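(* Let $H$ be a non-constant real meromorphic function in the plane with only real zeros and poles. Then any strictly non-real meromorphic solution in the plane of the equation $w''+Hw=0$ has at least one non-real zero.
   Context: For a meromorphic function $f$ in the plane $\mathbb{C}$, write $\widetilde f(z) = \overline{f(\bar z)}$, which is again meromorphic in the plane. The function $f$ is called real if $\widetilde f = f$, and (for $f$ non-constant) strictly non-real if $\widetilde f/f$ is non-constant. *)

theory Defs
  imports "HOL-Complex_Analysis.Complex_Analysis"
begin

text \<open>
  A meromorphic function in the plane is a function \<open>f :: complex \<Rightarrow> complex\<close> with
  \<open>f nicely_meromorphic_on UNIV\<close>: it has no removable singularities and is given the value \<open>0\<close>
  at its poles. Two such functions agree as meromorphic functions iff they are equal pointwise.
\<close>

definition schwarz_refl :: "(complex \<Rightarrow> complex) \<Rightarrow> complex \<Rightarrow> complex" where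
  "schwarz_refl f = (\<lambda>z. cnj (f (cnj z)))"

definition real_function :: "(complex \<Rightarrow> complex) \<Rightarrow> bool" where
  "real_function f \<longleftrightarrow> schwarz_refl f = f"

text \<open>
  The pointwise quotient has spurious values \<open>0\<close> where the denominator is \<open>0\<close>;
  \<^const>\<open>remove_sings\<close> turns it into the quotient in the field of meromorphic functions.
\<close>

definition strictly_non_real :: "(complex \<Rightarrow> complex) \<Rightarrow> bool" where
  "strictly_non_real f \<longleftrightarrow>
     \<not> f constant_on UNIV \<and>
     \<not> remove_sings (\<lambda>z. schwarz_refl f z / f z) constant_on UNIV"

text \<open>
  \<open>w'' + H w = 0\<close> as an identity of meromorphic functions: it is required at the points where
  neither \<open>w\<close> nor \<open>H\<close> has a pole, since \<^const>\<open>deriv\<close> and the value \<open>0\<close> carry no information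
  at poles.
\<close>

definition solves_ode :: "(complex \<Rightarrow> complex) \<Rightarrow> (complex \<Rightarrow> complex) \<Rightarrow> bool" where
  "solves_ode H w \<longleftrightarrow>
     (\<forall>z. \<not> is_pole w z \<longrightarrow> \<not> is_pole H z \<longrightarrow> (deriv ^^ 2) w z + H z * w z = 0)"

end

theory Submission
  imports Defs
begin

text \<open>
  Suppose that \<open>w\<close> has only real zeros. The equation is real, so \<open>v = schwarz_refl w\<close> solves it too.
  The Wronskian of \<open>w\<close> and \<open>v\<close> is a constant \<open>c\<close>, and \<open>c \<noteq> 0\<close> because \<open>v / w\<close> is not constant. At a
  real zero of \<open>w\<close> that is not a pole, \<open>v\<close> vanishes as well, which would give \<open>c = 0\<close>; so \<open>w\<close> has no
  zeros at all. Then \<open>v / w\<close> extends to an entire function without zeros, and \<open>w v\<close> is a constant multiple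
  of \<open>1 / k^2\<close> with \<open>k\<close> entire. The zeros of \<open>k\<close> are poles of \<open>w\<close>, hence of \<open>H\<close>, hence real, \<open>k^2\<close> is real
  on the real axis, and \<open>4 H k^2 = Q\<close> where \<open>Q = k^6 + 4 k k'' - 8 k'^2\<close>. It remains to see that \<open>Q\<close> has a
  non-real zero unless \<open>k\<close> is constant (\<open>constant_of_real_potential_zeros\<close>).

  \<^emph>\<open>Rescaling.\<close> All hypotheses on \<open>k\<close> survive the substitution \<open>s k(x + s^2 z)\<close> with \<open>x\<close> real and
  \<open>s > 0\<close>. Rescaling at well-chosen points (\<open>Zalcman_Brody_rescaling\<close>) produces a non-constant limit of
  exponential type, by the argument of Clunie and Hayman (\<open>Clunie_Hayman_bound\<close>). If the centres recede
  from the real axis, the limit has no zeros, so it is \<open>exp (\<alpha> z + \<beta>)\<close> and \<open>Q = k^2 (k^4 - 4 \<alpha>^2)\<close> has zeros.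
  Otherwise the limit satisfies the hypotheses again, and \<open>k\<close> may be assumed to be of exponential type.

  \<^emph>\<open>Real zeros.\<close> Such a \<open>k\<close> behaves like a real polynomial with real zeros times an exponential: the
  derivative of \<open>k' / k\<close> is the limit of the sums of \<open>- 1 / (z - a)^2\<close> over the zeros \<open>a\<close>
  (\<open>laguerre_inequality\<close>). It follows that the fourth derivative of \<open>Y = 1 / k^2\<close> has the sign of \<open>Y\<close> on the
  real axis. As \<open>Q / k^6 = 1 + Y'^2 - 2 Y Y''\<close> has derivative \<open>- 2 Y Y'''\<close>, Rolle's theorem leaves at most
  two zeros of \<open>Q\<close> in each interval free of zeros of \<open>k\<close> (\<open>no_three_potential_zeros_in_gap\<close>).

  \<^emph>\<open>Value distribution.\<close> Let \<open>J\<close> be the logarithmic derivative of \<open>Q / k^6\<close>. It has simple poles, located at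
  the zeros of \<open>k\<close> and \<open>Q\<close>, and \<open>k^6 J\<close> is \<open>k^2\<close> times a polynomial in logarithmic derivatives.
  On circles that keep away from all zeros logarithmic derivatives are \<open>O(r)\<close>, so \<open>4 log |k| \<le> - log |J| + O(log r)\<close>
  there, and the Jensen inequality bounds four times the mean of \<open>log+ |k|\<close> by the counting function of the zeros of
  \<open>k\<close> and \<open>Q\<close>, each zero counted once, up to \<open>O(log r)\<close> (\<open>milloux_inequality\<close>). By the previous paragraph this is at most three
  times the counting function of the zeros of \<open>k\<close>, hence three times the mean of \<open>log+ |k|\<close>. Therefore this mean
  is \<open>O(log r)\<close> and \<open>k\<close> is a polynomial, of some degree \<open>d \<ge> 1\<close>. Then \<open>J = O(z^(-4 d - 3))\<close> has at most
  \<open>3 d + 2\<close> poles, so \<open>J\<close> times the product of the \<open>z - a\<close> over its poles is entire and tends to \<open>0\<close>. This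
  forces \<open>J = 0\<close>, which is impossible (\<open>potential_wronskian_nonzero\<close>).
\<close>

section \<open>Consequences of the Schwarz lemma\<close>

lemma exp_form_on_ball:
  assumes "f holomorphic_on ball a d" "\<And>z. z \<in> ball a d \<Longrightarrow> f z \<noteq> 0"
  obtains h where "h holomorphic_on ball a d" "\<And>z. z \<in> ball a d \<Longrightarrow> f z = exp (h z)"
  by (rule contractible_imp_holomorphic_log[OF assms(1) convex_imp_contractible[OF convex_ball]])
     (use assms(2) that in auto)

lemma exp_form_on_plane:
  assumes "f holomorphic_on UNIV" "\<And>z. f z \<noteq> 0"
  obtains h where "h holomorphic_on UNIV" "\<And>z. f z = exp (h z)"
  by (rule contractible_imp_holomorphic_log[OF assms(1) convex_imp_contractible[OF convex_UNIV]])
     (use assms(2) that in auto)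

lemma Schwarz_ball:
  assumes "f holomorphic_on ball a d" "f a = 0" "d > 0"
    and "\<And>z. z \<in> ball a d \<Longrightarrow> norm (f z) < 1" and z: "z \<in> ball a d"
  shows "norm (f z) \<le> norm (z - a) / d" "norm (deriv f a) \<le> 1 / d"
proof -
  define \<phi> where "\<phi> = (\<lambda>w. f (a + of_real d * w))"
  have mem: "a + of_real d * w \<in> ball a d" if "norm w < 1" for w
    using that assms(3) by (simp add: dist_norm norm_mult)
  have hol: "\<phi> holomorphic_on ball 0 1"
    unfolding \<phi>_def
    by (rule holomorphic_on_compose_gen[OF _ assms(1), unfolded o_def])
       (use mem in \<open>auto intro!: holomorphic_intros\<close>)
  have z0: "\<phi> 0 = 0" using assms(2) by (simp add: \<phi>_def)
  have lt: "norm (\<phi> w) < 1" if "norm w < 1" for w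
    using assms(4)[OF mem[OF that]] by (simp add: \<phi>_def)
  have nz: "norm ((z - a) / of_real d) < 1"
    using z assms(3) by (simp add: norm_divide dist_norm norm_minus_commute)
  have "norm (\<phi> ((z - a) / of_real d)) \<le> norm ((z - a) / of_real d)"
    using Schwarz_Lemma(1)[OF hol z0 lt nz] .
  thus "norm (f z) \<le> norm (z - a) / d"
    using assms(3) by (simp add: \<phi>_def norm_divide)
  have "(f has_field_derivative deriv f a) (at a)"
    using assms(1,3) by (simp add: holomorphic_derivI)
  hence "(f has_field_derivative deriv f a) (at (a + of_real d * 0))" by simp
  note chain = DERIV_chain2[where f = f and g = "\<lambda>w. a + of_real d * w" and x = 0 and Db = "of_real d" and s = UNIV, OF this]
  have "(\<phi> has_field_derivative deriv f a * of_real d) (at 0)"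
    unfolding \<phi>_def by (rule chain) (auto intro!: derivative_eq_intros)
  hence "deriv \<phi> 0 = deriv f a * of_real d" by (rule DERIV_imp_deriv)
  moreover have "norm (deriv \<phi> 0) \<le> 1"
    using Schwarz_Lemma(2)[OF hol z0 lt nz] .
  ultimately show "norm (deriv f a) \<le> 1 / d"
    using assms(3) by (simp add: norm_mult field_simps)
qed

text \<open>
  The map \<open>(f - f a) / (f + cnj (f a))\<close> sends the ball into the unit disc and \<open>a\<close> to \<open>0\<close>, so both
  parts are the Schwarz lemma.
\<close>
lemma Harnack_inequality:
  assumes hol: "f holomorphic_on ball a d" and d: "d > 0"
    and pos: "\<And>z. z \<in> ball a d \<Longrightarrow> Re (f z) > 0" and z: "z \<in> ball a d"
  shows "Re (f a) * (d - norm (z - a)) / (d + norm (z - a)) \<le> Re (f z)"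
    and "norm (deriv f a) \<le> 2 * Re (f a) / d"
proof -
  define \<phi> where "\<phi> = (\<lambda>w. (f w - f a) / (f w + cnj (f a)))"
  have a: "a \<in> ball a d" using d by simp
  have nz: "f w + cnj (f a) \<noteq> 0" if "w \<in> ball a d" for w
  proof
    assume "f w + cnj (f a) = 0"
    hence "Re (f w) + Re (f a) = 0" by (metis complex_cnj cnj.simps(1) plus_complex.simps(1) zero_complex.simps(1))
    thus False using pos[OF that] pos[OF a] by simp
  qed
  have holp: "\<phi> holomorphic_on ball a d"
    unfolding \<phi>_def using hol nz by (auto intro!: holomorphic_intros)
  have lt: "norm (\<phi> w) < 1" if w: "w \<in> ball a d" for w
  proof -
    have "norm (f w - f a) ^ 2 < norm (f w + cnj (f a)) ^ 2"
      using mult_pos_pos[OF pos[OF w] pos[OF a]] unfolding cmod_power2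
      by (simp add: power2_eq_square algebra_simps)
    hence "norm (f w - f a) < norm (f w + cnj (f a))"
      by (rule power2_less_imp_less) simp
    thus ?thesis using nz[OF w] by (simp add: \<phi>_def norm_divide)
  qed
  have p0: "\<phi> a = 0" by (simp add: \<phi>_def)
  note S = Schwarz_ball[OF holp p0 d lt z]
  define s where "s = norm (z - a) / d"
  have s: "0 \<le> s" "s < 1" using z d by (auto simp: s_def dist_norm norm_minus_commute)
  have "norm (f z - f a) \<le> s * norm (f z + cnj (f a))"
    using S(1) nz[OF z] by (simp add: \<phi>_def norm_divide s_def divide_le_eq)
  hence "norm (f z - f a) ^ 2 \<le> (s * norm (f z + cnj (f a))) ^ 2"
    by (intro power_mono) auto
  hence "(Re (f z) - Re (f a))\<^sup>2 + (Im (f z) - Im (f a))\<^sup>2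
         \<le> s\<^sup>2 * ((Re (f z) + Re (f a))\<^sup>2 + (Im (f z) - Im (f a))\<^sup>2)"
    by (simp add: power_mult_distrib cmod_power2)
  moreover have "s\<^sup>2 * (Im (f z) - Im (f a))\<^sup>2 \<le> 1 * (Im (f z) - Im (f a))\<^sup>2"
    by (intro mult_right_mono) (use s in \<open>auto simp: power_le_one_iff\<close>)
  ultimately have "(Re (f z) - Re (f a))\<^sup>2 \<le> (s * (Re (f z) + Re (f a)))\<^sup>2"
    unfolding power_mult_distrib[of s] distrib_left[of "s\<^sup>2"] by linarith
  hence "\<bar>Re (f z) - Re (f a)\<bar> \<le> \<bar>s * (Re (f z) + Re (f a))\<bar>"
    by (simp add: abs_le_square_iff)
  hence "Re (f a) - Re (f z) \<le> s * (Re (f z) + Re (f a))"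
    using s pos[OF z] pos[OF a] by (auto simp: abs_mult)
  hence "Re (f a) * (1 - s) \<le> Re (f z) * (1 + s)" by (simp add: algebra_simps)
  hence "Re (f a) * (d * (1 - s)) \<le> Re (f z) * (d * (1 + s))"
    using d by (simp add: mult.left_commute)
  moreover have "d * (1 - s) = d - norm (z - a)" "d * (1 + s) = d + norm (z - a)"
    using d by (auto simp: s_def field_simps)
  ultimately show "Re (f a) * (d - norm (z - a)) / (d + norm (z - a)) \<le> Re (f z)"
    using d by (simp add: divide_le_eq add_pos_nonneg)
  have fd: "(f has_field_derivative deriv f a) (at a)"
    using hol d by (simp add: holomorphic_derivI)
  have nza: "f a + cnj (f a) \<noteq> 0" using nz[OF a] .
  have "(\<phi> has_field_derivative deriv f a / (f a + cnj (f a))) (at a)"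
    unfolding \<phi>_def by (rule derivative_eq_intros fd refl | use nza in \<open>simp add: power2_eq_square\<close>)+
  hence "deriv \<phi> a = deriv f a / (f a + cnj (f a))" by (rule DERIV_imp_deriv)
  moreover have "norm (f a + cnj (f a)) = 2 * Re (f a)"
    using pos[OF a] by (simp add: complex_add_cnj)
  ultimately show "norm (deriv f a) \<le> 2 * Re (f a) / d"
    using S(2) pos[OF a] d by (simp add: norm_divide field_simps)
qed

text \<open>
  The Schwarz lemma for \<open>f / (2 A - f)\<close>, which maps the half-plane \<open>Re < A\<close> to the unit disc.
\<close>
lemma Borel_Caratheodory_at:
  assumes hol: "f holomorphic_on ball a R" and R: "R > 0" and f0: "f a = 0" and A: "A > 0"
    and re: "\<And>z. z \<in> ball a R \<Longrightarrow> Re (f z) < A" and z: "z \<in> ball a R"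
  shows "norm (f z) \<le> 2 * A * norm (z - a) / (R - norm (z - a))"
proof -
  define \<phi> where "\<phi> = (\<lambda>w. f w / (2 * of_real A - f w))"
  have nz: "2 * of_real A - f w \<noteq> 0" if "w \<in> ball a R" for w
    using re[OF that] A by (auto simp: complex_eq_iff)
  have holp: "\<phi> holomorphic_on ball a R"
    unfolding \<phi>_def using hol nz by (auto intro!: holomorphic_intros)
  have lt: "norm (\<phi> w) < 1" if w: "w \<in> ball a R" for w
  proof -
    have "norm (2 * of_real A - f w) ^ 2 - norm (f w) ^ 2 = 4 * A * (A - Re (f w))"
      unfolding cmod_power2 by (simp add: power2_eq_square algebra_simps)
    moreover have "4 * A * (A - Re (f w)) > 0" using re[OF w] A by simp
    ultimately have "norm (f w) < norm (2 * of_real A - f w)"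
      by (intro power2_less_imp_less[OF _ norm_ge_zero]) linarith
    thus ?thesis using nz[OF w] by (simp add: \<phi>_def norm_divide)
  qed
  have "norm (\<phi> z) \<le> norm (z - a) / R"
    by (rule Schwarz_ball(1)[OF holp _ R lt z]) (simp add: \<phi>_def f0)
  hence "norm (f z) \<le> norm (z - a) / R * norm (2 * of_real A - f z)"
    using nz[OF z] by (simp add: \<phi>_def norm_divide divide_le_eq)
  also have "\<dots> \<le> norm (z - a) / R * (2 * A + norm (f z))"
    using norm_triangle_ineq4[of "2 * of_real A" "f z"] A R
    by (intro mult_left_mono) (auto simp: norm_mult)
  finally have "R * norm (f z) \<le> norm (z - a) * (2 * A + norm (f z))"
    using R by (simp add: field_simps)
  hence "norm (f z) * (R - norm (z - a)) \<le> 2 * A * norm (z - a)"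
    by (simp add: algebra_simps)
  moreover have "R - norm (z - a) > 0" using z by (simp add: dist_norm norm_minus_commute)
  ultimately show ?thesis by (simp add: le_divide_eq)
qed

section \<open>Means over circles and the Jensen inequality\<close>

lemma circle_mean_holomorphic:
  assumes "f holomorphic_on cball 0 r" "r > 0"
  shows "((\<lambda>t. f (circlepath 0 r t)) has_integral f 0) {0..1}"
proof -
  have "((\<lambda>u. f u / (u - 0)) has_contour_integral (2 * of_real pi * \<i> * f 0)) (circlepath 0 r)"
    by (rule Cauchy_integral_circlepath_simple) (use assms in auto)
  hence "((\<lambda>x. f (circlepath 0 r x) / circlepath 0 r x *
           vector_derivative (circlepath 0 r) (at x within {0..1})) has_integral
           (2 * of_real pi * \<i> * f 0)) {0..1}"
    by (simp add: has_contour_integral_def)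
  hence "((\<lambda>x. f (circlepath 0 r x) * (2 * of_real pi * \<i>)) has_integral
           (2 * of_real pi * \<i> * f 0)) {0..1}"
  proof (rule has_integral_eq[rotated])
    fix x :: real assume x: "x \<in> {0..1}"
    have "circlepath 0 r x = of_real r * exp (2 * of_real pi * \<i> * of_real x)"
      by (simp add: circlepath)
    thus "f (circlepath 0 r x) / circlepath 0 r x *
           vector_derivative (circlepath 0 r) (at x within {0..1}) =
          f (circlepath 0 r x) * (2 * of_real pi * \<i>)"
      using x assms by (simp add: vector_derivative_circlepath01)
  qed
  from has_integral_mult_left[OF this, of "1 / (2 * of_real pi * \<i>)"]
  show ?thesis by (simp add: field_simps)
qed

definition circle_mean :: "(complex \<Rightarrow> real) \<Rightarrow> real \<Rightarrow> real" where
  "circle_mean \<phi> r = integral {0..1} (\<lambda>t. \<phi> (circlepath 0 r t))"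

lemma circlepath_norm: "r > 0 \<Longrightarrow> norm (circlepath 0 r t) = r"
  by (simp add: circlepath norm_mult)

lemma circle_mean_integrable:
  fixes \<phi> :: "complex \<Rightarrow> real"
  assumes "continuous_on (sphere 0 r) \<phi>" "r > 0"
  shows "(\<lambda>t. \<phi> (circlepath 0 r t)) integrable_on {0..1}"
proof (rule integrable_continuous_real)
  have "continuous_on {0..1} (circlepath 0 r)"
    unfolding circlepath by (intro continuous_intros)
  moreover have "circlepath 0 r ` {0..1} \<subseteq> sphere 0 r"
    using assms(2) by (auto simp: circlepath_norm)
  ultimately show "continuous_on {0..1} (\<lambda>t. \<phi> (circlepath 0 r t))"
    by (rule continuous_on_compose2[OF assms(1)])
qed

lemma circle_mean_add:
  assumes "continuous_on (sphere 0 r) \<phi>" "continuous_on (sphere 0 r) \<psi>" "r > 0"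
  shows "circle_mean (\<lambda>z. \<phi> z + \<psi> z) r = circle_mean \<phi> r + circle_mean \<psi> r"
  unfolding circle_mean_def
  by (intro integral_add circle_mean_integrable assms)

lemma circle_mean_cmult: "circle_mean (\<lambda>z. c * \<phi> z) r = c * circle_mean \<phi> r"
  unfolding circle_mean_def by simp

lemma circle_mean_const [simp]: "circle_mean (\<lambda>_. c) r = c"
  unfolding circle_mean_def by simp

lemma circle_mean_mono:
  assumes "continuous_on (sphere 0 r) \<phi>" "continuous_on (sphere 0 r) \<psi>" "r > 0"
    and "\<And>z. norm z = r \<Longrightarrow> \<phi> z \<le> \<psi> z"
  shows "circle_mean \<phi> r \<le> circle_mean \<psi> r"
  unfolding circle_mean_def
  by (intro integral_le circle_mean_integrable assms) (auto simp: circlepath_norm assms)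

lemma circle_mean_cong:
  assumes "\<And>z. norm z = r \<Longrightarrow> \<phi> z = \<psi> z" "r > 0"
  shows "circle_mean \<phi> r = circle_mean \<psi> r"
  unfolding circle_mean_def
  by (intro integral_cong) (auto simp: circlepath_norm assms)

lemma circle_mean_Re:
  assumes "f holomorphic_on cball 0 r" "r > 0"
  shows "circle_mean (\<lambda>z. Re (f z)) r = Re (f 0)"
  using has_integral_Re[OF circle_mean_holomorphic[OF assms]]
  by (auto simp: circle_mean_def intro: integral_unique)

lemma open_nonzero:
  fixes f :: "complex \<Rightarrow> complex"
  assumes "f holomorphic_on UNIV"
  shows "open {z. f z \<noteq> 0}"
  using assms by (intro open_Collect_neq holomorphic_on_imp_continuous_on continuous_on_const) auto

lemma nonzero_nbhd_cball:
  fixes f :: "complex \<Rightarrow> complex"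
  assumes "f holomorphic_on UNIV" "\<And>z. z \<in> cball 0 r \<Longrightarrow> f z \<noteq> 0" "r > 0"
  obtains R where "R > r" "\<And>z. z \<in> ball 0 R \<Longrightarrow> f z \<noteq> 0"
proof -
  have "open {z. f z \<noteq> 0}" by (rule open_nonzero[OF assms(1)])
  moreover have "cball 0 r \<subseteq> {z. f z \<noteq> 0}" using assms(2) by auto
  ultimately obtain e where e: "e > 0" "(\<Union>z\<in>cball 0 r. ball z e) \<subseteq> {z. f z \<noteq> 0}"
    using compact_subset_open_imp_ball_epsilon_subset[OF compact_cball] by metis
  have "f z \<noteq> 0" if z: "z \<in> ball 0 (r + e)" for z
  proof (cases "norm z \<le> r")
    case True thus ?thesis using assms(2) by simp
  next
    case False
    define y where "y = of_real (r / norm z) * z"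
    have nz: "norm z > 0" using False assms(3) by linarith
    have ny: "norm y = r" using nz assms(3) by (simp add: y_def norm_mult norm_divide)
    have "z - y = of_real (1 - r / norm z) * z" by (simp add: y_def algebra_simps)
    hence "norm (z - y) = \<bar>1 - r / norm z\<bar> * norm z" by (simp add: norm_mult del: of_real_diff)
    moreover have "1 - r / norm z \<ge> 0" using False nz by simp
    ultimately have "norm (z - y) = norm z - r" using nz by (simp add: algebra_simps)
    with ny have "y \<in> cball 0 r" "z \<in> ball y e" using z by (auto simp: dist_norm norm_minus_commute)
    thus ?thesis using e(2) by blast
  qed
  thus ?thesis using that[of "r + e"] e(1) by auto
qed

lemma circle_mean_ln_zero_free:
  assumes "f holomorphic_on UNIV" "\<And>z. z \<in> cball 0 r \<Longrightarrow> f z \<noteq> 0" "r > 0"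
  shows "circle_mean (\<lambda>z. ln (norm (f z))) r = ln (norm (f 0))"
proof -
  obtain R where R: "R > r" "\<And>z. z \<in> ball 0 R \<Longrightarrow> f z \<noteq> 0"
    using nonzero_nbhd_cball[OF assms] by blast
  obtain h where h: "h holomorphic_on ball 0 R" "\<And>z. z \<in> ball 0 R \<Longrightarrow> f z = exp (h z)"
    using exp_form_on_ball[OF holomorphic_on_subset[OF assms(1) subset_UNIV] R(2)] by blast
  have eq: "ln (norm (f z)) = Re (h z)" if "norm z \<le> r" for z
    using that R(1) h(2)[of z] by simp
  have "circle_mean (\<lambda>z. ln (norm (f z))) r = circle_mean (\<lambda>z. Re (h z)) r"
    by (rule circle_mean_cong) (use assms(3) eq in auto)
  also have "\<dots> = Re (h 0)"
    by (rule circle_mean_Re[OF holomorphic_on_subset[OF h(1)]]) (use R assms in auto)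
  finally show ?thesis using eq[of 0] assms(3) by simp
qed

text \<open>
  On the circle \<open>|z - a|\<close> agrees with \<open>|r^2 - cnj a * z| / r\<close>, and this function has no zeros in the disc.
\<close>
lemma circle_mean_ln_linear:
  assumes "norm a < r"
  shows "circle_mean (\<lambda>z. ln (norm (z - a))) r = ln r"
proof -
  have r: "r > 0" using assms norm_ge_zero[of a] by linarith
  have eq: "norm (z - a) = norm ((of_real (r^2) - cnj a * z) / of_real r)" if "norm z = r" for z
  proof -
    have zz: "of_real (r^2) = cnj z * z"
      using that by (metis complex_norm_square mult.commute of_real_power)
    have "of_real (r^2) - cnj a * z = cnj (z - a) * z"
      unfolding zz by (simp add: algebra_simps)
    moreover have "norm (cnj (z - a)) = norm (z - a)" by (rule complex_mod_cnj)
    ultimately show ?thesis using that r by (simp add: norm_divide norm_mult del: complex_cnj_diff)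
  qed
  have "circle_mean (\<lambda>z. ln (norm (z - a))) r =
        circle_mean (\<lambda>z. ln (norm ((of_real (r^2) - cnj a * z) / of_real r))) r"
    by (rule circle_mean_cong) (use eq r in auto)
  also have "\<dots> = ln (norm ((of_real (r^2) - cnj a * 0) / of_real r :: complex))"
  proof (rule circle_mean_ln_zero_free[OF _ _ r])
    fix z :: complex assume "z \<in> cball 0 r"
    hence "norm (cnj a * z) \<le> norm a * r" by (auto simp: norm_mult intro: mult_left_mono)
    also have "\<dots> < r * r" using assms r by simp
    finally have "cnj a * z \<noteq> of_real (r^2)"
      using r by (metis less_irrefl norm_of_real abs_of_pos power2_eq_square zero_less_power)
    thus "(of_real (r^2) - cnj a * z) / of_real r \<noteq> 0" using r by auto
  qed (intro holomorphic_intros, use r in auto)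
  also have "\<dots> = ln r" using r by (simp add: norm_divide norm_power power2_eq_square)
  finally show ?thesis .
qed

lemma factor_zero_at:
  fixes f :: "complex \<Rightarrow> complex"
  assumes hol: "f holomorphic_on UNIV" and nz: "f z0 \<noteq> 0"
  obtains m g where "g holomorphic_on UNIV" "g a \<noteq> 0" "\<And>z. f z = (z - a) ^ m * g z"
proof (cases "f a = 0")
  case False
  thus ?thesis using that[of f 0] hol by simp
next
  case True
  have nc: "\<not> f constant_on UNIV" using True nz by (metis UNIV_I constant_on_def)
  obtain g0 r n where g0: "0 < n" "0 < r" "g0 holomorphic_on ball a r"
      "\<And>w. w \<in> ball a r \<Longrightarrow> f w = (w - a) ^ n * g0 w" "\<And>w. w \<in> ball a r \<Longrightarrow> g0 w \<noteq> 0"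
    using holomorphic_factor_zero_nonconstant[OF hol open_UNIV connected_UNIV UNIV_I True nc] by metis
  define g where "g = (\<lambda>z. if z \<in> ball a r then g0 z else f z / (z - a) ^ n)"
  have gb: "g z = g0 z" if "z \<in> ball a r" for z using that by (simp add: g_def)
  have gc: "g z = f z / (z - a) ^ n" if "z \<noteq> a" for z
    using that g0(4)[of z] by (auto simp: g_def)
  have "g holomorphic_on ball a r"
    by (rule holomorphic_transform[OF g0(3)]) (use gb in auto)
  moreover have "(\<lambda>z. f z / (z - a) ^ n) holomorphic_on -{a}"
    using hol by (auto intro!: holomorphic_intros intro: holomorphic_on_subset)
  hence "g holomorphic_on -{a}"
    using gc by (subst holomorphic_cong[OF refl, of _ _ "\<lambda>z. f z / (z - a) ^ n"]) auto
  ultimately have "g holomorphic_on (ball a r \<union> -{a})"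
    by (intro holomorphic_on_Un) auto
  moreover have "ball a r \<union> -{a} = UNIV" using g0(2) by auto
  ultimately have "g holomorphic_on UNIV" by simp
  moreover have "g a \<noteq> 0" using g0(2,5) gb by simp
  moreover have "f z = (z - a) ^ n * g z" for z
    using g0(2,4) gb[of z] gc[of z] by (cases "z = a") auto
  ultimately show ?thesis using that by blast
qed

text \<open>
  The exponent \<open>m a\<close> is the multiplicity of \<open>a\<close>; points of \<open>A\<close> that are not zeros get exponent \<open>0\<close>.
\<close>
lemma factor_zeros:
  fixes f :: "complex \<Rightarrow> complex"
  assumes "finite A" and hol: "f holomorphic_on UNIV" and nz: "f z0 \<noteq> 0"
  obtains m g where "g holomorphic_on UNIV" "\<And>a. a \<in> A \<Longrightarrow> g a \<noteq> 0"
    "\<And>z. f z = (\<Prod>a\<in>A. (z - a) ^ m a) * g z"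
proof -
  have "\<exists>m g. g holomorphic_on UNIV \<and> (\<forall>a\<in>A. g a \<noteq> 0) \<and> (\<forall>z. f z = (\<Prod>a\<in>A. (z - a) ^ m a) * g z)"
    using assms(1) hol nz
  proof (induction A arbitrary: f)
    case empty
    thus ?case by auto
  next
    case (insert a A)
    obtain n g where g: "g holomorphic_on UNIV" "g a \<noteq> 0" "\<And>z. f z = (z - a) ^ n * g z"
      using factor_zero_at[OF insert.prems] by metis
    have "g z0 \<noteq> 0" using insert.prems(2) g(3) by auto
    from insert.IH[OF g(1) this] obtain m k where k: "k holomorphic_on UNIV" "\<forall>a\<in>A. k a \<noteq> 0"
      "\<And>z. g z = (\<Prod>a\<in>A. (z - a) ^ m a) * k z" by blast
    have "k a \<noteq> 0" using g(2) k(3)[of a] by auto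
    moreover have "f z = (\<Prod>b\<in>insert a A. (z - b) ^ (m(a := n)) b) * k z" for z
    proof -
      have "(\<Prod>b\<in>A. (z - b) ^ (m(a := n)) b) = (\<Prod>b\<in>A. (z - b) ^ m b)"
        using insert.hyps by (intro prod.cong) auto
      thus ?thesis using insert.hyps by (simp add: g(3) k(3) mult.assoc)
    qed
    ultimately show ?case using k(1,2) by (metis insert_iff)
  qed
  thus ?thesis using that by blast
qed

lemma finite_zeros_cball:
  fixes f :: "complex \<Rightarrow> complex"
  assumes "f holomorphic_on UNIV" "f z0 \<noteq> 0"
  shows "finite {z \<in> cball 0 r. f z = 0}"
proof (cases "f constant_on UNIV")
  case True
  hence eq: "f z = f z0" for z by (metis UNIV_I constant_on_def)
  have "f z \<noteq> 0" for z using eq[of z] assms(2) by simp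
  hence "{z \<in> cball 0 r. f z = 0} = {}" by auto
  thus ?thesis by (simp only: finite.emptyI)
next
  case False
  thus ?thesis
    using holomorphic_compact_finite_zeros[OF assms(1) open_UNIV connected_UNIV compact_cball subset_UNIV]
    by blast
qed

lemma circle_mean_sum:
  assumes "finite A" "\<And>a. a \<in> A \<Longrightarrow> continuous_on (sphere 0 r) (\<phi> a)" "r > 0"
  shows "circle_mean (\<lambda>z. \<Sum>a\<in>A. \<phi> a z) r = (\<Sum>a\<in>A. circle_mean (\<phi> a) r)"
  unfolding circle_mean_def
  using assms by (intro integral_sum circle_mean_integrable) auto

lemma continuous_on_ln_norm:
  assumes "f holomorphic_on UNIV" "\<And>z. z \<in> S \<Longrightarrow> f z \<noteq> 0"
  shows "continuous_on S (\<lambda>z. ln (norm (f z)))"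
  using assms by (intro continuous_intros holomorphic_on_imp_continuous_on)
    (auto intro: holomorphic_on_subset)

text \<open>
  The Jensen formula with each zero of \<open>B\<close> counted once. Splitting off the zeros in the disc reduces it to
  the mean value property for \<open>ln |z - a|\<close> and for a zero-free factor.
\<close>
lemma Jensen_inequality:
  fixes f :: "complex \<Rightarrow> complex"
  assumes hol: "f holomorphic_on UNIV" and sph: "\<And>z. norm z = r \<Longrightarrow> f z \<noteq> 0" and f0: "f 0 \<noteq> 0"
    and r: "r > 0" and B: "B \<subseteq> {z \<in> ball 0 r. f z = 0}"
  shows "ln (norm (f 0)) + (\<Sum>a\<in>B. ln (r / norm a)) \<le> circle_mean (\<lambda>z. ln (norm (f z))) r"
proof -
  define A where "A = {z \<in> ball 0 r. f z = 0}"
  have finA: "finite A"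
    by (rule finite_subset[OF _ finite_zeros_cball[OF hol f0, of r]]) (auto simp: A_def)
  obtain m g where g: "g holomorphic_on UNIV" "\<And>a. a \<in> A \<Longrightarrow> g a \<noteq> 0"
    "\<And>z. f z = (\<Prod>a\<in>A. (z - a) ^ m a) * g z"
    using factor_zeros[OF finA hol f0] by metis
  have A0: "norm a < r" "a \<noteq> 0" if "a \<in> A" for a using that f0 by (auto simp: A_def)
  have g_nz: "g z \<noteq> 0" if "z \<in> cball 0 r" for z
  proof (cases "z \<in> A")
    case False
    hence "f z \<noteq> 0" using that sph[of z] by (auto simp: A_def)
    thus ?thesis using g(3)[of z] by auto
  qed (use g in auto)
  have lnf: "ln (norm (f z)) = (\<Sum>a\<in>A. real (m a) * ln (norm (z - a))) + ln (norm (g z))"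
    if z: "\<And>a. a \<in> A \<Longrightarrow> z \<noteq> a" "g z \<noteq> 0" for z
  proof -
    have "norm (f z) = (\<Prod>a\<in>A. norm (z - a) ^ m a) * norm (g z)"
      by (simp add: g(3) norm_mult norm_power flip: prod_norm)
    moreover have "(\<Prod>a\<in>A. norm (z - a) ^ m a) > 0"
      using z by (intro prod_pos) auto
    ultimately have "ln (norm (f z)) = ln (\<Prod>a\<in>A. norm (z - a) ^ m a) + ln (norm (g z))"
      using z by (simp add: ln_mult)
    also have "ln (\<Prod>a\<in>A. norm (z - a) ^ m a) = (\<Sum>a\<in>A. ln (norm (z - a) ^ m a))"
      using z finA by (intro ln_prod) auto
    finally show ?thesis using z by (simp add: ln_realpow)
  qed
  have c1: "continuous_on (sphere 0 r) (\<lambda>z. real (m a) * ln (norm (z - a)))" if "a \<in> A" for a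
    using A0[OF that] by (intro continuous_intros) auto
  have "circle_mean (\<lambda>z. ln (norm (f z))) r =
        circle_mean (\<lambda>z. (\<Sum>a\<in>A. real (m a) * ln (norm (z - a))) + ln (norm (g z))) r"
  proof (rule circle_mean_cong[OF _ r], rule lnf)
    fix z :: complex assume z: "norm z = r"
    show "g z \<noteq> 0" using g_nz[of z] z by simp
    show "z \<noteq> a" if "a \<in> A" for a using A0(1)[OF that] z by auto
  qed
  also have "\<dots> = circle_mean (\<lambda>z. \<Sum>a\<in>A. real (m a) * ln (norm (z - a))) r
                 + circle_mean (\<lambda>z. ln (norm (g z))) r"
    by (intro circle_mean_add r continuous_on_sum c1 continuous_on_ln_norm g(1)) (use g_nz in auto)
  also have "circle_mean (\<lambda>z. ln (norm (g z))) r = ln (norm (g 0))"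
    by (rule circle_mean_ln_zero_free[OF g(1) g_nz r])
  also have "circle_mean (\<lambda>z. \<Sum>a\<in>A. real (m a) * ln (norm (z - a))) r
             = (\<Sum>a\<in>A. real (m a) * ln r)"
    by (subst circle_mean_sum[OF finA c1 r])
       (auto simp: circle_mean_cmult circle_mean_ln_linear A0)
  finally have 1: "circle_mean (\<lambda>z. ln (norm (f z))) r = (\<Sum>a\<in>A. real (m a) * ln r) + ln (norm (g 0))" .
  have 2: "ln (norm (f 0)) = (\<Sum>a\<in>A. real (m a) * ln (norm a)) + ln (norm (g 0))"
    using lnf[of 0] A0 g_nz[of 0] r by (force simp: norm_minus_commute)
  have m1: "m a \<ge> 1" if "a \<in> A" for a
  proof (rule ccontr)
    assume "\<not> m a \<ge> 1"
    hence "(\<Prod>b\<in>A. (a - b) ^ m b) \<noteq> 0" using finA by auto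
    thus False using g(3)[of a] g(2)[OF that] that by (auto simp: A_def)
  qed
  have pos: "ln (r / norm a) \<ge> 0" if "a \<in> A" for a
    using A0[OF that] by simp
  have "(\<Sum>a\<in>B. ln (r / norm a)) \<le> (\<Sum>a\<in>A. ln (r / norm a))"
    using finA B pos by (intro sum_mono2) (auto simp: A_def)
  also have "\<dots> \<le> (\<Sum>a\<in>A. real (m a) * ln (r / norm a))"
  proof (rule sum_mono)
    fix a assume a: "a \<in> A"
    have "1 * ln (r / norm a) \<le> real (m a) * ln (r / norm a)"
      using m1[OF a] pos[OF a] by (intro mult_right_mono) auto
    thus "ln (r / norm a) \<le> real (m a) * ln (r / norm a)" by simp
  qed
  also have "\<dots> = (\<Sum>a\<in>A. real (m a) * ln r) - (\<Sum>a\<in>A. real (m a) * ln (norm a))"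
    unfolding sum_subtractf[symmetric]
    by (intro sum.cong) (use A0 r in \<open>auto simp: ln_div algebra_simps\<close>)
  finally show ?thesis using 1 2 by linarith
qed

section \<open>Entire functions of exponential type\<close>

text \<open>
  Writing \<open>1 + norm z\<close> in the exponent absorbs multiplicative constants, which makes closure under
  sums, products and derivatives immediate.
\<close>
definition exp_type :: "(complex \<Rightarrow> complex) \<Rightarrow> bool" where
  "exp_type f \<longleftrightarrow> f holomorphic_on UNIV \<and> (\<exists>B\<ge>0. \<forall>z. norm (f z) \<le> exp (B * (1 + norm z)))"

lemma exp_type_holomorphic: "exp_type f \<Longrightarrow> f holomorphic_on UNIV"
  by (simp add: exp_type_def)

lemma exp_typeE:
  assumes "exp_type f"
  obtains B where "B \<ge> 0" "\<And>z. norm (f z) \<le> exp (B * (1 + norm z))"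
  using assms by (auto simp: exp_type_def)

lemma exp_type_const: "exp_type (\<lambda>_. c)"
proof -
  have "norm c \<le> exp (norm c * (1 + norm z))" for z :: complex
  proof -
    have "norm c \<le> exp (norm c)" using exp_ge_add_one_self[of "norm c"] by linarith
    also have "\<dots> \<le> exp (norm c * (1 + norm z))" by (simp add: algebra_simps)
    finally show ?thesis .
  qed
  thus ?thesis unfolding exp_type_def by (intro conjI exI[of _ "norm c"]) auto
qed

lemma exp_type_mult:
  assumes "exp_type f" "exp_type g"
  shows "exp_type (\<lambda>z. f z * g z)"
proof -
  obtain B where B: "B \<ge> 0" "\<And>z. norm (f z) \<le> exp (B * (1 + norm z))" using exp_typeE[OF assms(1)] by metis
  obtain C where C: "C \<ge> 0" "\<And>z. norm (g z) \<le> exp (C * (1 + norm z))" using exp_typeE[OF assms(2)] by metis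
  have "norm (f z * g z) \<le> exp ((B + C) * (1 + norm z))" for z
    unfolding norm_mult distrib_right exp_add by (intro mult_mono B C) auto
  thus ?thesis using B(1) C(1) assms
    unfolding exp_type_def by (intro conjI exI[of _ "B + C"] holomorphic_on_mult) auto
qed

lemma exp_type_add:
  assumes "exp_type f" "exp_type g"
  shows "exp_type (\<lambda>z. f z + g z)"
proof -
  obtain B where B: "B \<ge> 0" "\<And>z. norm (f z) \<le> exp (B * (1 + norm z))" using exp_typeE[OF assms(1)] by metis
  obtain C where C: "C \<ge> 0" "\<And>z. norm (g z) \<le> exp (C * (1 + norm z))" using exp_typeE[OF assms(2)] by metis
  have "norm (f z + g z) \<le> exp ((B + C + 1) * (1 + norm z))" for z
  proof -
    have "norm (f z + g z) \<le> exp (B * (1 + norm z)) + exp (C * (1 + norm z))"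
      using B(2)[of z] C(2)[of z] norm_triangle_ineq[of "f z" "g z"] by linarith
    also have "\<dots> \<le> exp ((B + C) * (1 + norm z)) + exp ((B + C) * (1 + norm z))"
      using B(1) C(1) by (intro add_mono) (auto intro!: mult_right_mono)
    also have "\<dots> = 2 * exp ((B + C) * (1 + norm z))" by simp
    also have "2 \<le> exp (1 + norm z)" using exp_ge_add_one_self[of "1 + norm z"] norm_ge_zero[of z] by linarith
    finally have "norm (f z + g z) \<le> exp (1 + norm z) * exp ((B + C) * (1 + norm z))" by simp
    also have "\<dots> = exp ((B + C + 1) * (1 + norm z))" by (simp add: exp_add[symmetric] algebra_simps)
    finally show ?thesis .
  qed
  thus ?thesis using B(1) C(1) assms
    unfolding exp_type_def by (intro conjI exI[of _ "B + C + 1"] holomorphic_on_add) auto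
qed

lemma exp_type_cmult: "exp_type f \<Longrightarrow> exp_type (\<lambda>z. c * f z)"
  by (intro exp_type_mult exp_type_const)

lemma exp_type_diff:
  assumes "exp_type f" "exp_type g"
  shows "exp_type (\<lambda>z. f z - g z)"
  using exp_type_add[OF assms(1) exp_type_cmult[OF assms(2), of "-1"]] by simp

lemma exp_type_power: "exp_type f \<Longrightarrow> exp_type (\<lambda>z. f z ^ n)"
  by (induction n) (auto intro: exp_type_const exp_type_mult)

lemma exp_type_deriv:
  assumes "exp_type f"
  shows "exp_type (deriv f)"
proof -
  obtain B where B: "B \<ge> 0" "\<And>z. norm (f z) \<le> exp (B * (1 + norm z))" using exp_typeE[OF assms(1)] by metis
  have hol: "f holomorphic_on S" for S
    using assms exp_type_holomorphic holomorphic_on_subset by blast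
  have "norm (deriv f z) \<le> exp ((2 * B) * (1 + norm z))" for z
  proof -
    have "norm ((deriv ^^ 1) f z) \<le> fact 1 * exp (B * (2 + norm z)) / 1 ^ 1"
    proof (rule Cauchy_inequality[OF hol])
      fix x assume x: "norm (z - x) = 1"
      have "norm x \<le> norm z + 1" using x norm_triangle_ineq2[of x z] by (simp add: norm_minus_commute)
      hence "exp (B * (1 + norm x)) \<le> exp (B * (2 + norm z))"
        using B(1) by (auto intro!: mult_left_mono)
      thus "norm (f x) \<le> exp (B * (2 + norm z))" using B(2)[of x] by linarith
    qed (auto intro: holomorphic_on_imp_continuous_on hol)
    also have "B * (2 + norm z) \<le> B * (2 * (1 + norm z))"
      using B(1) by (intro mult_left_mono) auto
    finally show ?thesis by (simp add: mult_ac)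
  qed
  thus ?thesis using B(1) hol
    unfolding exp_type_def by (intro conjI exI[of _ "2 * B"] holomorphic_deriv) auto
qed

text \<open>
  A finite substitute for the Hadamard factorization: on the disc of radius \<open>R\<close> the function is a polynomial
  times \<open>exp h\<close>, with the number of zeros and the oscillation of \<open>h\<close> growing at most linearly in \<open>R\<close>. By the
  Cauchy estimates the second and higher derivatives of \<open>h\<close> then tend to \<open>0\<close> as \<open>R\<close> grows.
\<close>
definition local_factorization ::
  "(complex \<Rightarrow> complex) \<Rightarrow> real \<Rightarrow> real \<Rightarrow> (complex \<Rightarrow> nat) \<Rightarrow> (complex \<Rightarrow> complex) \<Rightarrow> bool" where
  "local_factorization f C R m h \<longleftrightarrow>
     (\<Sum>a | a \<in> cball 0 R \<and> f a = 0. real (m a)) \<le> C * R \<and>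
     (\<forall>a. f a = 0 \<longrightarrow> m a \<ge> 1) \<and> h holomorphic_on ball 0 R \<and>
     (\<forall>z\<in>ball 0 R. f z = (\<Prod>a | a \<in> cball 0 R \<and> f a = 0. (z - a) ^ m a) * exp (h z)) \<and>
     (\<forall>z. norm z \<le> 3 / 4 * R \<longrightarrow> norm (h z - h 0) \<le> C * R)"

text \<open>
  Divide \<open>f\<close> by the polynomial of its zeros in \<open>cball 0 R\<close>. On the circle of radius \<open>3 R\<close> every factor
  \<open>z - a\<close> is at least \<open>2 R\<close>, while at \<open>0\<close> it is at most \<open>R\<close>; the maximum principle therefore
  bounds the quotient relative to its value at \<open>0\<close> by \<open>exp (K R) / 2 ^ M\<close>, where \<open>M\<close> counts the zeros.
  Evaluated at \<open>0\<close> this bounds \<open>M\<close>, and the lemma of Borel and Caratheodory bounds the logarithm of the quotient.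
\<close>
lemma exp_type_local_factor:
  assumes "exp_type f" "f 0 \<noteq> 0"
  obtains C where "C > 0"
    "\<And>R. R \<ge> 1 \<Longrightarrow> \<exists>m h. local_factorization f C R m h"
proof -
  have hol: "f holomorphic_on UNIV" using assms exp_type_holomorphic by blast
  obtain B where B: "B \<ge> 0" "\<And>z. norm (f z) \<le> exp (B * (1 + norm z))" using exp_typeE[OF assms(1)] by metis
  define K where "K = 4 * B + \<bar>ln (norm (f 0))\<bar>"
  have K0: "K \<ge> 0" using B by (simp add: K_def)
  show thesis
  proof (rule that[of "6 * (K + 1)"])
    show "6 * (K + 1) > 0" using K0 by simp
    fix R :: real assume R: "R \<ge> 1"
    define A where "A = {a \<in> cball 0 R. f a = 0}"
    have finA: "finite A" unfolding A_def by (rule finite_zeros_cball[OF hol assms(2)])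
    obtain m g where g: "g holomorphic_on UNIV" "\<And>a. a \<in> A \<Longrightarrow> g a \<noteq> 0"
      "\<And>z. f z = (\<Prod>a\<in>A. (z - a) ^ m a) * g z"
      using factor_zeros[OF finA hol assms(2)] by metis
    have m1: "m a \<ge> 1" if "a \<in> A" for a
    proof (rule ccontr)
      assume "\<not> m a \<ge> 1"
      hence "(\<Prod>b\<in>A. (a - b) ^ m b) \<noteq> 0" using finA by auto
      thus False using g(3)[of a] g(2)[OF that] that by (auto simp: A_def)
    qed
    define M where "M = (\<Sum>a\<in>A. m a)"
    have g_nz: "g z \<noteq> 0" if "z \<in> ball 0 R" for z
    proof (cases "z \<in> A")
      case False
      hence "f z \<noteq> 0" using that by (auto simp: A_def)
      thus ?thesis using g(3)[of z] by auto
    qed (use g in auto)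
    have g0: "g 0 \<noteq> 0" using R g_nz[of 0] by simp
    have f0: "norm (f 0) \<le> R ^ M * norm (g 0)"
    proof -
      have "norm (f 0) = (\<Prod>a\<in>A. norm a ^ m a) * norm (g 0)"
        by (simp add: g(3) norm_mult norm_power flip: prod_norm)
      also have "(\<Prod>a\<in>A. norm a ^ m a) \<le> (\<Prod>a\<in>A. R ^ m a)"
        by (intro prod_mono conjI power_mono) (auto simp: A_def)
      also have "\<dots> = R ^ M" by (simp add: M_def power_sum)
      finally show ?thesis by (simp add: mult_right_mono)
    qed
    have gb: "norm (g z) \<le> exp (B * (1 + 3 * R)) / (2 * R) ^ M" if z: "z \<in> cball 0 (3 * R)" for z
    proof (rule maximum_modulus_frontier[of g "cball 0 (3 * R)"])
      fix w :: complex assume "w \<in> frontier (cball 0 (3 * R))"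
      hence w: "norm w = 3 * R" using R by (simp add: frontier_cball)
      have "(2 * R) ^ M = (\<Prod>a\<in>A. (2 * R) ^ m a)" by (simp add: M_def power_sum)
      also have "\<dots> \<le> (\<Prod>a\<in>A. norm (w - a) ^ m a)"
      proof (intro prod_mono conjI power_mono)
        fix a assume "a \<in> A"
        hence "norm a \<le> R" by (simp add: A_def)
        thus "2 * R \<le> norm (w - a)" using w norm_triangle_ineq2[of w a] by linarith
      qed (use R in auto)
      finally have "(2 * R) ^ M * norm (g w) \<le> norm (f w)"
        by (simp add: g(3) norm_mult norm_power mult_right_mono flip: prod_norm)
      also have "\<dots> \<le> exp (B * (1 + 3 * R))" using B(2)[of w] w by simp
      finally show "norm (g w) \<le> exp (B * (1 + 3 * R)) / (2 * R) ^ M"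
        using R by (simp add: field_simps)
    qed (use z g(1) in \<open>auto intro: holomorphic_on_subset holomorphic_on_imp_continuous_on\<close>)
    have ratio: "norm (g z) / norm (g 0) \<le> exp (K * R) / 2 ^ M" if z: "z \<in> cball 0 (3 * R)" for z
    proof -
      have "norm (g z) / norm (g 0) \<le> (exp (B * (1 + 3 * R)) / (2 * R) ^ M) / (norm (f 0) / R ^ M)"
        using f0 gb[OF z] assms(2) R by (intro frac_le) (auto simp: field_simps)
      also have "\<dots> = exp (B * (1 + 3 * R)) / norm (f 0) / 2 ^ M"
        using R by (simp add: power_mult_distrib)
      also have "exp (B * (1 + 3 * R)) / norm (f 0) = exp (B * (1 + 3 * R) - ln (norm (f 0)))"
        using assms(2) by (simp add: exp_diff)
      also have "B * (1 + 3 * R) - ln (norm (f 0)) \<le> K * R"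
      proof -
        have "B * (1 + 3 * R) \<le> B * (4 * R)" using B(1) R by (intro mult_left_mono) auto
        moreover have "1 * \<bar>ln (norm (f 0))\<bar> \<le> R * \<bar>ln (norm (f 0))\<bar>" using R by (intro mult_right_mono) auto
        ultimately show ?thesis by (simp add: K_def algebra_simps)
      qed
      finally show ?thesis by (simp add: divide_right_mono)
    qed
    have "2 ^ M \<le> exp (K * R)" using ratio[of 0] R g0 by (simp add: field_simps)
    hence "ln (2 ^ M) \<le> K * R" by (metis ln_exp ln_mono exp_gt_zero zero_less_power zero_less_numeral)
    hence "real M * ln 2 \<le> K * R" by (simp add: ln_realpow)
    moreover have "real M * (1 / 2) \<le> real M * ln 2"
      using ln2_ge_two_thirds by (intro mult_left_mono) auto
    ultimately have "real M \<le> 2 * (K * R)" by linarith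
    also have "\<dots> \<le> 6 * (K + 1) * R" using K0 R by (simp add: algebra_simps)
    finally have Mle: "(\<Sum>a\<in>A. real (m a)) \<le> 6 * (K + 1) * R" by (simp add: M_def)
    obtain h where h: "h holomorphic_on ball 0 R" "\<And>z. z \<in> ball 0 R \<Longrightarrow> g z = exp (h z)"
      using exp_form_on_ball[OF holomorphic_on_subset[OF g(1) subset_UNIV] g_nz] by blast
    have re: "Re (h z - h 0) < (K + 1) * R" if z: "z \<in> ball 0 R" for z
    proof -
      have "exp (Re (h z - h 0)) = norm (g z) / norm (g 0)"
        using z R by (simp add: h(2) exp_diff)
      also have "\<dots> \<le> exp (K * R) / 2 ^ M" using z R by (intro ratio) auto
      also have "\<dots> \<le> exp (K * R)" by (simp add: divide_le_eq)
      finally have "Re (h z - h 0) \<le> K * R" by simp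
      thus ?thesis using R by (simp add: algebra_simps)
    qed
    have hb: "norm (h z - h 0) \<le> 6 * (K + 1) * R" if z: "norm z \<le> 3 / 4 * R" for z
    proof -
      have "norm (h z - h 0) \<le> 2 * ((K + 1) * R) * norm (z - 0) / (R - norm (z - 0))"
        by (rule Borel_Caratheodory_at[of "\<lambda>z. h z - h 0"])
           (use re R K0 h(1) z in \<open>auto intro!: holomorphic_intros\<close>)
      also have "\<dots> \<le> 2 * ((K + 1) * R) * (3 / 4 * R) / (1 / 4 * R)"
        using z R K0 by (intro frac_le mult_left_mono mult_nonneg_nonneg) auto
      also have "\<dots> = 6 * (K + 1) * R" using R by simp
      finally show ?thesis .
    qed
    show "\<exists>m h. local_factorization f (6 * (K + 1)) R m h"
    proof (intro exI[of _ "\<lambda>a. max 1 (m a)"] exI[of _ h], unfold local_factorization_def, intro conjI ballI allI impI)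
      have mm: "max 1 (m a) = m a" if "a \<in> A" for a using m1[OF that] by simp
      show "(\<Sum>a | a \<in> cball 0 R \<and> f a = 0. real (max 1 (m a))) \<le> 6 * (K + 1) * R"
        using Mle mm unfolding A_def[symmetric] by simp
      fix z :: complex assume z: "z \<in> ball 0 R"
      show "f z = (\<Prod>a | a \<in> cball 0 R \<and> f a = 0. (z - a) ^ max 1 (m a)) * exp (h z)"
        unfolding A_def[symmetric] using g(3)[of z] h(2)[OF z] mm by simp
    qed (use h hb in auto)
  qed
qed

lemma deriv_prod_power_exp:
  fixes A :: "complex set"
  assumes "finite A" "S = (\<lambda>z. \<Prod>a\<in>A. (z - a) ^ m a)" "z \<notin> A"
  shows "(S has_field_derivative S z * (\<Sum>a\<in>A. of_nat (m a) / (z - a))) (at z)"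
proof -
  have "((\<lambda>z. \<Prod>a\<in>A. (z - a) ^ m a) has_field_derivative
          (\<Prod>a\<in>A. (z - a) ^ m a) * (\<Sum>a\<in>A. of_nat (m a) / (z - a))) (at z)"
    using assms(1,3)
  proof (induction A)
    case (insert a A)
    have za: "z - a \<noteq> 0" using insert.prems by auto
    have "((\<lambda>z. (z - a) ^ m a) has_field_derivative (z - a) ^ m a * (of_nat (m a) / (z - a))) (at z)"
    proof (cases "m a")
      case (Suc n)
      have "((\<lambda>z. (z - a) ^ m a) has_field_derivative of_nat (m a) * (z - a) ^ (m a - 1)) (at z)"
        by (auto intro!: derivative_eq_intros)
      moreover have "of_nat (m a) * (z - a) ^ (m a - 1) = (z - a) ^ m a * (of_nat (m a) / (z - a))"
        unfolding Suc using za by simp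
      ultimately show ?thesis by simp
    qed auto
    from DERIV_mult[OF this insert.IH] insert show ?case
      by (auto simp: algebra_simps)
  qed auto
  thus ?thesis by (simp add: assms(2))
qed

lemma logderiv_factored:
  fixes A :: "complex set"
  assumes "finite A" "h holomorphic_on U" "open U" "z \<in> U"
    "\<And>w. w \<in> U \<Longrightarrow> f w = (\<Prod>a\<in>A. (w - a) ^ m a) * exp (h w)" "z \<notin> A"
  shows "deriv f z = f z * ((\<Sum>a\<in>A. of_nat (m a) / (z - a)) + deriv h z)"
proof -
  have "(h has_field_derivative deriv h z) (at z)" using assms by (simp add: holomorphic_derivI)
  hence "((\<lambda>w. exp (h w)) has_field_derivative exp (h z) * deriv h z) (at z)"
    by (rule DERIV_fun_exp)
  from DERIV_mult[OF deriv_prod_power_exp[OF assms(1) refl assms(6), of m] this]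
  have "((\<lambda>w. (\<Prod>a\<in>A. (w - a) ^ m a) * exp (h w)) has_field_derivative
       f z * ((\<Sum>a\<in>A. of_nat (m a) / (z - a)) + deriv h z)) (at z)"
    by (simp add: assms(5)[OF assms(4)] algebra_simps)
  hence "(f has_field_derivative f z * ((\<Sum>a\<in>A. of_nat (m a) / (z - a)) + deriv h z)) (at z)"
    by (rule has_field_derivative_transform_within_open[OF _ assms(3,4)]) (simp add: assms(5))
  thus ?thesis by (rule DERIV_imp_deriv)
qed

lemma zero_mult_pos:
  assumes "\<forall>a. f a = 0 \<longrightarrow> m a \<ge> (1::nat)"
  shows "real (card {a \<in> cball 0 R. f a = 0}) \<le> (\<Sum>a | a \<in> cball 0 R \<and> f a = (0::complex). real (m a))"
proof -
  have "(\<Sum>a | a \<in> cball 0 R \<and> f a = 0. 1) \<le> (\<Sum>a | a \<in> cball 0 R \<and> f a = (0::complex). real (m a))"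
    using assms by (intro sum_mono) (metis (mono_tags, lifting) mem_Collect_eq of_nat_1 of_nat_mono)
  thus ?thesis by simp
qed

text \<open>
  There are \<open>O(R)\<close> zeros in the relevant annulus, hence some circle in it keeps a fixed distance from all
  of them. Such circles replace the lemma on the logarithmic derivative (see \<open>logderiv_bound\<close>).
\<close>
lemma radius_avoiding_zeros:
  assumes "exp_type F" "F 0 \<noteq> 0"
  obtains \<delta> where "\<delta> > 0"
    "\<And>R. R \<ge> 1 \<Longrightarrow> \<exists>r\<in>{R..2*R}. \<forall>a. F a = 0 \<longrightarrow> \<delta> \<le> \<bar>norm a - r\<bar>"
proof -
  obtain C where C: "C > 0" and loc: 
    "\<And>R. R \<ge> 1 \<Longrightarrow> \<exists>m h. local_factorization F C R m h"
    using exp_type_local_factor[OF assms] by blast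
  define \<delta> where "\<delta> = 1 / (2 * (4 * C + 1))"
  have \<delta>: "\<delta> > 0" "\<delta> \<le> 1" using C by (auto simp: \<delta>_def field_simps)
  show thesis
  proof (rule that[OF \<delta>(1)], rule ccontr)
    fix R :: real assume R: "R \<ge> 1"
    define A where "A = {a \<in> cball 0 (4 * R). F a = 0}"
    have finA: "finite A" unfolding A_def
      by (rule finite_zeros_cball[OF exp_type_holomorphic[OF assms(1)] assms(2)])
    define n where "n = card A"
    have "real n \<le> C * (4 * R)"
    proof -
      obtain m :: "complex \<Rightarrow> nat" where m: "(\<Sum>a | a \<in> cball 0 (4*R) \<and> F a = 0. real (m a)) \<le> C * (4*R)"
        "\<forall>a. F a = 0 \<longrightarrow> m a \<ge> 1"
        using loc[of "4 * R"] R unfolding local_factorization_def by auto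
      show ?thesis using m(1) zero_mult_pos[OF m(2), of "4 * R"] unfolding n_def A_def by linarith
    qed
    hence "2 * \<delta> * (real n + 1) \<le> 2 * \<delta> * (4 * C * R + R)"
      using R \<delta> by (intro mult_left_mono) auto
    also have "\<dots> = R" using C by (simp add: \<delta>_def field_simps)
    finally have step: "2 * \<delta> \<le> R / (real n + 1)" by (simp add: field_simps)
    \<comment> \<open>\<open>n + 1\<close> candidates for the radius that are \<open>2 \<delta>\<close> apart: each zero spoils at most one of them.\<close>
  define p where "p = (\<lambda>i::nat. R + real i * (R / (real n + 1)))"
    assume neg: "\<not> (\<exists>r\<in>{R..2 * R}. \<forall>a. F a = 0 \<longrightarrow> \<delta> \<le> \<bar>norm a - r\<bar>)"
    have "\<exists>a. F a = 0 \<and> \<bar>norm a - p i\<bar> < \<delta>" if "i \<le> n" for i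
    proof -
      have "real i * (R / (real n + 1)) \<le> (real n + 1) * (R / (real n + 1))"
        using that R by (intro mult_right_mono) auto
      hence "p i \<in> {R..2*R}" using R by (simp add: p_def)
      thus ?thesis using neg by force
    qed
    then obtain a where a: "\<And>i. i \<le> n \<Longrightarrow> F (a i) = 0 \<and> \<bar>norm (a i) - p i\<bar> < \<delta>" by metis
    have "inj_on a {..n}"
    proof (rule inj_onI, rule ccontr)
      fix i j assume ij: "i \<in> {..n}" "j \<in> {..n}" "a i = a j" "i \<noteq> j"
      have "\<bar>p i - p j\<bar> < 2 * \<delta>" using a[of i] a[of j] ij by auto
      moreover have "p i - p j = (real i - real j) * (R / (real n + 1))" unfolding p_def left_diff_distrib by linarith
      hence "\<bar>p i - p j\<bar> = \<bar>real i - real j\<bar> * (R / (real n + 1))" using R by (simp add: abs_mult)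
      moreover have "1 * (R / (real n + 1)) \<le> \<bar>real i - real j\<bar> * (R / (real n + 1))"
        using ij(4) R by (intro mult_right_mono) auto
      ultimately show False using step by linarith
    qed
    moreover have "a ` {..n} \<subseteq> A"
    proof safe
      fix i assume "i \<le> n"
      have "real i * (R / (real n + 1)) \<le> (real n + 1) * (R / (real n + 1))"
        using \<open>i \<le> n\<close> R by (intro mult_right_mono) auto
      hence "p i \<le> 2 * R" using R by (simp add: p_def)
      thus "a i \<in> A" using a[OF \<open>i \<le> n\<close>] \<delta>(2) R by (auto simp: A_def)
    qed
    ultimately have "card {..n} \<le> card A" using finA card_inj_on_le by blast
    thus False by (simp add: n_def)
  qed
qed

lemma higher_deriv_bound:
  assumes "h holomorphic_on ball 0 R" "R > 0" "n > 0" "norm z \<le> R / 4"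
    "\<And>z. norm z \<le> 3 / 4 * R \<Longrightarrow> norm (h z - c) \<le> B"
  shows "norm ((deriv ^^ n) h z) \<le> fact n * B / (R / 2) ^ n"
proof -
  have sub: "cball z (R / 2) \<subseteq> ball 0 R"
  proof
    fix w assume "w \<in> cball z (R / 2)"
    hence "norm (w - z) \<le> R / 2" by (simp add: dist_norm norm_minus_commute)
    thus "w \<in> ball 0 R" using assms(2,4) norm_triangle_ineq2[of w z] by simp
  qed
  have "norm ((deriv ^^ n) (\<lambda>w. h w - c) z) \<le> fact n * B / (R / 2) ^ n"
  proof (rule Cauchy_inequality)
    show "(\<lambda>w. h w - c) holomorphic_on ball z (R / 2)"
      using sub by (intro holomorphic_intros holomorphic_on_subset[OF assms(1)]) auto
    show "continuous_on (cball z (R / 2)) (\<lambda>w. h w - c)"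
      by (intro continuous_intros holomorphic_on_imp_continuous_on holomorphic_on_subset[OF assms(1)] sub)
    fix x assume x: "norm (z - x) = R / 2"
    have "norm x \<le> norm z + R / 2" using x norm_triangle_ineq2[of x z] by (simp add: norm_minus_commute)
    thus "norm (h x - c) \<le> B" using assms(4) by (intro assms(5)) simp
  qed (use assms in auto)
  moreover have "(deriv ^^ n) (\<lambda>w. h w - c) z = (deriv ^^ n) h z - (deriv ^^ n) (\<lambda>_. c) z"
    by (rule higher_deriv_diff[OF assms(1)]) (use assms(2,4) in auto)
  moreover have "(deriv ^^ n) (\<lambda>_. c) z = 0" using assms(3) by (simp add: higher_deriv_const)
  ultimately show ?thesis by simp
qed

text \<open>
  In the local factorization the polynomial contributes \<open>O(r)\<close> terms that are at most \<open>1 / \<delta>\<close> each, and \<open>h'\<close>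
  is bounded.
\<close>
lemma logderiv_bound:
  assumes "exp_type f" "f 0 \<noteq> 0" "\<delta> > 0"
  obtains C where "C > 0"
    "\<And>r z. r \<ge> 1 \<Longrightarrow> (\<And>a. f a = 0 \<Longrightarrow> \<delta> \<le> \<bar>norm a - r\<bar>) \<Longrightarrow> norm z = r \<Longrightarrow>
      norm (deriv f z) \<le> C * r * norm (f z)"
proof -
  obtain C where C: "C > 0" and loc: 
    "\<And>R. R \<ge> 1 \<Longrightarrow> \<exists>m h. local_factorization f C R m h"
    using exp_type_local_factor[OF assms(1,2)] by blast
  show thesis
  proof (rule that[of "4 * C / \<delta> + 2 * C"])
    show "4 * C / \<delta> + 2 * C > 0" using C assms(3) by (simp add: add_pos_pos)
    fix r z assume r: "r \<ge> (1::real)" and z: "norm (z::complex) = r"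
      and gap: "\<And>a. f a = 0 \<Longrightarrow> \<delta> \<le> \<bar>norm a - r\<bar>"
    define R where "R = 4 * r"
    define A where "A = {a. a \<in> cball 0 R \<and> f a = 0}"
    have finA: "finite A" unfolding A_def
      by (rule finite_zeros_cball[OF exp_type_holomorphic[OF assms(1)] assms(2)])
    obtain m h where mh: "(\<Sum>a\<in>A. real (m a)) \<le> C * R" "h holomorphic_on ball 0 R"
      "\<And>z. z \<in> ball 0 R \<Longrightarrow> f z = (\<Prod>a\<in>A. (z - a) ^ m a) * exp (h z)"
      "\<And>z. norm z \<le> 3 / 4 * R \<Longrightarrow> norm (h z - h 0) \<le> C * R"
      using loc[of R] r unfolding A_def R_def local_factorization_def by auto
    have zA: "z \<notin> A" using gap[of z] z assms(3) by (auto simp: A_def)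
    have zR: "z \<in> ball 0 R" using z r by (simp add: R_def)
    have "deriv f z = f z * ((\<Sum>a\<in>A. of_nat (m a) / (z - a)) + deriv h z)"
      by (rule logderiv_factored[OF finA mh(2) open_ball zR mh(3) zA])
    moreover have "norm ((\<Sum>a\<in>A. of_nat (m a) / (z - a)) + deriv h z) \<le> C * R / \<delta> + 2 * C"
    proof (rule norm_triangle_le, rule add_mono)
      have "norm (\<Sum>a\<in>A. of_nat (m a) / (z - a)) \<le> (\<Sum>a\<in>A. real (m a) / \<delta>)"
      proof (rule order.trans[OF norm_sum], rule sum_mono)
        fix a assume "a \<in> A"
        hence "\<delta> \<le> \<bar>norm a - r\<bar>" using gap by (simp add: A_def)
        also have "\<dots> \<le> norm (z - a)" using norm_triangle_ineq3[of z a] z by linarith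
        finally show "norm (of_nat (m a) / (z - a)) \<le> real (m a) / \<delta>"
          using assms(3) by (auto simp: norm_divide intro!: divide_left_mono mult_pos_pos)
      qed
      also have "\<dots> = (\<Sum>a\<in>A. real (m a)) / \<delta>" by (simp add: sum_divide_distrib)
      also have "\<dots> \<le> C * R / \<delta>" using mh(1) assms(3) by (simp add: divide_right_mono)
      finally show "norm (\<Sum>a\<in>A. of_nat (m a) / (z - a)) \<le> C * R / \<delta>" .
      have "norm ((deriv ^^ 1) h z) \<le> fact 1 * (C * R) / (R / 2) ^ 1"
        by (rule higher_deriv_bound[OF mh(2) _ _ _ mh(4)]) (use r z in \<open>auto simp: R_def\<close>)
      thus "norm (deriv h z) \<le> 2 * C" using r by (simp add: R_def)
    qed
    ultimately have "norm (deriv f z) \<le> norm (f z) * (C * R / \<delta> + 2 * C)"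
      by (simp add: norm_mult mult_left_mono)
    also have "norm (f z) * (C * R / \<delta> + 2 * C) \<le> norm (f z) * ((4 * C / \<delta> + 2 * C) * r)"
    proof (rule mult_left_mono)
      show "C * R / \<delta> + 2 * C \<le> (4 * C / \<delta> + 2 * C) * r"
        using C r by (simp add: R_def algebra_simps)
    qed simp
    finally show "norm (deriv f z) \<le> (4 * C / \<delta> + 2 * C) * r * norm (f z)"
      by (simp only: mult.commute)
  qed
qed

text \<open>
  The logarithm of \<open>f\<close> grows at most linearly by the lemma of Borel and Caratheodory, so it is a linear
  polynomial.
\<close>
lemma zero_free_exp_type:
  assumes "exp_type f" "\<And>z. f z \<noteq> 0"
  obtains \<alpha> \<beta> where "\<And>z. f z = exp (\<alpha> * z + \<beta>)"
proof -
  have hol: "f holomorphic_on UNIV" using assms exp_type_holomorphic by blast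
  obtain B where B: "B \<ge> 0" "\<And>z. norm (f z) \<le> exp (B * (1 + norm z))" using exp_typeE[OF assms(1)] by metis
  obtain h where h: "h holomorphic_on UNIV" "\<And>z. f z = exp (h z)"
    using exp_form_on_plane[OF hol assms(2)] by metis
  have re: "Re (h z) \<le> B * (1 + norm z)" for z using B(2)[of z] by (simp add: h(2))
  define K where "K = B + \<bar>Re (h 0)\<bar> + 1"
  have lin: "norm (h z - h 0) \<le> 6 * K * norm z ^ 1" if z: "1 \<le> norm z" for z
  proof -
    define r where "r = norm z"
    have r: "r \<ge> 1" using z by (simp add: r_def)
    have "norm (h z - h 0) \<le> 2 * (K * (1 + 2 * r)) * norm (z - 0) / (2 * r - norm (z - 0))"
    proof (rule Borel_Caratheodory_at[of "\<lambda>z. h z - h 0" 0 "2 * r"])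
      show "0 < K * (1 + 2 * r)" using B r by (auto simp: K_def intro!: mult_pos_pos)
      fix w :: complex assume w: "w \<in> ball 0 (2 * r)"
      have "Re (h w - h 0) \<le> B * (1 + norm w) + \<bar>Re (h 0)\<bar>" using re[of w] by simp
      also have "\<dots> \<le> B * (1 + 2 * r) + \<bar>Re (h 0)\<bar> * (1 + 2 * r)"
        using w B r by (intro add_mono mult_left_mono) (auto simp: algebra_simps)
      also have "\<dots> < K * (1 + 2 * r)" using r by (simp add: K_def algebra_simps)
      finally show "Re (h w - h 0) < K * (1 + 2 * r)" .
    qed (use r h(1) in \<open>auto intro!: holomorphic_intros intro: holomorphic_on_subset simp: r_def\<close>)
    also have "\<dots> = 2 * (K * (1 + 2 * r))" using r by (simp add: r_def[symmetric])
    also have "\<dots> \<le> 2 * (K * (3 * r))" using r B by (intro mult_left_mono) (auto simp: K_def)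
    finally show ?thesis by (simp add: r_def)
  qed
  have poly: "(\<lambda>z. h z - h 0) z = (\<Sum>k\<le>1. (deriv ^^ k) (\<lambda>z. h z - h 0) 0 / fact k * z ^ k)" for z
  proof (rule Liouville_polynomial[of _ 1 "6 * K"])
    show "(\<lambda>z. h z - h 0) holomorphic_on UNIV" using h(1) by (intro holomorphic_intros)
  qed (rule lin)
  have "f z = exp (deriv (\<lambda>z. h z - h 0) 0 * z + h 0)" for z
  proof -
    have "h z - h 0 = deriv (\<lambda>z. h z - h 0) 0 * z" using poly[of z] by simp
    hence "h z = deriv (\<lambda>z. h z - h 0) 0 * z + h 0" by (metis diff_add_cancel)
    thus ?thesis using h(2)[of z] by metis
  qed
  thus ?thesis by (rule that)
qed

lemma finite_zeros_exp_type:
  assumes "exp_type f" "f z0 \<noteq> 0" and fin: "finite {z. f z = 0}"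
  obtains m \<alpha> \<beta> where "\<And>a. f a = 0 \<Longrightarrow> m a \<ge> (1::nat)"
    "\<And>z. f z = (\<Prod>a | f a = 0. (z - a) ^ m a) * exp (\<alpha> * z + \<beta>)"
proof -
  define A where "A = {z. f z = 0}"
  have finA: "finite A" using fin by (simp add: A_def)
  have hol: "f holomorphic_on UNIV" using assms exp_type_holomorphic by blast
  obtain B where B: "B \<ge> 0" "\<And>z. norm (f z) \<le> exp (B * (1 + norm z))" using exp_typeE[OF assms(1)] by metis
  obtain m g where g: "g holomorphic_on UNIV" "\<And>a. a \<in> A \<Longrightarrow> g a \<noteq> 0"
    "\<And>z. f z = (\<Prod>a\<in>A. (z - a) ^ m a) * g z"
    using factor_zeros[OF finA hol assms(2)] by metis
  have m1: "m a \<ge> 1" if "a \<in> A" for a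
  proof (rule ccontr)
    assume "\<not> m a \<ge> 1"
    hence "(\<Prod>b\<in>A. (a - b) ^ m b) \<noteq> 0" using finA by auto
    thus False using g(3)[of a] g(2)[OF that] that by (auto simp: A_def)
  qed
  have g_nz: "g z \<noteq> 0" for z
    using g(2)[of z] g(3)[of z] by (cases "z \<in> A") (auto simp: A_def)
  obtain M where M: "\<And>a. a \<in> A \<Longrightarrow> norm a \<le> M" "M \<ge> 0"
    using finite_imp_bounded[OF finA] unfolding bounded_iff
    by (metis norm_ge_zero order.trans linear)
  have "norm (g z) \<le> exp (B * (M + 2) * (1 + norm z))" for z
  proof -
    define R where "R = norm z + M + 1"
    have R: "R > 0" using M(2) by (simp add: R_def add_nonneg_pos)
    have "norm (g z) \<le> exp (B * (1 + R))"
    proof (rule maximum_modulus_frontier[of g "cball 0 R"])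
      fix w :: complex assume "w \<in> frontier (cball 0 R)"
      hence w: "norm w = R" using R by (simp add: frontier_cball)
      have "1 \<le> (\<Prod>a\<in>A. norm (w - a) ^ m a)"
      proof (intro prod_ge_1 one_le_power)
        fix a assume "a \<in> A"
        hence "norm a \<le> M" using M by simp
        thus "1 \<le> norm (w - a)" using w norm_triangle_ineq2[of w a] norm_ge_zero[of z] unfolding R_def by linarith
      qed
      hence "1 * norm (g w) \<le> (\<Prod>a\<in>A. norm (w - a) ^ m a) * norm (g w)" by (intro mult_right_mono) auto
      also have "\<dots> = norm (f w)" by (simp add: g(3) norm_mult norm_power flip: prod_norm)
      also have "\<dots> \<le> exp (B * (1 + R))" using B(2)[of w] w by simp
      finally show "norm (g w) \<le> exp (B * (1 + R))" by simp
    qed (use g(1) M(2) in \<open>auto simp: R_def intro: holomorphic_on_subset holomorphic_on_imp_continuous_on\<close>)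
    also have "1 + R \<le> (M + 2) * (1 + norm z)" using M(2) by (simp add: R_def algebra_simps)
    hence "exp (B * (1 + R)) \<le> exp (B * ((M + 2) * (1 + norm z)))" using B(1) by (auto intro: mult_left_mono)
    finally show ?thesis by (simp add: mult.assoc)
  qed
  moreover have "0 \<le> B * (M + 2)" using B(1) M(2) by simp
  ultimately have "exp_type g" using g(1) unfolding exp_type_def by blast
  then obtain \<alpha> \<beta> where ab: "\<And>z. g z = exp (\<alpha> * z + \<beta>)" using zero_free_exp_type g_nz by metis
  show ?thesis
  proof (rule that[of m \<alpha> \<beta>])
    show "m a \<ge> 1" if "f a = 0" for a using m1[of a] that by (simp add: A_def)
    show "f z = (\<Prod>a | f a = 0. (z - a) ^ m a) * exp (\<alpha> * z + \<beta>)" for z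
      using g(3)[of z] ab[of z] unfolding A_def by metis
  qed
qed

section \<open>The potential as a differential polynomial\<close>

text \<open>
  If \<open>u' = k^2\<close>, this is \<open>k^2\<close> times twice the Schwarzian derivative of \<open>u\<close>; it also equals
  \<open>- 4 k^3 (1 / k)''\<close>.
\<close>
definition schwarzian_part :: "(complex \<Rightarrow> complex) \<Rightarrow> complex \<Rightarrow> complex" where
  "schwarzian_part k z = 4 * k z * deriv (deriv k) z - 8 * deriv k z ^ 2"

text \<open>
  The functions \<open>exp (i u / 2) / k\<close> and \<open>exp (- i u / 2) / k\<close> with \<open>u' = k^2\<close> solve an equation
  \<open>y'' + H y = 0\<close>, and the value defined here is \<open>4 H k^2\<close>.
\<close>
definition scaled_potential :: "(complex \<Rightarrow> complex) \<Rightarrow> complex \<Rightarrow> complex" where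
  "scaled_potential k z = k z ^ 6 + schwarzian_part k z"

text \<open>
  Divided by \<open>k\<close> and \<open>scaled_potential k\<close> this is the logarithmic derivative of
  \<open>scaled_potential k / k^6\<close>.
\<close>
definition potential_wronskian :: "(complex \<Rightarrow> complex) \<Rightarrow> complex \<Rightarrow> complex" where
  "potential_wronskian k z = deriv (scaled_potential k) z * k z - 6 * deriv k z * scaled_potential k z"

lemma schwarzian_part_logderiv:
  assumes hol: "k holomorphic_on UNIV" and z: "k z \<noteq> 0"
    and G: "((\<lambda>z. deriv k z / k z) has_field_derivative G') (at z)"
  shows "schwarzian_part k z = k z ^ 2 * (4 * (G' - (deriv k z / k z) ^ 2))"
proof -
  have kd: "(k has_field_derivative deriv k z) (at z)" for z
    using holomorphic_derivI[OF hol open_UNIV] by simp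
  have kdd: "(deriv k has_field_derivative deriv (deriv k) z) (at z)" for z
    using holomorphic_derivI[OF holomorphic_deriv[OF hol open_UNIV] open_UNIV] by simp
  have "((\<lambda>z. deriv k z / k z) has_field_derivative (deriv (deriv k) z * k z - deriv k z * deriv k z) / (k z * k z)) (at z)"
    by (intro DERIV_divide kd kdd z)
  hence G': "G' = (deriv (deriv k) z * k z - deriv k z * deriv k z) / (k z * k z)"
    using G DERIV_unique by blast
  show ?thesis unfolding G' using z by (simp add: schwarzian_part_def field_simps power2_eq_square)
qed

lemma potential_holomorphic:
  assumes "k holomorphic_on UNIV"
  shows "schwarzian_part k holomorphic_on UNIV" "scaled_potential k holomorphic_on UNIV" "potential_wronskian k holomorphic_on UNIV"
proof -
  show r: "schwarzian_part k holomorphic_on UNIV" unfolding schwarzian_part_def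
    by (intro holomorphic_intros holomorphic_deriv open_UNIV assms)
  show p: "scaled_potential k holomorphic_on UNIV" unfolding scaled_potential_def
    by (intro holomorphic_intros open_UNIV assms r)
  show "potential_wronskian k holomorphic_on UNIV" unfolding potential_wronskian_def
    by (intro holomorphic_intros holomorphic_deriv open_UNIV assms p)
qed

lemma potential_exp_type:
  assumes "exp_type k"
  shows "exp_type (schwarzian_part k)" "exp_type (scaled_potential k)" "exp_type (potential_wronskian k)"
proof -
  show r: "exp_type (schwarzian_part k)" unfolding schwarzian_part_def mult.assoc
    by (intro exp_type_diff exp_type_cmult exp_type_mult exp_type_power exp_type_deriv assms)
  show p: "exp_type (scaled_potential k)" unfolding scaled_potential_def
    by (intro exp_type_add exp_type_power assms r)
  show "exp_type (potential_wronskian k)" unfolding potential_wronskian_def mult.assoc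
    by (intro exp_type_diff exp_type_cmult exp_type_mult exp_type_deriv assms p)
qed

lemma deriv_scaled_potential:
  assumes "k holomorphic_on UNIV"
  shows "deriv (scaled_potential k) z = 6 * k z ^ 5 * deriv k z + deriv (schwarzian_part k) z"
proof -
  have "(k has_field_derivative deriv k z) (at z)"
    using holomorphic_derivI[OF assms open_UNIV] by simp
  moreover have "(schwarzian_part k has_field_derivative deriv (schwarzian_part k) z) (at z)"
    using holomorphic_derivI[OF potential_holomorphic(1)[OF assms] open_UNIV] by simp
  ultimately have "(scaled_potential k has_field_derivative 6 * k z ^ 5 * deriv k z + deriv (schwarzian_part k) z) (at z)"
    unfolding scaled_potential_def by (auto intro!: derivative_eq_intros)
  thus ?thesis by (rule DERIV_imp_deriv)
qed

text \<open>
  The power \<open>k^6\<close> drops out of the Wronskian because \<open>k^6\<close> and \<open>k\<close> have proportional logarithmic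
  derivatives. The second identity is what bounds \<open>k\<close> in terms of logarithmic derivatives.
\<close>
lemma potential_wronskian_rest:
  assumes "k holomorphic_on UNIV"
  shows "potential_wronskian k z = deriv (schwarzian_part k) z * k z - 6 * deriv k z * schwarzian_part k z"
    and "k z ^ 5 * potential_wronskian k z = deriv (schwarzian_part k) z * scaled_potential k z - deriv (scaled_potential k) z * schwarzian_part k z"
  unfolding potential_wronskian_def deriv_scaled_potential[OF assms] scaled_potential_def by (simp_all add: algebra_simps eval_nat_numeral)

section \<open>Real zeros of the potential between zeros of the entire function\<close>

lemma deriv_of_real_Re:
  assumes "(f has_field_derivative D) (at (of_real x))"
  shows "((\<lambda>t. Re (f (of_real t))) has_real_derivative Re D) (at x)"
    and "((\<lambda>t. Im (f (of_real t))) has_real_derivative Im D) (at x)"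
  using bounded_linear.has_vector_derivative[OF bounded_linear_Re has_vector_derivative_real_field[OF assms]]
    bounded_linear.has_vector_derivative[OF bounded_linear_Im has_vector_derivative_real_field[OF assms]]
  by (simp_all add: has_real_derivative_iff_has_vector_derivative)

lemma partial_fraction_deriv:
  fixes A :: "complex set" and c :: "complex \<Rightarrow> complex"
  assumes "finite A" "z \<notin> A"
  shows "((\<lambda>z. \<Sum>a\<in>A. c a / (z - a) ^ p) has_field_derivative
          - of_nat p * (\<Sum>a\<in>A. c a / (z - a) ^ Suc p)) (at z)"
proof -
  have "((\<lambda>z. c a / (z - a) ^ p) has_field_derivative - of_nat p * (c a / (z - a) ^ Suc p)) (at z)"
    if "a \<in> A" for a
  proof -
    have za: "z - a \<noteq> 0" using assms(2) that by auto
    have pow: "((\<lambda>z. (z - a) ^ p) has_field_derivative of_nat p * (z - a) ^ (p - 1)) (at z)"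
      by (auto intro!: derivative_eq_intros)
    have "((\<lambda>z. c a / (z - a) ^ p) has_field_derivative
       (0 * (z - a) ^ p - c a * (of_nat p * (z - a) ^ (p - 1))) / ((z - a) ^ p * (z - a) ^ p)) (at z)"
      by (intro DERIV_divide DERIV_const pow) (use za in auto)
    moreover have "(0 * (z - a) ^ p - c a * (of_nat p * (z - a) ^ (p - 1))) / ((z - a) ^ p * (z - a) ^ p)
        = - of_nat p * (c a / (z - a) ^ Suc p)"
    proof -
      have "(0 * u ^ p - c a * (of_nat p * u ^ (p - 1))) / (u ^ p * u ^ p) = - of_nat p * (c a / u ^ Suc p)"
        if "u \<noteq> 0" for u
        using that by (cases p) (auto simp: divide_simps algebra_simps)
      thus ?thesis using za by blast
    qed
    ultimately show ?thesis by simp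
  qed
  hence "((\<lambda>z. \<Sum>a\<in>A. c a / (z - a) ^ p) has_field_derivative
          (\<Sum>a\<in>A. - of_nat p * (c a / (z - a) ^ Suc p))) (at z)"
    by (intro DERIV_sum)
  thus ?thesis by (simp add: sum_distrib_left)
qed

text \<open>
  The power sums \<open>s2\<close>, \<open>s3\<close>, \<open>s4\<close> of \<open>1 / (x - a)\<close> over the zeros in the disc of radius \<open>R\<close> give the
  derivatives of \<open>k' / k\<close> up to the derivatives of order two to four of the exponent in the local
  factorization, which are \<open>O(1 / R)\<close>. The inequality between them is that of Cauchy and Schwarz.
\<close>
lemma laguerre_finite:
  assumes "exp_type k" "k 0 \<noteq> 0" and real: "\<And>a. k a = 0 \<Longrightarrow> a \<in> \<real>" and kx: "k (of_real x) \<noteq> 0"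
  defines "G \<equiv> \<lambda>z. deriv k z / k z"
  obtains C where "C > 0" "\<And>R. R \<ge> 1 + 4 * \<bar>x\<bar> \<Longrightarrow> \<exists>s2 s3 s4 :: real.
     0 \<le> s2 \<and> 0 \<le> s4 \<and> s3\<^sup>2 \<le> s2 * s4 \<and> (\<forall>a. k a = 0 \<longrightarrow> norm a \<le> R \<longrightarrow> 1 / (x - Re a)\<^sup>2 \<le> s2) \<and>
     norm (deriv G (of_real x) + of_real s2) \<le> C / R \<and>
     norm (deriv (deriv G) (of_real x) - 2 * of_real s3) \<le> C / R \<and>
     norm (deriv (deriv (deriv G)) (of_real x) + 6 * of_real s4) \<le> C / R"
proof -
  obtain C where C: "C > 0" and loc: 
    "\<And>R. R \<ge> 1 \<Longrightarrow> \<exists>m h. local_factorization k C R m h"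
    using exp_type_local_factor[OF assms(1,2)] by blast
  show thesis
  proof (rule that[of "400 * C"])
    show "400 * C > 0" using C by simp
    fix R :: real assume R: "R \<ge> 1 + 4 * \<bar>x\<bar>"
    have R1: "R \<ge> 1" using R by linarith
    define A where "A = {a. a \<in> cball 0 R \<and> k a = 0}"
    have finA: "finite A" unfolding A_def
      by (rule finite_zeros_cball[OF exp_type_holomorphic[OF assms(1)] assms(2)])
    obtain m h where mh0: "\<forall>a. k a = 0 \<longrightarrow> m a \<ge> (1::nat)" "h holomorphic_on ball 0 R"
      "\<forall>z\<in>ball 0 R. k z = (\<Prod>a\<in>A. (z - a) ^ m a) * exp (h z)"
      "\<forall>z. norm z \<le> 3 / 4 * R \<longrightarrow> norm (h z - h 0) \<le> C * R"
      using loc[OF R1] unfolding local_factorization_def A_def[symmetric] by blast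
    note mh = mh0(1)[rule_format] mh0(2) mh0(3)[rule_format] mh0(4)[rule_format]
    define U where "U = ball 0 R - A"
    have U: "open U" using finA by (auto simp: U_def finite_imp_closed)
    have xU: "of_real x \<in> U" using kx R by (auto simp: U_def A_def)
    define T where "T = (\<lambda>p z. \<Sum>a\<in>A. of_nat (m a) / (z - a) ^ p)"
    have Td: "(T p has_field_derivative - of_nat p * T (Suc p) z) (at z)" if "z \<in> U" for p z
      unfolding T_def by (rule partial_fraction_deriv) (use that finA in \<open>auto simp: U_def\<close>)
    have hd: "((deriv ^^ n) h has_field_derivative (deriv ^^ Suc n) h z) (at z)" if "z \<in> U" for n z
      using holomorphic_derivI[OF holomorphic_higher_deriv[OF mh(2) open_ball] open_ball, of z n] that
      by (simp add: U_def)
    have G0: "G z = T 1 z + (deriv ^^ 1) h z" if "z \<in> U" for z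
    proof -
      have "deriv k z = k z * ((\<Sum>a\<in>A. of_nat (m a) / (z - a)) + deriv h z)"
        by (rule logderiv_factored[OF finA mh(2) open_ball _ mh(3)]) (use that in \<open>auto simp: U_def\<close>)
      moreover have "k z \<noteq> 0" using that by (auto simp: U_def A_def)
      ultimately show ?thesis by (simp add: G_def T_def)
    qed
    have G1: "deriv G z = - T 2 z + (deriv ^^ 2) h z" if "z \<in> U" for z
    proof (rule DERIV_imp_deriv, rule has_field_derivative_transform_within_open[OF _ U that])
      show "((\<lambda>z. T 1 z + (deriv ^^ 1) h z) has_field_derivative - T 2 z + (deriv ^^ 2) h z) (at z)"
        using DERIV_add[OF Td[OF that, of 1] hd[OF that, of 1]] by (simp add: numeral_2_eq_2)
    qed (simp add: G0)
    have G2: "deriv (deriv G) z = 2 * T 3 z + (deriv ^^ 3) h z" if "z \<in> U" for z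
    proof (rule DERIV_imp_deriv, rule has_field_derivative_transform_within_open[OF _ U that])
      show "((\<lambda>z. - T 2 z + (deriv ^^ 2) h z) has_field_derivative 2 * T 3 z + (deriv ^^ 3) h z) (at z)"
        using DERIV_add[OF DERIV_minus[OF Td[OF that, of 2]] hd[OF that, of 2]]
        by (simp add: numeral_3_eq_3 numeral_2_eq_2)
    qed (simp add: G1)
    have G3: "deriv (deriv (deriv G)) z = - 6 * T 4 z + (deriv ^^ 4) h z" if "z \<in> U" for z
    proof (rule DERIV_imp_deriv, rule has_field_derivative_transform_within_open[OF _ U that])
      show "((\<lambda>z. 2 * T 3 z + (deriv ^^ 3) h z) has_field_derivative - 6 * T 4 z + (deriv ^^ 4) h z) (at z)"
        using DERIV_add[OF DERIV_cmult[OF Td[OF that, of 3], of 2] hd[OF that, of 3]]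
        by (simp add: eval_nat_numeral)
    qed (simp add: G2)
    have hb: "norm ((deriv ^^ n) h (of_real x)) \<le> fact n * (C * R) / (R / 2) ^ n" if "n > 0" for n
      by (rule higher_deriv_bound[OF mh(2) _ that _ mh(4)]) (use R in auto)
    have hb': "norm ((deriv ^^ n) h (of_real x)) \<le> 400 * C / R" if n: "n \<in> {2, 3, 4}" for n
    proof -
      have le: "1 \<le> R" "1 \<le> R * R" using R1 by (auto simp: mult_ge1_I)
      have "fact n * (C * R) / (R / 2) ^ n \<le> 400 * C / R"
        using n R1 C le by (auto simp: field_simps eval_nat_numeral fact_numeral)
      thus ?thesis using hb[of n] n by auto
    qed
    define s where "s = (\<lambda>p. \<Sum>a\<in>A. real (m a) * (1 / (x - Re a)) ^ p)"
    have reA: "a = of_real (Re a)" if "a \<in> A" for a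
      using real[of a] that by (auto simp: A_def complex_is_Real_iff complex_eq_iff)
    have Ts: "T p (of_real x) = of_real (s p)" for p
    proof -
      have "of_nat (m a) / (of_real x - a) ^ p = of_real (real (m a) * (1 / (x - Re a)) ^ p)" if "a \<in> A" for a
        by (subst reA[OF that]) (simp add: power_divide)
      thus ?thesis by (simp add: T_def s_def)
    qed
    have cs: "(s 3)\<^sup>2 \<le> s 2 * s 4"
    proof -
      define u where "u = (\<lambda>a. sqrt (real (m a)) * (1 / (x - Re a)))"
      define v where "v = (\<lambda>a. sqrt (real (m a)) * (1 / (x - Re a))\<^sup>2)"
      have "(\<Sum>a\<in>A. u a * v a)\<^sup>2 \<le> (\<Sum>a\<in>A. (u a)\<^sup>2) * (\<Sum>a\<in>A. (v a)\<^sup>2)"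
        by (rule Cauchy_Schwarz_ineq_sum)
      moreover have "u a * v a = real (m a) * (1 / (x - Re a)) ^ 3" for a
      proof -
        have "u a * v a = (sqrt (real (m a)) * sqrt (real (m a))) * (1 / (x - Re a)) ^ 3"
          unfolding u_def v_def by (simp add: power3_eq_cube power2_eq_square mult_ac)
        thus ?thesis by simp
      qed
      moreover have "(u a)\<^sup>2 = real (m a) * (1 / (x - Re a)) ^ 2" for a
        unfolding u_def power_mult_distrib by simp
      moreover have "(v a)\<^sup>2 = real (m a) * (1 / (x - Re a)) ^ 4" for a
        unfolding v_def power_mult_distrib by (simp flip: power_mult)
      ultimately show ?thesis by (simp add: s_def)
    qed
    have s2: "1 / (x - Re a)\<^sup>2 \<le> s 2" if "k a = 0" "norm a \<le> R" for a
    proof -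
      have aA: "a \<in> A" using that by (simp add: A_def)
      have "1 / (x - Re a)\<^sup>2 \<le> real (m a) * (1 / (x - Re a)) ^ 2"
        using mult_right_mono[of 1 "real (m a)" "(1 / (x - Re a)) ^ 2"] mh(1)[OF that(1)]
        by (simp add: power_divide)
      also have "\<dots> \<le> s 2" unfolding s_def
        by (rule member_le_sum[OF aA _ finA]) simp
      finally show ?thesis .
    qed
    show "\<exists>s2 s3 s4 :: real.
     0 \<le> s2 \<and> 0 \<le> s4 \<and> s3\<^sup>2 \<le> s2 * s4 \<and> (\<forall>a. k a = 0 \<longrightarrow> norm a \<le> R \<longrightarrow> 1 / (x - Re a)\<^sup>2 \<le> s2) \<and>
     norm (deriv G (of_real x) + of_real s2) \<le> 400 * C / R \<and>
     norm (deriv (deriv G) (of_real x) - 2 * of_real s3) \<le> 400 * C / R \<and>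
     norm (deriv (deriv (deriv G)) (of_real x) + 6 * of_real s4) \<le> 400 * C / R"
    proof (rule exI[of _ "s 2"], rule exI[of _ "s 3"], rule exI[of _ "s 4"], intro conjI allI impI)
      show "0 \<le> s 2" "0 \<le> s 4" by (auto simp: s_def intro!: sum_nonneg)
    qed (use cs s2 hb'[of 2] hb'[of 3] hb'[of 4] in \<open>auto simp: G1[OF xU] G2[OF xU] G3[OF xU] Ts\<close>)
  qed
qed

text \<open>
  The radius in \<open>laguerre_finite\<close> tends to infinity, and the derivatives of \<open>k' / k\<close> become power sums.
\<close>
lemma laguerre_inequality:
  assumes "exp_type k" "k 0 \<noteq> 0" and real: "\<And>a. k a = 0 \<Longrightarrow> a \<in> \<real>" and kx: "k (of_real x) \<noteq> 0"
  defines "G \<equiv> \<lambda>z. deriv k z / k z"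
  obtains s2 s3 s4 :: real where "0 \<le> s2" "0 \<le> s4" "s3\<^sup>2 \<le> s2 * s4" 
    "\<And>a. k a = 0 \<Longrightarrow> 1 / (x - Re a)\<^sup>2 \<le> s2"
    "deriv G (of_real x) = - of_real s2" "deriv (deriv G) (of_real x) = 2 * of_real s3"
    "deriv (deriv (deriv G)) (of_real x) = - 6 * of_real s4"
proof -
  obtain C where C: "C > 0" and fin: "\<And>R. R \<ge> 1 + 4 * \<bar>x\<bar> \<Longrightarrow> \<exists>s2 s3 s4 :: real.
     0 \<le> s2 \<and> 0 \<le> s4 \<and> s3\<^sup>2 \<le> s2 * s4 \<and> (\<forall>a. k a = 0 \<longrightarrow> norm a \<le> R \<longrightarrow> 1 / (x - Re a)\<^sup>2 \<le> s2) \<and>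
     norm (deriv G (of_real x) + of_real s2) \<le> C / R \<and>
     norm (deriv (deriv G) (of_real x) - 2 * of_real s3) \<le> C / R \<and>
     norm (deriv (deriv (deriv G)) (of_real x) + 6 * of_real s4) \<le> C / R"
    using laguerre_finite[OF assms(1-4), folded G_def] by metis
  define R where "R = (\<lambda>n. 1 + 4 * \<bar>x\<bar> + real n)"
  have Rlim: "(\<lambda>n. C / R n) \<longlonglongrightarrow> 0"
    unfolding R_def by real_asymp
  have "\<exists>s2 s3 s4. 0 \<le> s2 \<and> 0 \<le> s4 \<and> s3\<^sup>2 \<le> s2 * s4 \<and> (\<forall>a. k a = 0 \<longrightarrow> norm a \<le> R n \<longrightarrow> 1 / (x - Re a)\<^sup>2 \<le> s2) \<and>
     norm (deriv G (of_real x) + of_real s2) \<le> C / R n \<and>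
     norm (deriv (deriv G) (of_real x) - 2 * of_real s3) \<le> C / R n \<and>
     norm (deriv (deriv (deriv G)) (of_real x) + 6 * of_real s4) \<le> C / R n" for n
    by (rule fin) (simp add: R_def)
  then obtain S2 S3 S4 where S: "\<And>n. 0 \<le> S2 n" "\<And>n. 0 \<le> S4 n" "\<And>n. (S3 n)\<^sup>2 \<le> S2 n * S4 n"
    "\<And>n a. k a = 0 \<Longrightarrow> norm a \<le> R n \<Longrightarrow> 1 / (x - Re a)\<^sup>2 \<le> S2 n"
    "\<And>n. norm (deriv G (of_real x) + of_real (S2 n)) \<le> C / R n"
    "\<And>n. norm (deriv (deriv G) (of_real x) - 2 * of_real (S3 n)) \<le> C / R n"
    "\<And>n. norm (deriv (deriv (deriv G)) (of_real x) + 6 * of_real (S4 n)) \<le> C / R n"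
    by metis
  have lim: "\<exists>s. S \<longlonglongrightarrow> s \<and> z = of_real (c * s)"
    if b: "\<And>n. norm (z - of_real (c * S n)) \<le> C / R n" and c: "c \<noteq> 0" for z :: complex and S :: "nat \<Rightarrow> real" and c :: real
  proof -
    have ev: "\<forall>\<^sub>F n in sequentially. norm (z - of_real (c * S n)) \<le> C / R n"
      using b by (simp only: eventually_True)
    have "(\<lambda>n. z - of_real (c * S n)) \<longlonglongrightarrow> 0"
      by (rule Lim_null_comparison[OF ev Rlim])
    from tendsto_diff[OF tendsto_const[of z] this]
    have l: "(\<lambda>n. of_real (c * S n) :: complex) \<longlonglongrightarrow> z" by simp
    have re: "(\<lambda>n. c * S n) \<longlonglongrightarrow> Re z" using tendsto_Re[OF l] by simp
    have "Im z = 0" using tendsto_Im[OF l] by (simp add: LIMSEQ_const_iff)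
    hence "z = of_real (c * (Re z / c))" using c by (simp add: complex_eq_iff)
    moreover have "S \<longlonglongrightarrow> Re z / c" using tendsto_divide[OF re tendsto_const, of c] c by simp
    ultimately show ?thesis by blast
  qed
  obtain s2 where s2: "S2 \<longlonglongrightarrow> s2" "deriv G (of_real x) = of_real ((-1) * s2)"
    using lim[of "deriv G (of_real x)" "-1" S2] S(5) by auto
  obtain s3 where s3: "S3 \<longlonglongrightarrow> s3" "deriv (deriv G) (of_real x) = of_real (2 * s3)"
    using lim[of "deriv (deriv G) (of_real x)" 2 S3] S(6) by auto
  obtain s4 where s4: "S4 \<longlonglongrightarrow> s4" "deriv (deriv (deriv G)) (of_real x) = of_real ((-6) * s4)"
    using lim[of "deriv (deriv (deriv G)) (of_real x)" "-6" S4] S(7) by auto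
  show thesis
  proof (rule that[of s2 s4 s3])
    show "0 \<le> s2" by (rule LIMSEQ_le_const[OF s2(1)]) (use S in auto)
    show "0 \<le> s4" by (rule LIMSEQ_le_const[OF s4(1)]) (use S in auto)
    show "s3\<^sup>2 \<le> s2 * s4"
      by (rule LIMSEQ_le[OF tendsto_power[OF s3(1)] tendsto_mult[OF s2(1) s4(1)]]) (use S in auto)
    show "1 / (x - Re a)\<^sup>2 \<le> s2" if "k a = 0" for a
    proof (rule LIMSEQ_le_const[OF s2(1)], intro exI allI impI)
      fix n assume "n \<ge> nat \<lceil>norm a\<rceil>"
      hence "norm a \<le> R n" unfolding R_def by linarith
      thus "1 / (x - Re a)\<^sup>2 \<le> S2 n" using S(4) that by blast
    qed
  qed (use s2 s3 s4 in auto)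
qed


text \<open>
  With \<open>g = k' / k\<close> and the power sums of \<open>laguerre_inequality\<close> the expression is \<open>Y'''' / Y\<close> for \<open>Y = 1 / k^2\<close>.
\<close>
lemma fourth_derivative_quotient_pos:
  fixes g s2 s3 s4 :: real
  assumes "0 < s2" "0 \<le> s4" "s3\<^sup>2 \<le> s2 * s4"
  shows "16 * g ^ 4 + 48 * g\<^sup>2 * s2 + 12 * s2\<^sup>2 + 32 * g * s3 + 12 * s4 > 0"
proof -
  have "0 \<le> 16 * (3 * s2 * g + s3)\<^sup>2 + 20 * (s2 * s4) + 16 * (s2 * s4 - s3\<^sup>2)"
    using assms by (intro add_nonneg_nonneg mult_nonneg_nonneg) auto
  also have "\<dots> = 3 * s2 * (48 * g\<^sup>2 * s2 + 32 * g * s3 + 12 * s4)"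
    by (simp add: power2_eq_square algebra_simps)
  finally have "48 * g\<^sup>2 * s2 + 32 * g * s3 + 12 * s4 \<ge> 0"
    using assms(1) by (simp add: zero_le_mult_iff)
  moreover have "12 * s2\<^sup>2 > 0" "16 * g ^ 4 \<ge> 0" using assms(1) by auto
  ultimately show ?thesis by linarith
qed

lemma Rolle_Re:
  assumes "p < q" "Re (f (of_real p)) = 0" "Re (f (of_real q)) = 0"
    and d: "\<And>x. x \<in> {p..q} \<Longrightarrow> (f has_field_derivative f' (of_real x)) (at (of_real x))"
  obtains \<xi> where "p < \<xi>" "\<xi> < q" "Re (f' (of_real \<xi>)) = 0"
proof -
  have d': "((\<lambda>t. Re (f (of_real t))) has_real_derivative Re (f' (of_real x))) (at x)" if "x \<in> {p..q}" for x
    by (rule deriv_of_real_Re(1)[OF d[OF that]])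
  have "continuous_on {p..q} (\<lambda>t. Re (f (of_real t)))"
    using d' by (meson DERIV_isCont continuous_at_imp_continuous_on)
  from Rolle_deriv[OF assms(1) _ this, of "\<lambda>x v. Re (f' (of_real x)) * v"]
  obtain \<xi> where "p < \<xi>" "\<xi> < q" "(\<lambda>v. Re (f' (of_real \<xi>)) * v) = (\<lambda>v. 0)"
    using d' assms(2,3) by (force simp: has_field_derivative_def)
  thus ?thesis using that[of \<xi>] by (metis mult.right_neutral)
qed

text \<open>
  The quotient \<open>\<Phi> = scaled_potential k / k^6\<close> equals \<open>1 + Y'^2 - 2 Y Y''\<close> with \<open>Y = 1 / k^2\<close>, and
  \<open>\<Phi>' = - 2 Y Y'''\<close>. Three zeros of \<open>\<Phi>\<close> give two zeros of \<open>Y'''\<close>, hence a zero of \<open>Y''''\<close>, which is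
  excluded by \<open>fourth_derivative_quotient_pos\<close>.
\<close>
lemma no_three_potential_zeros_in_gap:
  assumes k: "exp_type k" "k 0 \<noteq> 0" and real: "\<And>a. k a = 0 \<Longrightarrow> a \<in> \<real>"
    and sq: "\<And>x::real. Im (k (of_real x) ^ 2) = 0" and zero: "k a0 = 0"
    and p: "p1 < p2" "p2 < p3" and nz: "\<And>x. x \<in> {p1..p3} \<Longrightarrow> k (of_real x) \<noteq> 0"
    and Q: "scaled_potential k (of_real p1) = 0" "scaled_potential k (of_real p2) = 0" "scaled_potential k (of_real p3) = 0"
  shows False
proof -
  have hol: "k holomorphic_on UNIV" using k exp_type_holomorphic by blast
  define W where "W = {z. k z \<noteq> 0}"
  have W: "open W" unfolding W_def
    by (rule open_nonzero[OF hol])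
  have pW: "of_real x \<in> W" if "x \<in> {p1..p3}" for x using nz[OF that] by (simp add: W_def)
  define G where "G = (\<lambda>z. deriv k z / k z)"
  define G1 where "G1 = deriv G"
  define G2 where "G2 = deriv G1"
  define G3 where "G3 = deriv G2"
  have kd: "(k has_field_derivative deriv k z) (at z)" for z
    using holomorphic_derivI[OF hol open_UNIV] by simp
  have kdd: "(deriv k has_field_derivative deriv (deriv k) z) (at z)" for z
    using holomorphic_derivI[OF holomorphic_deriv[OF hol open_UNIV] open_UNIV] by simp
  have holG: "G holomorphic_on W" unfolding G_def W_def
    by (intro holomorphic_intros holomorphic_on_subset[OF holomorphic_deriv[OF hol open_UNIV]]
        holomorphic_on_subset[OF hol]) auto
  have holG1: "G1 holomorphic_on W" unfolding G1_def by (rule holomorphic_deriv[OF holG W])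
  have holG2: "G2 holomorphic_on W" unfolding G2_def by (rule holomorphic_deriv[OF holG1 W])
  have Gd: "(G has_field_derivative G1 z) (at z)" "(G1 has_field_derivative G2 z) (at z)"
       "(G2 has_field_derivative G3 z) (at z)" if "z \<in> W" for z
    using holomorphic_derivI[OF holG W that] holomorphic_derivI[OF holG1 W that] holomorphic_derivI[OF holG2 W that]
    by (simp_all add: G1_def G2_def G3_def)
  define Y where "Y = (\<lambda>z. 1 / k z ^ 2)"
  have Yd: "(Y has_field_derivative - 2 * G z * Y z) (at z)" if "z \<in> W" for z
  proof -
    have "(Y has_field_derivative (0 * k z ^ 2 - 1 * (2 * k z * deriv k z)) / (k z ^ 2 * k z ^ 2)) (at z)"
      unfolding Y_def using that by (intro DERIV_divide DERIV_const) (auto simp: W_def intro!: derivative_eq_intros kd)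
    thus ?thesis using that by (simp add: Y_def G_def W_def power2_eq_square)
  qed
  define \<Phi> where "\<Phi> = (\<lambda>z. Y z ^ 2 * (4 * G1 z - 4 * G z ^ 2) + 1)"
  define T where "T = (\<lambda>z. - 8 * G z ^ 3 + 12 * G z * G1 z - 2 * G2 z)"
  define D where "D = (\<lambda>z. 16 * G z ^ 4 - 48 * G z ^ 2 * G1 z + 12 * G1 z ^ 2 + 16 * G z * G2 z - 2 * G3 z)"
  have \<Phi>d: "(\<Phi> has_field_derivative - 2 * Y z ^ 2 * T z) (at z)" if "z \<in> W" for z
    unfolding \<Phi>_def
    by (rule derivative_eq_intros Yd Gd that refl)+ (simp add: T_def power2_eq_square power3_eq_cube algebra_simps)
  have TYd: "((\<lambda>z. T z * Y z) has_field_derivative Y z * D z) (at z)" if "z \<in> W" for z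
    unfolding T_def
    by (rule derivative_eq_intros Yd Gd that refl)+
       (simp add: D_def power2_eq_square power3_eq_cube power4_eq_xxxx algebra_simps)
  have \<Phi>0: "\<Phi> z = 0" if "z \<in> W" "scaled_potential k z = 0" for z
  proof -
    have nzk: "k z \<noteq> 0" using that by (simp add: W_def)
    have "(G has_field_derivative (deriv (deriv k) z * k z - deriv k z * deriv k z) / (k z * k z)) (at z)"
      unfolding G_def by (intro DERIV_divide kd kdd nzk)
    hence G1z: "G1 z = (deriv (deriv k) z * k z - deriv k z * deriv k z) / (k z * k z)"
      unfolding G1_def by (rule DERIV_imp_deriv)
    have "\<Phi> z = scaled_potential k z / k z ^ 6"
      unfolding \<Phi>_def Y_def G1z G_def scaled_potential_def schwarzian_part_def using nzk
      by (simp add: field_simps power2_eq_square eval_nat_numeral)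
    thus ?thesis using that by simp
  qed
  have Yreal: "Y (of_real x) = of_real (Re (Y (of_real x)))" for x
  proof -
    have "k (of_real x) ^ 2 = of_real (Re (k (of_real x) ^ 2))" using sq[of x] by (simp add: complex_eq_iff)
    hence "Y (of_real x) = of_real (1 / Re (k (of_real x) ^ 2))"
      unfolding Y_def by (metis of_real_1 of_real_divide)
    thus ?thesis by (metis Re_complex_of_real)
  qed
  have Greal: "G (of_real x) = of_real (Re (G (of_real x)))" if "of_real x \<in> W" for x
  proof -
    have kx: "k (of_real x) \<noteq> 0" using that by (simp add: W_def)
    have "((\<lambda>z. k z ^ 2) has_field_derivative 2 * k (of_real x) * deriv k (of_real x)) (at (of_real x))"
      by (auto intro!: derivative_eq_intros kd)
    from deriv_of_real_Re(2)[OF this]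
    have "((\<lambda>t. 0) has_real_derivative Im (2 * k (of_real x) * deriv k (of_real x))) (at x)"
      by (simp only: sq)
    hence "Im (2 * k (of_real x) * deriv k (of_real x)) = 0" using DERIV_unique DERIV_const by blast
    then obtain c where c: "2 * k (of_real x) * deriv k (of_real x) = of_real c"
      by (metis complex_is_Real_iff Reals_cases)
    obtain d where d: "k (of_real x) ^ 2 = of_real d"
      using sq[of x] by (metis complex_is_Real_iff Reals_cases)
    have "G (of_real x) = (2 * k (of_real x) * deriv k (of_real x)) / (2 * k (of_real x) ^ 2)"
      using kx by (simp add: G_def power2_eq_square)
    also have "\<dots> = of_real (c / (2 * d))" unfolding c d by simp
    finally show ?thesis by (metis Re_complex_of_real)
  qed
  note L = laguerre_inequality[OF k real, folded G_def, folded G1_def, folded G2_def, folded G3_def]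
  have T_real: "T (of_real x) = of_real (Re (T (of_real x)))" if x: "of_real x \<in> W" for x
  proof -
    obtain s2 s3 s4 where s: "G1 (of_real x) = - of_real s2" "G2 (of_real x) = 2 * of_real s3"
      using L[of x] x unfolding W_def by (metis mem_Collect_eq)
    obtain g where g: "G (of_real x) = of_real g" using Greal[OF x] by blast
    have "T (of_real x) = of_real (- 8 * g ^ 3 + 12 * g * (-s2) - 2 * (2 * s3))"
      by (simp add: T_def s g)
    thus ?thesis by (metis Re_complex_of_real)
  qed
  have Tzero: "T (of_real x) = 0" if x: "of_real x \<in> W" and z: "Re (- 2 * Y (of_real x) ^ 2 * T (of_real x)) = 0" for x
  proof -
    have Ynz: "Y (of_real x) \<noteq> 0" using x by (simp add: Y_def W_def)
    have "- 2 * Y (of_real x) ^ 2 * T (of_real x) = of_real (- 2 * Re (Y (of_real x)) ^ 2 * Re (T (of_real x)))"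
      by (subst Yreal, subst T_real[OF x]) simp
    hence "- 2 * Y (of_real x) ^ 2 * T (of_real x) = 0" using z by (metis Re_complex_of_real of_real_0)
    thus ?thesis using Ynz by simp
  qed
  have seg: "x \<in> {p1..p3}" if "x \<in> {p1..p2} \<or> x \<in> {p2..p3}" for x using that p by auto
  have Q0: "Re (\<Phi> (of_real p1)) = 0" "Re (\<Phi> (of_real p2)) = 0" "Re (\<Phi> (of_real p3)) = 0"
    using Q \<Phi>0 pW p by auto
  obtain x1 where x1: "p1 < x1" "x1 < p2" "Re (- 2 * Y (of_real x1) ^ 2 * T (of_real x1)) = 0"
    by (rule Rolle_Re[OF p(1) Q0(1,2), of "\<lambda>z. - 2 * Y z ^ 2 * T z"]) (use \<Phi>d pW seg in blast)+
  obtain x2 where x2: "p2 < x2" "x2 < p3" "Re (- 2 * Y (of_real x2) ^ 2 * T (of_real x2)) = 0"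
    by (rule Rolle_Re[OF p(2) Q0(2,3), of "\<lambda>z. - 2 * Y z ^ 2 * T z"]) (use \<Phi>d pW seg in blast)+
  have T0: "T (of_real x1) = 0" "T (of_real x2) = 0"
    using Tzero x1 x2 pW by auto
  have x12: "x1 < x2" using x1 x2 by linarith
  have seg2: "x \<in> {p1..p3}" if "x \<in> {x1..x2}" for x using that x1 x2 p by auto
  obtain y where y: "x1 < y" "y < x2" "Re (Y (of_real y) * D (of_real y)) = 0"
    by (rule Rolle_Re[OF x12, of "\<lambda>z. T z * Y z" "\<lambda>z. Y z * D z"]) (use TYd pW seg2 T0 in auto)
  have yW: "of_real y \<in> W" using pW seg2 y by auto
  hence ky: "k (of_real y) \<noteq> 0" by (simp add: W_def)
  obtain s2 s3 s4 :: real where s: "0 \<le> s2" "0 \<le> s4" "s3\<^sup>2 \<le> s2 * s4" 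
    "\<And>a. k a = 0 \<Longrightarrow> 1 / (y - Re a)\<^sup>2 \<le> s2"
    "G1 (of_real y) = - of_real s2" "G2 (of_real y) = 2 * of_real s3"
    "G3 (of_real y) = - 6 * of_real s4" using L[OF _ ky] by metis
  obtain g where g: "G (of_real y) = of_real g" using Greal[OF yW] by blast
  have "y \<noteq> Re a0"
    using real[OF zero] zero ky by (metis of_real_Re)
  hence "0 < 1 / (y - Re a0)\<^sup>2" by simp
  hence "0 < s2" using s(4)[OF zero] by linarith
  define c where "c = 16 * g ^ 4 + 48 * g\<^sup>2 * s2 + 12 * s2\<^sup>2 + 32 * g * s3 + 12 * s4"
  have Dpos: "c > 0" unfolding c_def by (rule fourth_derivative_quotient_pos[OF \<open>0 < s2\<close> s(2,3)])
  have "D (of_real y) = of_real c" by (simp add: D_def s g c_def)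
  hence "Re (Y (of_real y) * D (of_real y)) = Re (Y (of_real y)) * c" by simp
  hence "Re (Y (of_real y)) = 0" using y(3) Dpos by simp
  hence "Y (of_real y) = 0" using Yreal[of y] by simp
  thus False using ky by (simp add: Y_def)
qed

section \<open>Zeros and poles of the logarithmic derivative\<close>

lemma card_le_2_of_no_chain:
  fixes S :: "real set"
  assumes "\<And>a b c. a \<in> S \<Longrightarrow> b \<in> S \<Longrightarrow> c \<in> S \<Longrightarrow> a < b \<Longrightarrow> b < c \<Longrightarrow> False"
  shows "finite S \<and> card S \<le> 2"
proof (rule ccontr)
  assume *: "\<not> (finite S \<and> card S \<le> 2)"
  obtain T where T: "T \<subseteq> S" "card T = 3" "finite T"
  proof (cases "finite S")
    case True
    hence "3 \<le> card S" using * by simp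
    thus ?thesis using that by (rule obtain_subset_with_card_n)
  next
    case False
    thus ?thesis using that infinite_arbitrarily_large by metis
  qed
  define xs where "xs = sorted_list_of_set T"
  have xs: "length xs = 3" "sorted_wrt (<) xs" "set xs = T" using T by (simp_all add: xs_def)
  have "xs ! 0 < xs ! 1" "xs ! 1 < xs ! 2" using xs by (simp_all add: sorted_wrt_nth_less)
  moreover have "xs ! 0 \<in> S" "xs ! 1 \<in> S" "xs ! 2 \<in> S" using xs T nth_mem[of _ xs] by auto
  ultimately show False using assms by blast
qed

text \<open>
  Each point of \<open>S\<close> is assigned to the next point of \<open>Z\<close> in the direction of the origin, and to \<open>0\<close> if there is
  none. Points with the same image have no point of \<open>Z\<close> between them. Moving towards the origin makes
  \<open>ln (r / norm q)\<close> larger, so sums over \<open>S\<close> are dominated by sums over \<open>Z\<close>.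
\<close>
lemma inner_neighbour_assignment:
  fixes Z S :: "real set"
  assumes Z: "finite Z" "0 \<notin> Z" "S \<inter> Z = {}" "0 \<notin> S"
    and gap: "\<And>a b c. a \<in> S \<Longrightarrow> b \<in> S \<Longrightarrow> c \<in> S \<Longrightarrow> a < b \<Longrightarrow> b < c \<Longrightarrow> \<exists>z\<in>Z. z \<in> {a..c}"
  obtains \<pi> where "\<And>q. q \<in> S \<Longrightarrow> \<pi> q \<in> insert 0 Z" "\<And>q. q \<in> S \<Longrightarrow> \<bar>\<pi> q\<bar> \<le> \<bar>q\<bar>"
    "\<And>p. finite {q \<in> S. \<pi> q = p} \<and> card {q \<in> S. \<pi> q = p} \<le> 2"
proof -
  define U where "U = (\<lambda>q. insert 0 {z \<in> Z. 0 < z \<and> z < q})"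
  define L where "L = (\<lambda>q. insert 0 {z \<in> Z. q < z \<and> z < 0})"
  have fin: "finite (U q)" "finite (L q)" "U q \<noteq> {}" "L q \<noteq> {}" for q
    using Z by (auto simp: U_def L_def)
  define \<pi> where "\<pi> = (\<lambda>q. if q > 0 then Max (U q) else Min (L q))"
  have pos: "Max (U q) \<in> U q" "\<And>z. z \<in> U q \<Longrightarrow> z \<le> Max (U q)" for q using fin by auto
  have neg: "Min (L q) \<in> L q" "\<And>z. z \<in> L q \<Longrightarrow> Min (L q) \<le> z" for q using fin by auto
  show thesis
  proof (rule that[of \<pi>])
    fix q assume q: "q \<in> S"
    show "\<pi> q \<in> insert 0 Z" using pos(1)[of q] neg(1)[of q] by (auto simp: \<pi>_def U_def L_def)
    show "\<bar>\<pi> q\<bar> \<le> \<bar>q\<bar>" using pos(1)[of q] neg(1)[of q] by (auto simp: \<pi>_def U_def L_def)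
  next
    fix p
    show "finite {q \<in> S. \<pi> q = p} \<and> card {q \<in> S. \<pi> q = p} \<le> 2"
    proof (rule card_le_2_of_no_chain)
      fix a b c assume abc: "a \<in> {q \<in> S. \<pi> q = p}" "b \<in> {q \<in> S. \<pi> q = p}" "c \<in> {q \<in> S. \<pi> q = p}" "a < b" "b < c"
      obtain z where z: "z \<in> Z" "a \<le> z" "z \<le> c" using gap[of a b c] abc by auto
      have zac: "a < z" "z < c" using z abc Z(3) by (metis IntI Collect_mem_eq Collect_conj_eq Int_iff empty_iff order_le_less)+
      have z0: "z \<noteq> 0" using z Z by auto
      have pa: "\<pi> a = p" "\<pi> c = p" "a \<noteq> 0" "c \<noteq> 0" using abc Z by auto
      show False
      proof (cases "z > 0")
        case True
        hence zU: "z \<in> U c" "c > 0" using z zac by (auto simp: U_def)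
        hence "z \<le> p" using pos(2)[OF zU(1)] pa(2) by (simp add: \<pi>_def)
        moreover have "p \<le> max 0 a"
          using pos(1)[of a] neg(1)[of a] pa(1) by (auto simp: \<pi>_def U_def L_def split: if_splits)
        ultimately show False using True zac by auto
      next
        case False
        hence zL: "z \<in> L a" "a < 0" using z zac z0 by (auto simp: L_def)
        hence "p \<le> z" using neg(2)[OF zL(1)] pa(1) by (simp add: \<pi>_def)
        moreover have "min 0 c \<le> p"
          using pos(1)[of c] neg(1)[of c] pa(2) by (auto simp: \<pi>_def U_def L_def split: if_splits)
        ultimately show False using False z0 zac by auto
      qed
    qed
  qed
qed

lemma deriv_factored:
  fixes g :: "complex \<Rightarrow> complex"
  assumes "finite A" "g holomorphic_on UNIV" "\<And>w. f w = (\<Prod>a\<in>A. (w - a) ^ m a) * g w" "z \<notin> A"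
  shows "deriv f z = (\<Prod>a\<in>A. (z - a) ^ m a) * ((\<Sum>a\<in>A. of_nat (m a) / (z - a)) * g z + deriv g z)"
proof -
  have "(g has_field_derivative deriv g z) (at z)" using holomorphic_derivI[OF assms(2) open_UNIV] by simp
  from DERIV_mult[OF deriv_prod_power_exp[OF assms(1) refl assms(4), of m] this]
  have "((\<lambda>w. (\<Prod>a\<in>A. (w - a) ^ m a) * g w) has_field_derivative
     (\<Prod>a\<in>A. (z - a) ^ m a) * ((\<Sum>a\<in>A. of_nat (m a) / (z - a)) * g z + deriv g z)) (at z)"
    by (simp add: algebra_simps)
  moreover have "f = (\<lambda>w. (\<Prod>a\<in>A. (w - a) ^ m a) * g w)" using assms(3) by auto
  ultimately show ?thesis by (simp add: DERIV_imp_deriv)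
qed

text \<open>
  The quotient is \<open>Q' / Q - 6 k' / k\<close>, whose poles are simple, so one linear factor for each point of \<open>B\<close>
  clears the poles in \<open>B\<close>.
\<close>
lemma wronskian_simple_poles:
  fixes k Q :: "complex \<Rightarrow> complex"
  assumes B: "finite B" and k: "k holomorphic_on UNIV" "k z0 \<noteq> 0" and Q: "Q holomorphic_on UNIV" "Q z1 \<noteq> 0"
  shows "\<exists>N g. N holomorphic_on UNIV \<and> g holomorphic_on UNIV \<and> (\<forall>z. g z = 0 \<longrightarrow> z \<notin> B \<and> k z * Q z = 0) \<and>
    (\<forall>z. z \<notin> B \<longrightarrow> k z * Q z \<noteq> 0 \<longrightarrow>
       (deriv Q z * k z - 6 * deriv k z * Q z) / (k z * Q z) = N z / ((\<Prod>a\<in>B. z - a) * g z))"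
proof -
  obtain \<mu> g1 where g1: "g1 holomorphic_on UNIV" "\<And>a. a \<in> B \<Longrightarrow> g1 a \<noteq> 0"
    "\<And>z. k z = (\<Prod>a\<in>B. (z - a) ^ \<mu> a) * g1 z" using factor_zeros[OF B k] by metis
  obtain \<nu> g2 where g2: "g2 holomorphic_on UNIV" "\<And>a. a \<in> B \<Longrightarrow> g2 a \<noteq> 0"
    "\<And>z. Q z = (\<Prod>a\<in>B. (z - a) ^ \<nu> a) * g2 z" using factor_zeros[OF B Q] by metis
  define N where "N = (\<lambda>z. (\<Sum>a\<in>B. (of_nat (\<nu> a) - 6 * of_nat (\<mu> a)) * (\<Prod>b\<in>B-{a}. z - b)) * (g1 z * g2 z)
     + (\<Prod>a\<in>B. z - a) * (deriv g2 z * g1 z - 6 * deriv g1 z * g2 z))"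
  show ?thesis
  proof (rule exI[of _ N], rule exI[of _ "\<lambda>z. g1 z * g2 z"], intro conjI allI impI)
    show "N holomorphic_on UNIV" unfolding N_def
      by (intro holomorphic_intros g1 g2 holomorphic_deriv open_UNIV)
    show "(\<lambda>z. g1 z * g2 z) holomorphic_on UNIV" by (intro holomorphic_intros g1 g2)
    show "z \<notin> B" "k z * Q z = 0" if "g1 z * g2 z = 0" for z
      using that g1(2,3)[of z] g2(2,3)[of z] by auto
    fix z assume z: "z \<notin> B" "k z * Q z \<noteq> 0"
    define S1 S2 P where "S1 = (\<Prod>a\<in>B. (z - a) ^ \<mu> a)" and "S2 = (\<Prod>a\<in>B. (z - a) ^ \<nu> a)"
      and "P = (\<Prod>a\<in>B. z - a)"
    define s1 s2 where "s1 = (\<Sum>a\<in>B. of_nat (\<mu> a) / (z - a))" and "s2 = (\<Sum>a\<in>B. of_nat (\<nu> a) / (z - a))"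
    have nz: "S1 \<noteq> 0" "S2 \<noteq> 0" "P \<noteq> 0" "g1 z \<noteq> 0" "g2 z \<noteq> 0"
      using z B g1(3)[of z] g2(3)[of z] by (auto simp: S1_def S2_def P_def)
    have dk: "deriv k z = S1 * (s1 * g1 z + deriv g1 z)"
      unfolding S1_def s1_def by (rule deriv_factored[OF B g1(1) g1(3) z(1)])
    have dQ: "deriv Q z = S2 * (s2 * g2 z + deriv g2 z)"
      unfolding S2_def s2_def by (rule deriv_factored[OF B g2(1) g2(3) z(1)])
    have kQ: "k z = S1 * g1 z" "Q z = S2 * g2 z" using g1(3) g2(3) by (simp_all add: S1_def S2_def)
    have sums: "(\<Sum>a\<in>B. (of_nat (\<nu> a) - 6 * of_nat (\<mu> a)) * (\<Prod>b\<in>B-{a}. z - b)) = P * (s2 - 6 * s1)"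
    proof -
      have "(of_nat (\<nu> a) - 6 * of_nat (\<mu> a)) * (\<Prod>b\<in>B-{a}. z - b)
             = P * (of_nat (\<nu> a) / (z - a) - 6 * (of_nat (\<mu> a) / (z - a)))" if "a \<in> B" for a
      proof -
        have "z - a \<noteq> 0" using that z by auto
        moreover have "P = (z - a) * (\<Prod>b\<in>B-{a}. z - b)" unfolding P_def using that B by (simp add: prod.remove)
        moreover have "(n - 6 * m) * R = (u * R) * (n / u - 6 * (m / u))" if "u \<noteq> 0" for n m u R :: complex
          using that by (simp add: field_simps)
        ultimately show ?thesis by metis
      qed
      thus ?thesis by (simp add: s1_def s2_def sum_distrib_left sum_subtractf right_diff_distrib)
    qed
    have N: "N z = P * ((s2 - 6 * s1) * (g1 z * g2 z) + (deriv g2 z * g1 z - 6 * deriv g1 z * g2 z))"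
      unfolding N_def P_def[symmetric] sums by (simp add: algebra_simps)
    have "deriv Q z * k z - 6 * deriv k z * Q z = S1 * S2 * ((s2 - 6 * s1) * (g1 z * g2 z) + (deriv g2 z * g1 z - 6 * deriv g1 z * g2 z))"
      unfolding dk dQ kQ by (simp add: algebra_simps)
    thus "(deriv Q z * k z - 6 * deriv k z * Q z) / (k z * Q z) = N z / ((\<Prod>a\<in>B. z - a) * (g1 z * g2 z))"
      unfolding P_def[symmetric] N kQ using nz by (simp add: divide_simps)
  qed
qed

text \<open>
  The Jensen inequality for the numerator \<open>N\<close> of \<open>wronskian_simple_poles\<close>: a zero of \<open>k Q\<close> costs
  \<open>ln (r / norm a)\<close> only once, whatever its multiplicity.
\<close>
lemma circle_mean_wronskian_quotient:
  fixes k Q :: "complex \<Rightarrow> complex"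
  assumes k: "k holomorphic_on UNIV" "k 0 \<noteq> 0" and Q: "Q holomorphic_on UNIV" "Q 0 \<noteq> 0" and r: "r > 0"
  defines "D \<equiv> \<lambda>z. deriv Q z * k z - 6 * deriv k z * Q z"
  assumes nz: "\<And>z. norm z = r \<Longrightarrow> k z \<noteq> 0 \<and> Q z \<noteq> 0 \<and> D z \<noteq> 0" and D0: "D 0 \<noteq> 0"
  shows "ln (norm (D 0 / (k 0 * Q 0))) - (\<Sum>a | a \<in> ball 0 r \<and> k a * Q a = 0. ln (r / norm a))
         \<le> circle_mean (\<lambda>z. ln (norm (D z / (k z * Q z)))) r"
proof -
  define B where "B = {a. a \<in> ball 0 r \<and> k a * Q a = 0}"
  have kQ: "(\<lambda>z. k z * Q z) holomorphic_on UNIV" by (intro holomorphic_intros k Q)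
  have finB: "finite B"
    by (rule finite_subset[OF _ finite_zeros_cball[OF kQ, of 0 r]]) (use k Q in \<open>auto simp: B_def\<close>)
  obtain N g where N0: "N holomorphic_on UNIV" "g holomorphic_on UNIV" "\<forall>z. g z = 0 \<longrightarrow> z \<notin> B \<and> k z * Q z = 0"
    "\<forall>z. z \<notin> B \<longrightarrow> k z * Q z \<noteq> 0 \<longrightarrow>
       (deriv Q z * k z - 6 * deriv k z * Q z) / (k z * Q z) = N z / ((\<Prod>a\<in>B. z - a) * g z)"
    using wronskian_simple_poles[OF finB k Q] by blast
  note N = N0(1,2) N0(3)[rule_format]
  have eq: "D z / (k z * Q z) = N z / ((\<Prod>a\<in>B. z - a) * g z)" if "z \<notin> B" "k z * Q z \<noteq> 0" for z
    unfolding D_def using N0(4) that by blast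
  have B0: "norm a < r" "a \<noteq> 0" if "a \<in> B" for a using that k Q by (auto simp: B_def)
  have g_nz: "g z \<noteq> 0" if "z \<in> cball 0 r" for z
    using N(3)[of z] nz[of z] that by (auto simp: B_def)
  have ok: "z \<notin> B \<and> k z * Q z \<noteq> 0 \<and> D z \<noteq> 0" if "norm z = r \<or> z = 0" for z
    using that nz[of z] k Q D0 by (auto simp: B_def)
  have N_nz: "N z \<noteq> 0" if "norm z = r \<or> z = 0" for z
    using eq[of z] ok[OF that] by auto
  have lnq: "ln (norm (D z / (k z * Q z))) + ((\<Sum>a\<in>B. ln (norm (z - a))) + ln (norm (g z))) = ln (norm (N z))"
    if z: "norm z = r \<or> z = 0" for z
  proof -
    have gz: "g z \<noteq> 0" using g_nz[of z] z r by auto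
    have zb: "norm (z - a) > 0" if "a \<in> B" for a using ok[OF z] that by auto
    have P: "(\<Prod>a\<in>B. norm (z - a)) > 0" using zb by (intro prod_pos) auto
    have "ln (\<Prod>a\<in>B. norm (z - a)) = (\<Sum>a\<in>B. ln (norm (z - a)))"
      using zb finB by (intro ln_prod) auto
    moreover have "norm (D z / (k z * Q z)) = norm (N z) / ((\<Prod>a\<in>B. norm (z - a)) * norm (g z))"
      using eq[of z] ok[OF z] by (simp add: norm_divide norm_mult flip: prod_norm)
    ultimately show ?thesis using P gz N_nz[OF z] by (simp add: ln_div ln_mult)
  qed
  have DkQ: "D holomorphic_on UNIV" unfolding D_def
    by (intro holomorphic_intros k Q holomorphic_deriv open_UNIV)
  have contJ: "continuous_on (sphere 0 r) (\<lambda>z. ln (norm (D z / (k z * Q z))))"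
    by (intro continuous_intros holomorphic_on_imp_continuous_on holomorphic_on_subset[OF DkQ]
        holomorphic_on_subset[OF k(1)] holomorphic_on_subset[OF Q(1)]) (use nz in auto)
  have c1: "continuous_on (sphere 0 r) (\<lambda>z. ln (norm (z - a)))" if "a \<in> B" for a
    using B0[OF that] by (intro continuous_intros) auto
  have cg: "continuous_on (sphere 0 r) (\<lambda>z. ln (norm (g z)))"
    by (rule continuous_on_ln_norm[OF N(2)]) (use g_nz in auto)
  have "ln (norm (N 0)) + (\<Sum>a\<in>({}::complex set). ln (r / norm a)) \<le> circle_mean (\<lambda>z. ln (norm (N z))) r"
    by (rule Jensen_inequality[OF N(1) _ _ r]) (use N_nz in auto)
  also have "circle_mean (\<lambda>z. ln (norm (N z))) r =
     circle_mean (\<lambda>z. ln (norm (D z / (k z * Q z))) + ((\<Sum>a\<in>B. ln (norm (z - a))) + ln (norm (g z)))) r"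
    by (rule circle_mean_cong[OF _ r]) (use lnq in auto)
  also have "\<dots> = circle_mean (\<lambda>z. ln (norm (D z / (k z * Q z)))) r
     + (circle_mean (\<lambda>z. \<Sum>a\<in>B. ln (norm (z - a))) r + circle_mean (\<lambda>z. ln (norm (g z))) r)"
    by (subst circle_mean_add[OF contJ _ r] circle_mean_add[OF _ cg r];
        intro continuous_intros c1 cg refl circle_mean_add r arg_cong2[of _ _ _ _ "(+)"])+
  also have "circle_mean (\<lambda>z. ln (norm (g z))) r = ln (norm (g 0))"
    by (rule circle_mean_ln_zero_free[OF N(2) g_nz r])
  also have "circle_mean (\<lambda>z. \<Sum>a\<in>B. ln (norm (z - a))) r = (\<Sum>a\<in>B. ln r)"
    by (subst circle_mean_sum[OF finB c1 r]) (auto simp: circle_mean_ln_linear B0)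
  finally have 1: "ln (norm (N 0)) \<le> circle_mean (\<lambda>z. ln (norm (D z / (k z * Q z)))) r + ((\<Sum>a\<in>B. ln r) + ln (norm (g 0)))"
    by simp
  have "(\<Sum>a\<in>B. ln (r / norm a)) = (\<Sum>a\<in>B. ln r) - (\<Sum>a\<in>B. ln (norm (0 - a)))"
    unfolding sum_subtractf[symmetric]
    by (intro sum.cong) (use B0 r in \<open>auto simp: ln_div\<close>)
  thus ?thesis using 1 lnq[of 0] unfolding B_def[symmetric] by simp
qed

section \<open>A Milloux inequality\<close>

text \<open>
  The functions to be excluded, after a real translation that moves the origin away from all zeros in sight.
\<close>
locale normalized_counterexample =
  fixes k :: "complex \<Rightarrow> complex"
  assumes exp_type: "exp_type k"
    and nz0: "k 0 \<noteq> 0" "deriv k 0 \<noteq> 0" "schwarzian_part k 0 \<noteq> 0" "scaled_potential k 0 \<noteq> 0" "potential_wronskian k 0 \<noteq> 0"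
    and zeros_real: "\<And>a. k a = 0 \<Longrightarrow> a \<in> \<real>"
    and potential_zeros_real: "\<And>a. scaled_potential k a = 0 \<Longrightarrow> a \<in> \<real>"
    and square_real: "\<And>x::real. Im (k (of_real x) ^ 2) = 0"
    and has_zero: "\<exists>a. k a = 0"
begin

lemma hol: "k holomorphic_on UNIV"
  using exp_type exp_type_holomorphic by blast

text \<open>
  The conditions that \<open>radius_avoiding_zeros\<close> and \<open>logderiv_bound\<close> provide on a single circle.
\<close>
definition tame_circle :: "real \<Rightarrow> real \<Rightarrow> bool" where
  "tame_circle C r \<longleftrightarrow> (\<forall>z. norm z = r \<longrightarrow>
     k z \<noteq> 0 \<and> schwarzian_part k z \<noteq> 0 \<and> scaled_potential k z \<noteq> 0 \<and> potential_wronskian k z \<noteq> 0 \<and>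
     norm (deriv k z) \<le> C * r * norm (k z) \<and> norm (deriv (deriv k) z) \<le> C * r * norm (deriv k z) \<and>
     norm (deriv (schwarzian_part k) z) \<le> C * r * norm (schwarzian_part k z) \<and>
     norm (deriv (scaled_potential k) z) \<le> C * r * norm (scaled_potential k z))"

lemma tame_circles_exist:
  obtains C where "C > 0" "\<And>R. R \<ge> 1 \<Longrightarrow> \<exists>r\<in>{R..2*R}. tame_circle C r"
proof -
  note E = exp_type exp_type_deriv[OF exp_type] potential_exp_type[OF exp_type]
  define F where "F = (\<lambda>z. k z * deriv k z * schwarzian_part k z * scaled_potential k z * potential_wronskian k z)"
  have "exp_type F" unfolding F_def by (intro exp_type_mult E)
  moreover have "F 0 \<noteq> 0" using nz0 by (simp add: F_def)
  ultimately obtain \<delta> where \<delta>: "\<delta> > 0"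
    "\<And>R. R \<ge> 1 \<Longrightarrow> \<exists>r\<in>{R..2*R}. \<forall>a. F a = 0 \<longrightarrow> \<delta> \<le> \<bar>norm a - r\<bar>"
    using radius_avoiding_zeros by blast
  obtain C1 where C1: "C1 > 0" "\<And>r z. r \<ge> 1 \<Longrightarrow> (\<And>a. k a = 0 \<Longrightarrow> \<delta> \<le> \<bar>norm a - r\<bar>) \<Longrightarrow> norm z = r \<Longrightarrow>
      norm (deriv k z) \<le> C1 * r * norm (k z)" using logderiv_bound[OF E(1) nz0(1) \<delta>(1)] by metis
  obtain C2 where C2: "C2 > 0" "\<And>r z. r \<ge> 1 \<Longrightarrow> (\<And>a. deriv k a = 0 \<Longrightarrow> \<delta> \<le> \<bar>norm a - r\<bar>) \<Longrightarrow> norm z = r \<Longrightarrow>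
      norm (deriv (deriv k) z) \<le> C2 * r * norm (deriv k z)" using logderiv_bound[OF E(2) nz0(2) \<delta>(1)] by metis
  obtain C3 where C3: "C3 > 0" "\<And>r z. r \<ge> 1 \<Longrightarrow> (\<And>a. schwarzian_part k a = 0 \<Longrightarrow> \<delta> \<le> \<bar>norm a - r\<bar>) \<Longrightarrow> norm z = r \<Longrightarrow>
      norm (deriv (schwarzian_part k) z) \<le> C3 * r * norm (schwarzian_part k z)" using logderiv_bound[OF E(3) nz0(3) \<delta>(1)] by metis
  obtain C4 where C4: "C4 > 0" "\<And>r z. r \<ge> 1 \<Longrightarrow> (\<And>a. scaled_potential k a = 0 \<Longrightarrow> \<delta> \<le> \<bar>norm a - r\<bar>) \<Longrightarrow> norm z = r \<Longrightarrow>
      norm (deriv (scaled_potential k) z) \<le> C4 * r * norm (scaled_potential k z)" using logderiv_bound[OF E(4) nz0(4) \<delta>(1)] by metis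
  define C where "C = C1 + C2 + C3 + C4"
  have CC: "C1 \<le> C" "C2 \<le> C" "C3 \<le> C" "C4 \<le> C" "C > 0" using C1(1) C2(1) C3(1) C4(1) by (auto simp: C_def)
  show thesis
  proof (rule that[OF CC(5)])
    fix R :: real assume R: "R \<ge> 1"
    obtain r where r: "r \<in> {R..2*R}" "\<forall>a. F a = 0 \<longrightarrow> \<delta> \<le> \<bar>norm a - r\<bar>" using \<delta>(2)[OF R] by blast
    have r1: "r \<ge> 1" using r R by simp
    have up: "x \<le> C * r * y" if "x \<le> c * r * y" "c \<le> C" "y \<ge> 0" for x y c
    proof -
      have "c * r * y \<le> C * r * y" using that r1 by (intro mult_right_mono) auto
      thus ?thesis using that by linarith
    qed
    show "\<exists>r\<in>{R..2*R}. tame_circle C r"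
    proof (rule bexI[OF _ r(1)], unfold tame_circle_def, intro allI impI)
      fix z :: complex assume z: "norm z = r"
      have "F z \<noteq> 0" using r(2)[rule_format, of z] z \<delta>(1) by auto
      hence nz: "k z \<noteq> 0 \<and> schwarzian_part k z \<noteq> 0 \<and> scaled_potential k z \<noteq> 0 \<and> potential_wronskian k z \<noteq> 0"
        by (simp add: F_def)
      have d1: "norm (deriv k z) \<le> C * r * norm (k z)"
        by (rule up[OF C1(2)[OF r1 _ z] CC(1)]) (use r(2) in \<open>auto simp: F_def\<close>)
      have d2: "norm (deriv (deriv k) z) \<le> C * r * norm (deriv k z)"
        by (rule up[OF C2(2)[OF r1 _ z] CC(2)]) (use r(2) in \<open>auto simp: F_def\<close>)
      have d3: "norm (deriv (schwarzian_part k) z) \<le> C * r * norm (schwarzian_part k z)"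
        by (rule up[OF C3(2)[OF r1 _ z] CC(3)]) (use r(2) in \<open>auto simp: F_def\<close>)
      have d4: "norm (deriv (scaled_potential k) z) \<le> C * r * norm (scaled_potential k z)"
        by (rule up[OF C4(2)[OF r1 _ z] CC(4)]) (use r(2) in \<open>auto simp: F_def\<close>)
      show "k z \<noteq> 0 \<and> schwarzian_part k z \<noteq> 0 \<and> scaled_potential k z \<noteq> 0 \<and> potential_wronskian k z \<noteq> 0 \<and>
    norm (deriv k z) \<le> C * r * norm (k z) \<and> norm (deriv (deriv k) z) \<le> C * r * norm (deriv k z) \<and>
    norm (deriv (schwarzian_part k) z) \<le> C * r * norm (schwarzian_part k z) \<and>
    norm (deriv (scaled_potential k) z) \<le> C * r * norm (scaled_potential k z)"
        using nz d1 d2 d3 d4 by blast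
    qed
  qed
qed

text \<open>
  With \<open>J = potential_wronskian k / (k * scaled_potential k)\<close> one has
  \<open>k^6 J = S (S' / S - Q' / Q)\<close>, where \<open>S\<close> is \<open>schwarzian_part k\<close> and \<open>Q\<close> is
  \<open>scaled_potential k\<close>. Since \<open>S / k^2\<close> is a polynomial in logarithmic derivatives,
  \<open>|k|^4 |J| = O(r^3)\<close>; together with \<open>|J| = O(r)\<close> this covers large and small values of \<open>k\<close>.
\<close>
lemma pointwise_milloux:
  assumes z: "k z \<noteq> 0" "schwarzian_part k z \<noteq> 0" "scaled_potential k z \<noteq> 0" "potential_wronskian k z \<noteq> 0"
    and C: "C > 0" and r: "r \<ge> 1"
    and d: "norm (deriv k z) \<le> C * r * norm (k z)" "norm (deriv (deriv k) z) \<le> C * r * norm (deriv k z)"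
    "norm (deriv (schwarzian_part k) z) \<le> C * r * norm (schwarzian_part k z)"
    "norm (deriv (scaled_potential k) z) \<le> C * r * norm (scaled_potential k z)"
  shows "4 * max 0 (ln (norm (k z))) + ln (norm (potential_wronskian k z / (k z * scaled_potential k z)))
         \<le> \<bar>ln (7 * C)\<bar> + \<bar>ln (24 * C ^ 3)\<bar> + 3 * ln r"
proof -
  define J where "J = potential_wronskian k z / (k z * scaled_potential k z)"
  have J: "norm J > 0" using z by (simp add: J_def)
  have lnr: "ln r \<ge> 0" using r by simp
  have "J = deriv (scaled_potential k) z / scaled_potential k z - 6 * (deriv k z / k z)"
    using z by (simp add: J_def potential_wronskian_def field_simps)
  hence "norm J \<le> norm (deriv (scaled_potential k) z / scaled_potential k z) + norm (6 * (deriv k z / k z))"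
    by (simp add: norm_triangle_ineq4)
  also have "\<dots> \<le> C * r + 6 * (C * r)"
    using z d by (intro add_mono) (auto simp: norm_divide norm_mult field_simps)
  finally have "norm J \<le> (7 * C) * r" by simp
  hence "ln (norm J) \<le> ln ((7 * C) * r)" using J C r by (simp add: ln_le_cancel_iff)
  hence 1: "ln (norm J) \<le> ln (7 * C) + ln r" using C r by (simp add: ln_mult)
  have "norm (schwarzian_part k z) \<le> 4 * norm (k z) * norm (deriv (deriv k) z) + 8 * norm (deriv k z) ^ 2"
    unfolding schwarzian_part_def by (rule order.trans[OF norm_triangle_ineq4]) (simp add: norm_mult norm_power)
  also have "\<dots> \<le> 4 * norm (k z) * (C * r * (C * r * norm (k z))) + 8 * (C * r * norm (k z)) ^ 2"
  proof (intro add_mono mult_left_mono power_mono d)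
    have "C * r * norm (deriv k z) \<le> C * r * (C * r * norm (k z))"
      using C r d(1) by (intro mult_left_mono) auto
    thus "norm (deriv (deriv k) z) \<le> C * r * (C * r * norm (k z))" using d(2) by linarith
  qed auto
  also have "\<dots> = 12 * (C * r)\<^sup>2 * norm (k z) ^ 2" by (simp add: power2_eq_square algebra_simps)
  finally have rest: "norm (schwarzian_part k z) \<le> 12 * (C * r)\<^sup>2 * norm (k z) ^ 2" .
  have "k z ^ 6 * J = schwarzian_part k z * (deriv (schwarzian_part k) z / schwarzian_part k z - deriv (scaled_potential k) z / scaled_potential k z)"
  proof -
    have "k z ^ 6 * J = (k z ^ 5 * potential_wronskian k z) / scaled_potential k z"
      using z by (simp add: J_def eval_nat_numeral)
    also have "\<dots> = (deriv (schwarzian_part k) z * scaled_potential k z - deriv (scaled_potential k) z * schwarzian_part k z) / scaled_potential k z"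
      by (simp only: potential_wronskian_rest(2)[OF hol])
    also have "\<dots> = schwarzian_part k z * (deriv (schwarzian_part k) z / schwarzian_part k z - deriv (scaled_potential k) z / scaled_potential k z)"
      using z by (simp add: field_simps)
    finally show ?thesis .
  qed
  hence "norm (k z) ^ 6 * norm J = norm (schwarzian_part k z) *
      norm (deriv (schwarzian_part k) z / schwarzian_part k z - deriv (scaled_potential k) z / scaled_potential k z)"
    by (metis norm_mult norm_power)
  also have "\<dots> \<le> (12 * (C * r)\<^sup>2 * norm (k z) ^ 2) * (C * r + C * r)"
  proof (intro mult_mono rest)
    have "norm (deriv (schwarzian_part k) z / schwarzian_part k z) \<le> C * r" "norm (deriv (scaled_potential k) z / scaled_potential k z) \<le> C * r"
      using z d by (auto simp: norm_divide field_simps)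
    thus "norm (deriv (schwarzian_part k) z / schwarzian_part k z - deriv (scaled_potential k) z / scaled_potential k z) \<le> C * r + C * r"
      by (rule order.trans[OF norm_triangle_ineq4 add_mono])
  qed (use C r in auto)
  also have "\<dots> = norm (k z) ^ 2 * (24 * C ^ 3 * r ^ 3)"
    by (simp add: power2_eq_square power3_eq_cube algebra_simps)
  finally have "norm (k z) ^ 2 * (norm (k z) ^ 4 * norm J) \<le> norm (k z) ^ 2 * (24 * C ^ 3 * r ^ 3)"
    by (simp add: mult.assoc[symmetric] flip: power_add)
  hence "norm (k z) ^ 4 * norm J \<le> 24 * C ^ 3 * r ^ 3"
    by (rule mult_left_le_imp_le) (use z in simp)
  hence "ln (norm (k z) ^ 4 * norm J) \<le> ln (24 * C ^ 3 * r ^ 3)"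
    using J C r z by (subst ln_le_cancel_iff) auto
  moreover have "ln (norm (k z) ^ 4 * norm J) = 4 * ln (norm (k z)) + ln (norm J)"
    using J z by (simp add: ln_mult ln_realpow)
  moreover have "ln (24 * C ^ 3 * r ^ 3) = ln (24 * C ^ 3) + 3 * ln r"
    using C r by (simp add: ln_mult_pos ln_realpow)
  ultimately have 2: "4 * ln (norm (k z)) + ln (norm J) \<le> ln (24 * C ^ 3) + 3 * ln r" by simp
  show ?thesis unfolding J_def[symmetric] using 1 2 lnr by (auto simp: max_def)
qed

lemma continuous_log_plus:
  assumes "\<And>z. z \<in> S \<Longrightarrow> k z \<noteq> 0"
  shows "continuous_on S (\<lambda>z. max 0 (ln (norm (k z))))"
  by (intro continuous_intros continuous_on_ln_norm[OF hol assms])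

text \<open>
  The mean of \<open>pointwise_milloux\<close> over a tame circle, with \<open>circle_mean_wronskian_quotient\<close> as the lower bound for the
  mean of \<open>ln |J|\<close>.
\<close>
lemma milloux_inequality:
  obtains C where "\<And>R. R \<ge> 1 \<Longrightarrow> \<exists>r\<in>{R..2*R}. (\<forall>z. norm z = r \<longrightarrow> k z \<noteq> 0) \<and>
    4 * circle_mean (\<lambda>z. max 0 (ln (norm (k z)))) r \<le>
    C + 3 * ln r + (\<Sum>a | a \<in> ball 0 r \<and> k a * scaled_potential k a = 0. ln (r / norm a))"
proof -
  obtain C where C: "C > 0" "\<And>R. R \<ge> 1 \<Longrightarrow> \<exists>r\<in>{R..2*R}. tame_circle C r"
    using tame_circles_exist by blast
  define K where "K = \<bar>ln (7 * C)\<bar> + \<bar>ln (24 * C ^ 3)\<bar>"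
  define J where "J = (\<lambda>z. potential_wronskian k z / (k z * scaled_potential k z))"
  show thesis
  proof (rule that[of "K - ln (norm (J 0))"])
    fix R :: real assume R: "R \<ge> 1"
    obtain r where r: "r \<in> {R..2*R}" and b: "\<And>z. norm z = r \<Longrightarrow>
    k z \<noteq> 0 \<and> schwarzian_part k z \<noteq> 0 \<and> scaled_potential k z \<noteq> 0 \<and> potential_wronskian k z \<noteq> 0 \<and>
    norm (deriv k z) \<le> C * r * norm (k z) \<and> norm (deriv (deriv k) z) \<le> C * r * norm (deriv k z) \<and>
    norm (deriv (schwarzian_part k) z) \<le> C * r * norm (schwarzian_part k z) \<and>
    norm (deriv (scaled_potential k) z) \<le> C * r * norm (scaled_potential k z)" using C(2)[OF R] unfolding tame_circle_def by blast
    have r1: "r \<ge> 1" "r > 0" using r R by auto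
    have c1: "continuous_on (sphere 0 r) (\<lambda>z. 4 * max 0 (ln (norm (k z))))"
      by (intro continuous_intros continuous_log_plus) (use b in auto)
    have c2: "continuous_on (sphere 0 r) (\<lambda>z. ln (norm (J z)))" unfolding J_def
      by (intro continuous_intros holomorphic_on_imp_continuous_on holomorphic_on_subset[OF hol]
          holomorphic_on_subset[OF potential_holomorphic(2)[OF hol]] holomorphic_on_subset[OF potential_holomorphic(3)[OF hol]])
         (use b in auto)
    have "circle_mean (\<lambda>z. 4 * max 0 (ln (norm (k z)))) r + circle_mean (\<lambda>z. ln (norm (J z))) r
       = circle_mean (\<lambda>z. 4 * max 0 (ln (norm (k z))) + ln (norm (J z))) r"
      by (rule circle_mean_add[OF c1 c2 r1(2), symmetric])
    also have "\<dots> \<le> circle_mean (\<lambda>_. K + 3 * ln r) r"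
    proof (rule circle_mean_mono[OF continuous_on_add[OF c1 c2] continuous_on_const r1(2)])
      fix z :: complex assume z: "norm z = r"
      show "4 * max 0 (ln (norm (k z))) + ln (norm (J z)) \<le> K + 3 * ln r"
        unfolding K_def J_def by (rule pointwise_milloux) (use b[OF z] C(1) r1 in auto)
    qed
    finally have 1: "4 * circle_mean (\<lambda>z. max 0 (ln (norm (k z)))) r + circle_mean (\<lambda>z. ln (norm (J z))) r \<le> K + 3 * ln r"
      by (simp add: circle_mean_cmult)
    have "ln (norm (J 0)) - (\<Sum>a | a \<in> ball 0 r \<and> k a * scaled_potential k a = 0. ln (r / norm a))
         \<le> circle_mean (\<lambda>z. ln (norm (J z))) r"
      unfolding J_def potential_wronskian_def
      by (rule circle_mean_wronskian_quotient[OF hol nz0(1) potential_holomorphic(2)[OF hol] nz0(4) r1(2)])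
         (use b nz0 in \<open>auto simp: potential_wronskian_def\<close>)
    with 1 have "4 * circle_mean (\<lambda>z. max 0 (ln (norm (k z)))) r \<le>
    K - ln (norm (J 0)) + 3 * ln r + (\<Sum>a | a \<in> ball 0 r \<and> k a * scaled_potential k a = 0. ln (r / norm a))" by linarith
    thus "\<exists>r\<in>{R..2*R}. (\<forall>z. norm z = r \<longrightarrow> k z \<noteq> 0) \<and> 4 * circle_mean (\<lambda>z. max 0 (ln (norm (k z)))) r \<le>
    K - ln (norm (J 0)) + 3 * ln r + (\<Sum>a | a \<in> ball 0 r \<and> k a * scaled_potential k a = 0. ln (r / norm a))"
      using r b by blast
  qed
qed

text \<open>
  The hypothesis of \<open>inner_neighbour_assignment\<close> on triples of points is \<open>no_three_potential_zeros_in_gap\<close>. The set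
  \<open>Z\<close> may consist of the zeros in a disc or of all zeros, as long as it reaches as far out as \<open>S\<close>.
\<close>
lemma potential_zero_assignment:
  assumes B: "finite Z" "Z \<subseteq> {a. k a = 0}" "S \<subseteq> {a. scaled_potential k a = 0 \<and> k a \<noteq> 0}"
    and conv: "\<And>z c. k z = 0 \<Longrightarrow> c \<in> S \<Longrightarrow> norm z \<le> norm c \<Longrightarrow> z \<in> Z"
  obtains \<pi> where "\<And>q. q \<in> S \<Longrightarrow> \<pi> q \<in> insert 0 Z" "\<And>q. q \<in> S \<Longrightarrow> norm (\<pi> q) \<le> norm q"
    "\<And>p. finite {q \<in> S. \<pi> q = p} \<and> card {q \<in> S. \<pi> q = p} \<le> 2"
proof -
  have reZ: "z \<in> \<real>" if "z \<in> Z" for z using that B zeros_real by auto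
  have reS: "z \<in> \<real>" if "z \<in> S" for z using that B potential_zeros_real by auto
  have nrm: "norm z = \<bar>Re z\<bar>" if "z \<in> \<real>" for z using that by (metis of_real_Re norm_of_real)
  have memS: "of_real x \<in> S" if "x \<in> Re ` S" for x
  proof -
    from that obtain q where "q \<in> S" "x = Re q" by blast
    thus ?thesis using reS of_real_Re by simp
  qed
  obtain \<rho> where \<rho>: "\<And>q. q \<in> Re ` S \<Longrightarrow> \<rho> q \<in> insert 0 (Re ` Z)" "\<And>q. q \<in> Re ` S \<Longrightarrow> \<bar>\<rho> q\<bar> \<le> \<bar>q\<bar>"
    "\<And>p. finite {q \<in> Re ` S. \<rho> q = p} \<and> card {q \<in> Re ` S. \<rho> q = p} \<le> 2"
  proof (rule inner_neighbour_assignment[of "Re ` Z" "Re ` S"])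
    show "finite (Re ` Z)" using B by simp
    show "0 \<notin> Re ` Z"
    proof
      assume "0 \<in> Re ` Z"
      then obtain z where "z \<in> Z" "Re z = 0" by auto
      hence "z = 0" using reZ by (metis of_real_Re of_real_0)
      thus False using \<open>z \<in> Z\<close> B nz0 by auto
    qed
    show "0 \<notin> Re ` S" using memS[of 0] B nz0 by auto
    show "Re ` S \<inter> Re ` Z = {}"
    proof (rule ccontr)
      assume "Re ` S \<inter> Re ` Z \<noteq> {}"
      then obtain s z where "s \<in> S" "z \<in> Z" "Re s = Re z" by auto
      hence "s = z" using reS reZ by (metis of_real_Re)
      thus False using B \<open>s \<in> S\<close> \<open>z \<in> Z\<close> by auto
    qed
    fix a b c assume abc: "a \<in> Re ` S" "b \<in> Re ` S" "c \<in> Re ` S" "a < b" "b < c"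
    have Q: "scaled_potential k (of_real a) = 0" "scaled_potential k (of_real b) = 0" "scaled_potential k (of_real c) = 0"
      using memS abc B by blast+
    obtain a0 where a0: "k a0 = 0" using has_zero by blast
    obtain x where x: "x \<in> {a..c}" "k (of_real x) = 0"
      using no_three_potential_zeros_in_gap[OF exp_type nz0(1) zeros_real square_real a0 abc(4,5) _ Q] by blast
    have "of_real x \<in> Z"
    proof (cases "x \<ge> 0")
      case True
      show ?thesis by (rule conv[OF x(2) memS[OF abc(3)]]) (use x True in auto)
    next
      case False
      show ?thesis by (rule conv[OF x(2) memS[OF abc(1)]]) (use x False in auto)
    qed
    hence "x \<in> Re ` Z" by (metis Re_complex_of_real image_eqI)
    thus "\<exists>z\<in>Re ` Z. z \<in> {a..c}" using x by blast
  qed blast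
  show thesis
  proof (rule that[of "\<lambda>q. of_real (\<rho> (Re q))"])
    fix q assume q: "q \<in> S"
    show "complex_of_real (\<rho> (Re q)) \<in> insert 0 Z"
    proof -
      have "\<rho> (Re q) = 0 \<or> (\<exists>z\<in>Z. \<rho> (Re q) = Re z)" using \<rho>(1)[of "Re q"] q by auto
      thus ?thesis using reZ of_real_Re by auto
    qed
    show "norm (complex_of_real (\<rho> (Re q))) \<le> norm q"
      using \<rho>(2)[of "Re q"] q nrm[OF reS[OF q]] by simp
  next
    fix p :: complex
    let ?F = "{q \<in> S. of_real (\<rho> (Re q)) = p}"
    have inj: "inj_on Re ?F"
      by (rule inj_onI) (metis (mono_tags, lifting) of_real_Re mem_Collect_eq reS)
    have sub: "Re ` ?F \<subseteq> {q \<in> Re ` S. \<rho> q = Re p}" by auto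
    have fin: "finite (Re ` ?F)" using finite_subset[OF sub] \<rho>(3)[of "Re p"] by blast
    have "card (Re ` ?F) \<le> 2" using card_mono[OF _ sub] \<rho>(3)[of "Re p"] by linarith
    thus "finite ?F \<and> card ?F \<le> 2" using finite_imageD[OF fin inj] card_image[OF inj] by simp
  qed
qed

end

lemma nonzero_near_0:
  fixes f :: "complex \<Rightarrow> complex"
  assumes "f holomorphic_on UNIV" "f 0 \<noteq> 0"
  obtains \<eta> where "\<eta> > 0" "\<eta> \<le> 1" "\<And>a. f a = 0 \<Longrightarrow> \<eta> \<le> norm a"
proof -
  have "open {z. f z \<noteq> 0}"
    by (rule open_nonzero[OF assms(1)])
  then obtain e where e: "e > 0" "ball 0 e \<subseteq> {z. f z \<noteq> 0}"
    using assms(2) unfolding open_contains_ball by blast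
  show thesis
  proof (rule that[of "min e 1"])
    fix a assume "f a = 0"
    hence "a \<notin> ball 0 e" using e(2) by auto
    thus "min e 1 \<le> norm a" by simp
  qed (use e in auto)
qed

lemma tendsto_z_div:
  "((\<lambda>z::complex. z / (z - a)) \<longlongrightarrow> 1) at_infinity"
proof -
  have "((\<lambda>z::complex. inverse (1 - a * inverse z)) \<longlongrightarrow> inverse (1 - a * 0)) at_infinity"
    by (intro tendsto_intros tendsto_inverse_0) auto
  moreover have "eventually (\<lambda>z::complex. z \<noteq> 0) at_infinity"
    unfolding eventually_at_infinity by (intro exI[of _ 1]) auto
  hence "eventually (\<lambda>z::complex. inverse (1 - a * inverse z) = z / (z - a)) at_infinity"
    by eventually_elim (auto simp: field_simps)
  ultimately show ?thesis by (simp add: filterlim_cong)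
qed

context normalized_counterexample
begin

text \<open>
  Up to \<open>O(log r)\<close> the zeros of \<open>scaled_potential k\<close> count at most twice as much as those of \<open>k\<close>, and
  these are bounded by the Jensen inequality. The Milloux inequality then reads \<open>4 m \<le> 3 m + O(log r)\<close>, where \<open>m\<close> is the mean of \<open>log+ |k|\<close>.
\<close>
lemma log_growth:
  obtains C where "\<And>R. R \<ge> 1 \<Longrightarrow> \<exists>r\<in>{R..2*R}. (\<forall>z. norm z = r \<longrightarrow> k z \<noteq> 0) \<and>
    circle_mean (\<lambda>z. max 0 (ln (norm (k z)))) r \<le> C + 5 * ln r \<and>
    (\<Sum>a | a \<in> ball 0 r \<and> k a = 0. ln (r / norm a)) \<le> C + 5 * ln r"
proof -
  obtain C where C: "\<And>R. R \<ge> 1 \<Longrightarrow> \<exists>r\<in>{R..2*R}. (\<forall>z. norm z = r \<longrightarrow> k z \<noteq> 0) \<and>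
    4 * circle_mean (\<lambda>z. max 0 (ln (norm (k z)))) r \<le>
    C + 3 * ln r + (\<Sum>a | a \<in> ball 0 r \<and> k a * scaled_potential k a = 0. ln (r / norm a))"
    using milloux_inequality by blast
  \<comment> \<open>\<open>\<eta>\<close> handles the zeros of the potential that are assigned to the origin.\<close>
  obtain \<eta> where \<eta>: "\<eta> > 0" "\<eta> \<le> 1" "\<And>a. scaled_potential k a = 0 \<Longrightarrow> \<eta> \<le> norm a"
    using nonzero_near_0[OF potential_holomorphic(2)[OF hol] nz0(4)] by metis
  define L where "L = ln (norm (k 0))"
  define K where "K = \<bar>C\<bar> + 2 * \<bar>ln \<eta>\<bar> + 4 * \<bar>L\<bar>"
  show thesis
  proof (rule that[of K])
    fix R :: real assume R: "R \<ge> 1"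
    obtain r where r: "r \<in> {R..2*R}" "\<forall>z. norm z = r \<longrightarrow> k z \<noteq> 0"
     "4 * circle_mean (\<lambda>z. max 0 (ln (norm (k z)))) r \<le>
      C + 3 * ln r + (\<Sum>a | a \<in> ball 0 r \<and> k a * scaled_potential k a = 0. ln (r / norm a))"
      using C[OF R] by blast
    have r1: "r \<ge> 1" "r > 0" using r R by auto
    define Z where "Z = {a. a \<in> ball 0 r \<and> k a = 0}"
    define S where "S = {a. a \<in> ball 0 r \<and> scaled_potential k a = 0 \<and> k a \<noteq> 0}"
    have finZ: "finite Z"
      by (rule finite_subset[OF _ finite_zeros_cball[OF hol nz0(1), of r]]) (auto simp: Z_def)
    have finS: "finite S"
      by (rule finite_subset[OF _ finite_zeros_cball[OF potential_holomorphic(2)[OF hol] nz0(4), of r]]) (auto simp: S_def)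
    have Z0: "0 \<notin> Z" "0 \<notin> S" using nz0 by (auto simp: Z_def S_def)
    obtain \<pi> where \<pi>: "\<And>q. q \<in> S \<Longrightarrow> \<pi> q \<in> insert 0 Z" "\<And>q. q \<in> S \<Longrightarrow> norm (\<pi> q) \<le> norm q"
      "\<And>p. finite {q \<in> S. \<pi> q = p} \<and> card {q \<in> S. \<pi> q = p} \<le> 2"
    proof (rule potential_zero_assignment[OF finZ])
      show "Z \<subseteq> {a. k a = 0}" "S \<subseteq> {a. scaled_potential k a = 0 \<and> k a \<noteq> 0}" by (auto simp: Z_def S_def)
      show "z \<in> Z" if "k z = 0" "c \<in> S" "norm z \<le> norm c" for z c using that by (auto simp: Z_def S_def)
    qed blast
    have fib: "(\<Sum>q | q \<in> S \<and> \<pi> q = p. ln (r / norm q)) \<le> 2 * ln (r / b)"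
      if b: "b > 0" "\<And>q. q \<in> S \<Longrightarrow> \<pi> q = p \<Longrightarrow> b \<le> norm q" "b \<le> r" for p b
    proof -
      have "(\<Sum>q | q \<in> S \<and> \<pi> q = p. ln (r / norm q)) \<le> real (card {q \<in> S. \<pi> q = p}) * ln (r / b)"
      proof (rule sum_bounded_above)
        fix q assume q: "q \<in> {q. q \<in> S \<and> \<pi> q = p}"
        have "b \<le> norm q" using b(2) q by auto
        moreover have nq: "norm q > 0" using q Z0 by auto
        ultimately have "r / norm q \<le> r / b" using b(1) r1 by (intro divide_left_mono mult_pos_pos) auto
        moreover note nq
        ultimately show "ln (r / norm q) \<le> ln (r / b)" using b(1) r1 by simp
      qed
      also have "\<dots> \<le> 2 * ln (r / b)"
        using \<pi>(3)[of p] b(1,3) by (intro mult_right_mono) auto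
      finally show ?thesis .
    qed
    have "(\<Sum>q\<in>S. ln (r / norm q)) = (\<Sum>p\<in>insert 0 Z. \<Sum>q | q \<in> S \<and> \<pi> q = p. ln (r / norm q))"
      by (rule sum.group[symmetric]) (use finS finZ \<pi>(1) in auto)
    also have "\<dots> = (\<Sum>q | q \<in> S \<and> \<pi> q = 0. ln (r / norm q)) + (\<Sum>p\<in>Z. \<Sum>q | q \<in> S \<and> \<pi> q = p. ln (r / norm q))"
      using finZ Z0 by simp
    also have "\<dots> \<le> 2 * ln (r / \<eta>) + (\<Sum>p\<in>Z. 2 * ln (r / norm p))"
    proof (intro add_mono sum_mono fib)
      show "\<eta> > 0" "\<eta> \<le> r" using \<eta> r1 by auto
      show "\<eta> \<le> norm q" if "q \<in> S" for q using \<eta>(3) that by (auto simp: S_def)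
      fix p assume p: "p \<in> Z"
      show "norm p > 0" "norm p \<le> r" using p Z0 by (auto simp: Z_def)
      show "norm p \<le> norm q" if "q \<in> S" "\<pi> q = p" for q using \<pi>(2) that by auto
    qed
    finally have Sle: "(\<Sum>q\<in>S. ln (r / norm q)) \<le> 2 * ln (r / \<eta>) + 2 * (\<Sum>p\<in>Z. ln (r / norm p))"
      by (simp add: sum_distrib_left)
    have "(\<Sum>a | a \<in> ball 0 r \<and> k a * scaled_potential k a = 0. ln (r / norm a)) = (\<Sum>a\<in>Z \<union> S. ln (r / norm a))"
      by (rule sum.cong) (auto simp: Z_def S_def)
    also have "\<dots> = (\<Sum>a\<in>Z. ln (r / norm a)) + (\<Sum>a\<in>S. ln (r / norm a))"
      using finZ finS by (intro sum.union_disjoint) (auto simp: Z_def S_def)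
    finally have all: "(\<Sum>a | a \<in> ball 0 r \<and> k a * scaled_potential k a = 0. ln (r / norm a)) \<le>
        3 * (\<Sum>a\<in>Z. ln (r / norm a)) + 2 * ln (r / \<eta>)" using Sle by linarith
    define m where "m = circle_mean (\<lambda>z. max 0 (ln (norm (k z)))) r"
    have J: "ln (norm (k 0)) + (\<Sum>a\<in>Z. ln (r / norm a)) \<le> circle_mean (\<lambda>z. ln (norm (k z))) r"
      by (rule Jensen_inequality[OF hol _ nz0(1) r1(2)]) (use r in \<open>auto simp: Z_def\<close>)
    also have "\<dots> \<le> m" unfolding m_def
      by (rule circle_mean_mono[OF continuous_on_ln_norm[OF hol] continuous_log_plus r1(2)]) (use r in auto)
    finally have Zle: "(\<Sum>a\<in>Z. ln (r / norm a)) \<le> m - L" by (simp add: L_def)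
    have "ln (r / \<eta>) = ln r - ln \<eta>" using \<eta> r1 by (simp add: ln_div)
    hence "4 * m \<le> C + 5 * ln r - 2 * ln \<eta> + 3 * (m - L)" using r(3) all Zle unfolding m_def[symmetric] by argo
    hence mle: "m \<le> C + 5 * ln r - 2 * ln \<eta> - 3 * L" by argo
    hence "m \<le> K + 5 * ln r" "(\<Sum>a\<in>Z. ln (r / norm a)) \<le> K + 5 * ln r"
      using Zle unfolding K_def by linarith+
    thus "\<exists>r\<in>{R..2*R}. (\<forall>z. norm z = r \<longrightarrow> k z \<noteq> 0) \<and>
    circle_mean (\<lambda>z. max 0 (ln (norm (k z)))) r \<le> K + 5 * ln r \<and>
    (\<Sum>a | a \<in> ball 0 r \<and> k a = 0. ln (r / norm a)) \<le> K + 5 * ln r"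
      using r unfolding m_def Z_def by blast
  qed
qed

lemma finite_zeros: "finite {a. k a = 0}"
proof (rule ccontr)
  assume "infinite {a. k a = 0}"
  \<comment> \<open>Once \<open>r\<close> exceeds the square of their moduli, twelve zeros contribute \<open>6 ln r\<close>, more than \<open>5 ln r\<close>.\<close>
  then obtain T where T: "T \<subseteq> {a. k a = 0}" "finite T" "card T = 12"
    using infinite_arbitrarily_large by metis
  obtain C where C: "\<And>R. R \<ge> 1 \<Longrightarrow> \<exists>r\<in>{R..2*R}. (\<forall>z. norm z = r \<longrightarrow> k z \<noteq> 0) \<and>
    circle_mean (\<lambda>z. max 0 (ln (norm (k z)))) r \<le> C + 5 * ln r \<and>
    (\<Sum>a | a \<in> ball 0 r \<and> k a = 0. ln (r / norm a)) \<le> C + 5 * ln r"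
    using log_growth by blast
  obtain M where M: "\<And>a. a \<in> T \<Longrightarrow> norm a \<le> M" using finite_imp_bounded[OF T(2)] unfolding bounded_iff by blast
  define \<rho> where "\<rho> = max 2 M"
  define R where "R = max (\<rho> ^ 2) (exp (C + 1))"
  have \<rho>: "\<rho> \<ge> 2" "\<rho> < \<rho>\<^sup>2" "1 \<le> \<rho>\<^sup>2"
  proof -
    show 1: "\<rho> \<ge> 2" by (simp add: \<rho>_def)
    hence "\<rho> * 2 \<le> \<rho> * \<rho>" by (intro mult_left_mono) auto
    thus "\<rho> < \<rho>\<^sup>2" "1 \<le> \<rho>\<^sup>2" using 1 unfolding power2_eq_square by linarith+
  qed
  have R1: "R \<ge> 1" using \<rho> by (simp add: R_def)
  obtain r where r: "r \<in> {R..2*R}" "(\<Sum>a | a \<in> ball 0 r \<and> k a = 0. ln (r / norm a)) \<le> C + 5 * ln r"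
    using C[OF R1] by blast
  have r2: "\<rho>\<^sup>2 \<le> r" "exp (C + 1) \<le> r" "r > 0" using r R1 by (auto simp: R_def)
  have Tb: "norm a < r" "norm a \<le> \<rho>" "norm a > 0" if "a \<in> T" for a
  proof -
    show "norm a \<le> \<rho>" using M[OF that] by (simp add: \<rho>_def)
    thus "norm a < r" using r2(1) \<rho>(2) by linarith
    show "norm a > 0" using that T nz0 by auto
  qed
  have lr: "ln r \<ge> 2 * ln \<rho>"
    using r2 \<rho> ln_mono[of "\<rho>\<^sup>2" r] by (simp add: ln_realpow)
  have "12 * (ln r - ln \<rho>) = (\<Sum>a\<in>T. ln r - ln \<rho>)" using T(3) by simp
  also have "\<dots> \<le> (\<Sum>a\<in>T. ln (r / norm a))"
  proof (rule sum_mono)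
    fix a assume a: "a \<in> T"
    have "ln (norm a) \<le> ln \<rho>" using Tb[OF a] \<rho>(1) by (subst ln_le_cancel_iff) auto
    thus "ln r - ln \<rho> \<le> ln (r / norm a)" using Tb[OF a] r2 by (simp add: ln_div)
  qed
  also have "\<dots> \<le> (\<Sum>a | a \<in> ball 0 r \<and> k a = 0. ln (r / norm a))"
  proof (rule sum_mono2)
    show "finite {a. a \<in> ball 0 r \<and> k a = 0}"
      by (rule finite_subset[OF _ finite_zeros_cball[OF hol nz0(1), of r]]) auto
    show "T \<subseteq> {a. a \<in> ball 0 r \<and> k a = 0}" using T Tb by auto
    fix a assume a: "a \<in> {a. a \<in> ball 0 r \<and> k a = 0} - T"
    hence "norm a > 0" "norm a < r" using nz0 by auto
    thus "0 \<le> ln (r / norm a)" by simp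
  qed
  finally have "12 * (ln r - ln \<rho>) \<le> C + 5 * ln r" using r(2) by linarith
  hence "ln r \<le> C" using lr by argo
  moreover have "C + 1 \<le> ln r" using r2 by (simp add: ln_ge_iff)
  ultimately show False by linarith
qed

lemma polynomial_form:
  obtains m \<kappa> where "\<And>a. k a = 0 \<Longrightarrow> m a \<ge> (1::nat)" "\<kappa> \<noteq> 0"
    "\<And>z. k z = (\<Prod>a | k a = 0. (z - a) ^ m a) * \<kappa>"
proof -
  obtain m \<alpha> \<beta> where m: "\<And>a. k a = 0 \<Longrightarrow> m a \<ge> (1::nat)"
    "\<And>z. k z = (\<Prod>a | k a = 0. (z - a) ^ m a) * exp (\<alpha> * z + \<beta>)"
    using finite_zeros_exp_type[OF exp_type nz0(1) finite_zeros] by metis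
  have "\<alpha> = 0"
  proof (rule ccontr)
    assume \<alpha>: "\<alpha> \<noteq> 0"
    obtain C where C: "\<And>R. R \<ge> 1 \<Longrightarrow> \<exists>r\<in>{R..2*R}. (\<forall>z. norm z = r \<longrightarrow> k z \<noteq> 0) \<and>
      circle_mean (\<lambda>z. max 0 (ln (norm (k z)))) r \<le> C + 5 * ln r \<and>
      (\<Sum>a | a \<in> ball 0 r \<and> k a = 0. ln (r / norm a)) \<le> C + 5 * ln r"
      using log_growth by blast
    obtain M where M: "\<And>a. k a = 0 \<Longrightarrow> norm a \<le> M"
      using finite_imp_bounded[OF finite_zeros] unfolding bounded_iff by blast
    define c where "c = norm \<alpha> / 4"
    have c: "c > 0" using \<alpha> by (simp add: c_def)
    define K where "K = C + \<bar>Re \<beta>\<bar>"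
    have "eventually (\<lambda>r. c * r > K + 5 * ln r) at_top" using c by real_asymp
    then obtain r0 where r0: "\<And>r. r \<ge> r0 \<Longrightarrow> c * r > K + 5 * ln r" unfolding eventually_at_top_linorder by blast
    define R where "R = max r0 (max 1 (M + 1))"
    have R1: "R \<ge> 1" by (simp add: R_def)
    obtain r where r: "r \<in> {R..2*R}" "\<forall>z. norm z = r \<longrightarrow> k z \<noteq> 0"
      "circle_mean (\<lambda>z. max 0 (ln (norm (k z)))) r \<le> C + 5 * ln r" using C[OF R1] by blast
    have r2: "r \<ge> r0" "r \<ge> 1" "r \<ge> M + 1" "r > 0" using r by (auto simp: R_def)
    \<comment> \<open>For \<open>\<bar>x\<bar> \<le> t\<close> one has \<open>max 0 x \<ge> (x + x^2 / t) / 2\<close>. Take \<open>x = Re (\<alpha> * z)\<close> and \<open>t = norm \<alpha> * r\<close>: the means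
    of \<open>x\<close> and of \<open>Re ((\<alpha> * z)^2)\<close> vanish, so the mean of \<open>log+ |k|\<close> is at least \<open>norm \<alpha> * r / 4 - O(1)\<close>.\<close>
    have ptw: "(1/2) * Re (\<alpha> * z) + (norm \<alpha> * r / 4 + (1 / (4 * norm \<alpha> * r)) * Re ((\<alpha> * z)^2)) + (- \<bar>Re \<beta>\<bar>)
        \<le> max 0 (ln (norm (k z)))" if z: "norm z = r" for z
    proof -
      define x where "x = Re (\<alpha> * z)"
      have nr: "norm (\<alpha> * z) = norm \<alpha> * r" using z by (simp add: norm_mult)
      have pos: "norm \<alpha> * r > 0" using \<alpha> r2 by simp
      have ax: "\<bar>x\<bar> \<le> norm \<alpha> * r" unfolding x_def using abs_Re_le_cmod[of "\<alpha> * z"] nr by simp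
      have "Re ((\<alpha> * z)^2) = 2 * x\<^sup>2 - norm (\<alpha> * z) ^ 2"
        unfolding x_def cmod_power2 by (simp add: Re_power2)
      hence re2: "Re ((\<alpha> * z)^2) = 2 * x\<^sup>2 - (norm \<alpha> * r)\<^sup>2" by (simp only: nr)
      have eq: "norm \<alpha> * r / 4 + (1 / (4 * norm \<alpha> * r)) * Re ((\<alpha> * z)^2) = x\<^sup>2 / (2 * (norm \<alpha> * r))"
      proof -
        have gen: "t / 4 + (1 / (4 * t)) * (2 * x\<^sup>2 - t\<^sup>2) = x\<^sup>2 / (2 * t)" if "t > 0" for t :: real
          using that by (simp add: field_simps power2_eq_square)
        show ?thesis unfolding re2 using gen[OF pos] by (simp add: mult.assoc)
      qed
      have "x\<^sup>2 \<le> \<bar>x\<bar> * (norm \<alpha> * r)"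
        using mult_left_mono[OF ax, of "\<bar>x\<bar>"] by (simp add: power2_eq_square)
      hence "x\<^sup>2 / (2 * (norm \<alpha> * r)) \<le> \<bar>x\<bar> / 2" using pos by (simp add: field_simps)
      hence le: "(1/2) * x + x\<^sup>2 / (2 * (norm \<alpha> * r)) \<le> max 0 x" by (auto simp: max_def abs_if split: if_splits)
      have "1 \<le> (\<Prod>a | k a = 0. norm (z - a) ^ m a)"
      proof (intro prod_ge_1 one_le_power)
        fix a assume "a \<in> {a. k a = 0}"
        hence "norm a \<le> M" using M by auto
        thus "1 \<le> norm (z - a)" using norm_triangle_ineq2[of z a] z r2 by linarith
      qed
      hence ge: "1 * exp (x + Re \<beta>) \<le> (\<Prod>a | k a = 0. norm (z - a) ^ m a) * exp (x + Re \<beta>)"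
        by (intro mult_right_mono) auto
      have "norm (k z) = (\<Prod>a | k a = 0. norm (z - a) ^ m a) * exp (x + Re \<beta>)"
        by (subst m(2)) (simp add: norm_mult norm_power x_def flip: prod_norm)
      hence "exp (x + Re \<beta>) \<le> norm (k z)" using ge by simp
      hence "x + Re \<beta> \<le> ln (norm (k z))" by (metis exp_gt_zero ln_exp ln_mono less_le_trans)
      thus ?thesis using le unfolding eq x_def[symmetric] by (auto simp: max_def split: if_splits)
    qed
    have h: "(\<lambda>z. \<alpha> * z) holomorphic_on cball 0 r" "(\<lambda>z. (\<alpha> * z)^2) holomorphic_on cball 0 r"
      by (intro holomorphic_intros)+
    have co: "continuous_on (sphere 0 r) (\<lambda>z. (1/2) * Re (\<alpha> * z))"
       "continuous_on (sphere 0 r) (\<lambda>z. (1 / (4 * norm \<alpha> * r)) * Re ((\<alpha> * z)^2))"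
      by (intro continuous_intros)+
    have "c * r - \<bar>Re \<beta>\<bar> = circle_mean (\<lambda>z. (1/2) * Re (\<alpha> * z) + (norm \<alpha> * r / 4 + (1 / (4 * norm \<alpha> * r)) * Re ((\<alpha> * z)^2)) + (- \<bar>Re \<beta>\<bar>)) r"
      using circle_mean_Re[OF h(1) r2(4)] circle_mean_Re[OF h(2) r2(4)]
      by (subst circle_mean_add circle_mean_cmult; (intro continuous_intros r2(4) co)?)+
         (simp add: c_def)
    also have "\<dots> \<le> circle_mean (\<lambda>z. max 0 (ln (norm (k z)))) r"
      by (rule circle_mean_mono[OF _ continuous_log_plus r2(4) ptw])
         (intro continuous_on_add co continuous_on_const, use r(2) in auto)
    also have "\<dots> \<le> C + 5 * ln r" by (rule r(3))
    finally show False using r0[OF r2(1)] by (simp add: K_def)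
  qed
  hence eq: "exp (\<alpha> * z + \<beta>) = exp \<beta>" for z by simp
  show thesis
  proof (rule that[of m "exp \<beta>"])
    show "k z = (\<Prod>a | k a = 0. (z - a) ^ m a) * exp \<beta>" for z using m(2)[of z] unfolding eq .
  qed (use m(1) in auto)
qed

text \<open>
  For a polynomial \<open>k\<close> of degree \<open>d\<close> the logarithmic derivative \<open>J\<close> of \<open>scaled_potential k / k^6\<close> decays like
  \<open>z^(-4 d - 3)\<close>, because this quotient is \<open>1 + V / k^4\<close> with \<open>V = O(z^(-2))\<close>. Its poles are too few to
  allow such decay.
\<close>
lemma no_normalized_counterexample: False
proof -
  obtain m \<kappa> where m: "\<And>a. k a = 0 \<Longrightarrow> m a \<ge> (1::nat)" and \<kappa>: "\<kappa> \<noteq> 0"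
    and kz: "\<And>z. k z = (\<Prod>a | k a = 0. (z - a) ^ m a) * \<kappa>"
    using polynomial_form by metis
  define Z where "Z = {a. k a = 0}"
  have finZ: "finite Z" using finite_zeros by (simp add: Z_def)
  have kz': "k z = (\<Prod>a\<in>Z. (z - a) ^ m a) * (\<lambda>_. \<kappa>) z" for z using kz[of z] unfolding Z_def .
  define d where "d = (\<Sum>a\<in>Z. m a)"
  define S where "S = {a. scaled_potential k a = 0 \<and> k a \<noteq> 0}"
  define B where "B = Z \<union> S"
  have cardZ: "card Z \<le> d"
  proof -
    have "(\<Sum>a\<in>Z. 1) \<le> (\<Sum>a\<in>Z. m a)" by (rule sum_mono) (use m in \<open>auto simp: Z_def\<close>)
    thus ?thesis by (simp add: d_def)
  qed
  have S: "finite S \<and> card S \<le> 2 * (card Z + 1)"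
  proof -
    obtain \<pi> where \<pi>: "\<And>q. q \<in> S \<Longrightarrow> \<pi> q \<in> insert 0 Z"
      "\<And>p. finite {q \<in> S. \<pi> q = p} \<and> card {q \<in> S. \<pi> q = p} \<le> 2"
    proof (rule potential_zero_assignment[OF finZ])
      show "Z \<subseteq> {a. k a = 0}" "S \<subseteq> {a. scaled_potential k a = 0 \<and> k a \<noteq> 0}" by (auto simp: Z_def S_def)
      show "z \<in> Z" if "k z = 0" for z using that by (auto simp: Z_def)
    qed blast
    have Seq: "S = (\<Union>p\<in>insert 0 Z. {q \<in> S. \<pi> q = p})" using \<pi>(1) by auto
    have "card (\<Union>p\<in>insert 0 Z. {q \<in> S. \<pi> q = p}) \<le> (\<Sum>p\<in>insert 0 Z. card {q \<in> S. \<pi> q = p})"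
      by (rule card_UN_le) (use finZ in auto)
    also have "\<dots> \<le> card (insert 0 Z) * 2"
      using sum_bounded_above[of "insert 0 Z" "\<lambda>p. card {q \<in> S. \<pi> q = p}" 2] \<pi>(2) by simp
    also have "\<dots> \<le> 2 * (card Z + 1)" using finZ by (simp add: card_insert_if)
    finally have "card S \<le> 2 * (card Z + 1)" by (subst Seq)
    moreover have "finite (\<Union>p\<in>insert 0 Z. {q \<in> S. \<pi> q = p})" using finZ \<pi>(2) by blast
    hence "finite S" by (subst Seq)
    ultimately show ?thesis by blast
  qed
  have finB: "finite B" using S finZ by (simp add: B_def)
  have cardB: "card B < 4 * d + 3"
    using card_Un_le[of Z S] conjunct2[OF S] cardZ unfolding B_def by presburger
  define G where "G = (\<lambda>z. deriv k z / k z)"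
  define W where "W = - Z"
  have W: "open W" using finZ by (simp add: W_def finite_imp_closed open_Compl)
  have knz: "k z \<noteq> 0" if "z \<in> W" for z using that by (simp add: W_def Z_def)
  define T where "T = (\<lambda>p z. \<Sum>a\<in>Z. of_nat (m a) / (z - a) ^ p)"
  have Td: "(T p has_field_derivative - of_nat p * T (Suc p) z) (at z)" if "z \<in> W" for p z
    unfolding T_def by (rule partial_fraction_deriv) (use that finZ in \<open>auto simp: W_def\<close>)
  have G0: "G z = T 1 z" if "z \<in> W" for z
  proof -
    have "deriv k z = (\<Prod>a\<in>Z. (z - a) ^ m a) * ((\<Sum>a\<in>Z. of_nat (m a) / (z - a)) * (\<lambda>_. \<kappa>) z + deriv (\<lambda>_. \<kappa>) z)"
      by (rule deriv_factored[OF finZ _ kz']) (use that in \<open>auto simp: W_def\<close>)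
    also have "\<dots> = k z * T 1 z" using kz'[of z] by (simp add: T_def)
    finally show ?thesis using knz[OF that] by (simp add: G_def)
  qed
  have Gd: "(G has_field_derivative - T 2 z) (at z)" if "z \<in> W" for z
    using has_field_derivative_transform_within_open[OF Td[OF that, of 1] W that, of G] G0
    by (simp add: numeral_2_eq_2)
  have G1d: "((\<lambda>z. - T 2 z) has_field_derivative 2 * T 3 z) (at z)" if "z \<in> W" for z
    using DERIV_minus[OF Td[OF that, of 2]] by (simp add: numeral_3_eq_3)
  \<comment> \<open>\<open>V = schwarzian_part k / k^2\<close>, with derivative \<open>V'\<close>.\<close>
  define V where "V = (\<lambda>z. 4 * (- T 2 z - G z ^ 2))"
  define V' where "V' = (\<lambda>z. 4 * (2 * T 3 z + 2 * G z * T 2 z))"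
  have Vd: "(V has_field_derivative V' z) (at z)" if "z \<in> W" for z
    unfolding V_def V'_def by (rule derivative_eq_intros Gd[OF that] G1d[OF that] refl)+ (simp add: algebra_simps)
  have kd: "(k has_field_derivative deriv k z) (at z)" for z
    using holomorphic_derivI[OF hol open_UNIV] by simp
  have rest: "schwarzian_part k z = k z ^ 2 * V z" if z: "z \<in> W" for z
    using schwarzian_part_logderiv[OF hol knz[OF z] Gd[OF z, unfolded G_def]] unfolding V_def G_def .
  have J: "potential_wronskian k z / (k z * scaled_potential k z) = (V' z - 4 * G z * V z) / (k z ^ 4 * (1 + V z / k z ^ 4))"
    if z: "z \<in> W" for z
  proof -
    have "((\<lambda>z. k z ^ 2 * V z) has_field_derivative 2 * k z * deriv k z * V z + k z ^ 2 * V' z) (at z)"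
      by (rule derivative_eq_intros kd Vd[OF z] refl)+ (simp add: algebra_simps)
    hence "(schwarzian_part k has_field_derivative 2 * k z * deriv k z * V z + k z ^ 2 * V' z) (at z)"
      by (rule has_field_derivative_transform_within_open[OF _ W z]) (simp add: rest)
    hence dr: "deriv (schwarzian_part k) z = 2 * k z * deriv k z * V z + k z ^ 2 * V' z" by (rule DERIV_imp_deriv)
    have dk: "deriv k z = k z * G z" using knz[OF z] by (simp add: G_def)
    have num: "potential_wronskian k z = k z ^ 3 * (V' z - 4 * G z * V z)"
      unfolding potential_wronskian_rest(1)[OF hol] dr rest[OF z] dk
      by (simp add: power2_eq_square power3_eq_cube algebra_simps)
    have den: "k z * scaled_potential k z = k z ^ 3 * (k z ^ 4 * (1 + V z / k z ^ 4))"
      unfolding scaled_potential_def rest[OF z] using knz[OF z] by (simp add: field_simps eval_nat_numeral)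
    show ?thesis unfolding num den
      by (rule nonzero_mult_divide_mult_cancel_left) (use knz[OF z] in simp)
  qed
  have Tlim: "((\<lambda>z. z ^ p * T p z) \<longlongrightarrow> (\<Sum>a\<in>Z. of_nat (m a) * 1 ^ p)) at_infinity" for p
  proof -
    have "((\<lambda>z. \<Sum>a\<in>Z. of_nat (m a) * (z / (z - a)) ^ p) \<longlongrightarrow> (\<Sum>a\<in>Z. of_nat (m a) * 1 ^ p)) at_infinity"
      by (intro tendsto_intros tendsto_z_div)
    thus ?thesis by (simp add: T_def sum_distrib_left power_divide mult_ac)
  qed
  have evW: "eventually (\<lambda>z. z \<in> W \<and> z \<notin> B \<and> z \<noteq> 0) at_infinity"
  proof -
    obtain M where M: "\<And>a. a \<in> insert 0 B \<Longrightarrow> norm a \<le> M"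
      using finite_imp_bounded[of "insert 0 B"] finB unfolding bounded_iff by blast
    show ?thesis unfolding eventually_at_infinity
    proof (intro exI[of _ "M + 1"] allI impI)
      fix z :: complex assume "M + 1 \<le> norm z"
      hence "z \<notin> insert 0 B" using M[of z] by force
      thus "z \<in> W \<and> z \<notin> B \<and> z \<noteq> 0" by (auto simp: W_def B_def)
    qed
  qed
  define D :: complex where "D = of_nat d"
  have Glim: "((\<lambda>z. z * G z) \<longlongrightarrow> D) at_infinity"
  proof -
    have "((\<lambda>z. z ^ 1 * T 1 z) \<longlongrightarrow> D) at_infinity" using Tlim[of 1] by (simp add: D_def d_def)
    moreover have "eventually (\<lambda>z. z ^ 1 * T 1 z = z * G z) at_infinity"
      using evW by eventually_elim (simp add: G0)
    ultimately show ?thesis by (rule Lim_transform_eventually)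
  qed
  have T2: "((\<lambda>z. z ^ 2 * T 2 z) \<longlongrightarrow> D) at_infinity" and T3: "((\<lambda>z. z ^ 3 * T 3 z) \<longlongrightarrow> D) at_infinity"
    using Tlim[of 2] Tlim[of 3] by (simp_all add: D_def d_def)
  have Vlim: "((\<lambda>z. z ^ 2 * V z) \<longlongrightarrow> 4 * (- D - D ^ 2)) at_infinity"
  proof -
    have "((\<lambda>z. 4 * (- (z ^ 2 * T 2 z) - (z * G z) ^ 2)) \<longlongrightarrow> 4 * (- D - D ^ 2)) at_infinity"
      by (intro tendsto_intros T2 Glim)
    thus ?thesis by (simp add: V_def power_mult_distrib algebra_simps)
  qed
  have V'lim: "((\<lambda>z. z ^ 3 * V' z) \<longlongrightarrow> 4 * (2 * D + 2 * D * D)) at_infinity"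
  proof -
    have "((\<lambda>z. 4 * (2 * (z ^ 3 * T 3 z) + 2 * (z * G z) * (z ^ 2 * T 2 z))) \<longlongrightarrow> 4 * (2 * D + 2 * D * D)) at_infinity"
      by (intro tendsto_intros T2 T3 Glim)
    thus ?thesis by (simp add: V'_def power2_eq_square power3_eq_cube algebra_simps)
  qed
  define c where "c = 4 * (2 * D + 2 * D * D) - 4 * D * (4 * (- D - D ^ 2))"
  have numlim: "((\<lambda>z. z ^ 3 * (V' z - 4 * G z * V z)) \<longlongrightarrow> c) at_infinity"
  proof -
    have "((\<lambda>z. z ^ 3 * V' z - 4 * (z * G z) * (z ^ 2 * V z)) \<longlongrightarrow> c) at_infinity"
      unfolding c_def by (intro tendsto_intros Vlim V'lim Glim)
    thus ?thesis by (simp add: power2_eq_square power3_eq_cube algebra_simps)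
  qed
  have klim: "((\<lambda>z. z ^ d / k z) \<longlongrightarrow> 1 / \<kappa>) at_infinity"
  proof -
    have "((\<lambda>z. (\<Prod>a\<in>Z. (z / (z - a)) ^ m a) * (1 / \<kappa>)) \<longlongrightarrow> (\<Prod>a\<in>Z. 1 ^ m a) * (1 / \<kappa>)) at_infinity"
      by (intro tendsto_intros tendsto_z_div)
    moreover have "(\<Prod>a\<in>Z. (z / (z - a)) ^ m a) * (1 / \<kappa>) = z ^ d / k z" for z
      unfolding kz' d_def by (simp add: power_divide prod_dividef power_sum)
    ultimately show ?thesis by simp
  qed
  have inv0: "((\<lambda>z::complex. inverse z ^ Suc n) \<longlongrightarrow> 0) at_infinity" for n
    using tendsto_power[OF tendsto_inverse_0, of "Suc n"] by (simp only: power_0_Suc)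
  have Vk: "((\<lambda>z. V z / k z ^ 4) \<longlongrightarrow> 0) at_infinity"
  proof -
    have "((\<lambda>z. (z ^ 2 * V z) * (z ^ d / k z) ^ 4 * inverse z ^ Suc (4 * d + 1)) \<longlongrightarrow> 4 * (- D - D ^ 2) * (1 / \<kappa>) ^ 4 * 0) at_infinity"
      by (intro tendsto_intros Vlim klim inv0)
    moreover have "eventually (\<lambda>z. (z ^ 2 * V z) * (z ^ d / k z) ^ 4 * inverse z ^ Suc (4 * d + 1) = V z / k z ^ 4) at_infinity"
      using evW
    proof eventually_elim
      case (elim z)
      have "inverse z ^ Suc (4 * d + 1) * (z ^ 2 * (z ^ d) ^ 4) = 1"
        using elim by (simp add: power_add power_mult field_simps power2_eq_square)
      hence "(V z / k z ^ 4) * (inverse z ^ Suc (4 * d + 1) * (z ^ 2 * (z ^ d) ^ 4)) = V z / k z ^ 4" by simp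
      thus ?case by (simp add: power_divide mult_ac)
    qed
    ultimately show ?thesis by (simp add: filterlim_cong)
  qed
  have Jlim: "((\<lambda>z. z ^ (4 * d + 3) * (potential_wronskian k z / (k z * scaled_potential k z))) \<longlongrightarrow> c * (1 / \<kappa>) ^ 4 / (1 + 0)) at_infinity"
  proof -
    have "((\<lambda>z. (z ^ 3 * (V' z - 4 * G z * V z)) * (z ^ d / k z) ^ 4 / (1 + V z / k z ^ 4)) \<longlongrightarrow> c * (1 / \<kappa>) ^ 4 / (1 + 0)) at_infinity"
      by (intro tendsto_intros numlim klim Vk) auto
    moreover have "eventually (\<lambda>z. (z ^ 3 * (V' z - 4 * G z * V z)) * (z ^ d / k z) ^ 4 / (1 + V z / k z ^ 4) =
       z ^ (4 * d + 3) * (potential_wronskian k z / (k z * scaled_potential k z))) at_infinity"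
      using evW
    proof eventually_elim
      case (elim z)
      have "z ^ (4 * d + 3) = z ^ 3 * (z ^ d) ^ 4"
        by (simp add: power_add mult.commute flip: power_mult)
      thus ?case using J[of z] elim by (simp add: power_divide)
    qed
    ultimately show ?thesis by (rule Lim_transform_eventually)
  qed
  obtain N g where N: "N holomorphic_on UNIV" "g holomorphic_on UNIV" "\<forall>z. g z = 0 \<longrightarrow> z \<notin> B \<and> k z * scaled_potential k z = 0"
    "\<forall>z. z \<notin> B \<longrightarrow> k z * scaled_potential k z \<noteq> 0 \<longrightarrow>
       (deriv (scaled_potential k) z * k z - 6 * deriv k z * scaled_potential k z) / (k z * scaled_potential k z) = N z / ((\<Prod>a\<in>B. z - a) * g z)"
    using wronskian_simple_poles[OF finB hol nz0(1) potential_holomorphic(2)[OF hol] nz0(4)] by blast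
  have inB: "z \<in> B" if "k z * scaled_potential k z = 0" for z using that by (auto simp: B_def Z_def S_def)
  have g_nz: "g z \<noteq> 0" for z using N(3) inB by blast
  have E: "N z / g z = (\<Prod>a\<in>B. z - a) * (potential_wronskian k z / (k z * scaled_potential k z))" if z: "z \<notin> B" for z
  proof -
    have "k z * scaled_potential k z \<noteq> 0" using inB z by blast
    moreover have "(\<Prod>a\<in>B. z - a) \<noteq> 0" using finB z by auto
    ultimately show ?thesis unfolding potential_wronskian_def using N(4) z by simp
  qed
  define e where "e = 4 * d + 2 - card B"
  have e: "4 * d + 3 = Suc e + card B" using cardB by (simp add: e_def)
  have "((\<lambda>z. z ^ (4 * d + 3) * (potential_wronskian k z / (k z * scaled_potential k z)) * inverse (\<Prod>a\<in>B. z / (z - a)) * inverse z ^ Suc e) \<longlongrightarrow>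
      c * (1 / \<kappa>) ^ 4 / (1 + 0) * inverse (\<Prod>a\<in>B. 1) * 0) at_infinity"
    by (intro tendsto_intros Jlim tendsto_z_div inv0) auto
  moreover have "eventually (\<lambda>z. z ^ (4 * d + 3) * (potential_wronskian k z / (k z * scaled_potential k z)) * inverse (\<Prod>a\<in>B. z / (z - a)) * inverse z ^ Suc e = N z / g z) at_infinity"
    using evW
  proof eventually_elim
    case (elim z)
    have P: "(\<Prod>a\<in>B. z / (z - a)) = z ^ card B / (\<Prod>a\<in>B. z - a)" by (simp add: prod_dividef)
    have "z ^ (4 * d + 3) * inverse (\<Prod>a\<in>B. z / (z - a)) * inverse z ^ Suc e = (\<Prod>a\<in>B. z - a)"
      unfolding P e using elim by (simp add: power_add field_simps)
    thus ?case using E[of z] elim by (simp add: mult_ac)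
  qed
  ultimately have lim: "((\<lambda>z. N z / g z) \<longlongrightarrow> 0) at_infinity" by (simp add: filterlim_cong)
  have "(\<lambda>z. N z / g z) holomorphic_on UNIV" by (intro holomorphic_intros N g_nz)
  from Liouville_weak_0[OF this lim] have "N 0 / g 0 = 0" .
  moreover have "0 \<notin> B" using nz0 by (auto simp: B_def Z_def S_def)
  ultimately have "(\<Prod>a\<in>B. 0 - a) * (potential_wronskian k 0 / (k 0 * scaled_potential k 0)) = 0" using E[of 0] by simp
  moreover have "(\<Prod>a\<in>B. 0 - a) \<noteq> 0" using finB \<open>0 \<notin> B\<close> by auto
  ultimately show False using nz0 by simp
qed

end

text \<open>
  At a zero of order \<open>m\<close> of \<open>k\<close> the left-hand side vanishes to order exactly \<open>2 m - 2\<close>, since its leading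
  coefficient is a non-zero multiple of \<open>m + m^2\<close>; the right-hand side vanishes to order at least \<open>6 m\<close>.
\<close>
lemma schwarzian_part_not_multiple_of_power:
  fixes k :: "complex \<Rightarrow> complex"
  assumes hol: "k holomorphic_on UNIV" and a: "k a = 0" and nz: "k z0 \<noteq> 0"
  shows "\<exists>z. schwarzian_part k z \<noteq> c * k z ^ 6"
proof (rule ccontr)
  assume "\<not> ?thesis"
  hence eq: "schwarzian_part k z = c * k z ^ 6" for z by blast
  obtain m g where g: "g holomorphic_on UNIV" "g a \<noteq> 0" "\<And>z. k z = (z - a) ^ m * g z"
    using factor_zero_at[OF hol nz] by metis
  have m: "m \<ge> 1" using g(2) g(3)[of a] a by (cases m) auto
  define U where "U = {z. g z \<noteq> 0}"
  have U: "open U" "a \<in> U" unfolding U_def using g(2) open_nonzero[OF g(1)] by auto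
  define \<gamma> where "\<gamma> = (\<lambda>z. deriv g z / g z)"
  have hol\<gamma>: "\<gamma> holomorphic_on U" unfolding \<gamma>_def U_def
    by (intro holomorphic_intros holomorphic_on_subset[OF holomorphic_deriv[OF g(1) open_UNIV]]
        holomorphic_on_subset[OF g(1)]) auto
  have hol\<gamma>': "deriv \<gamma> holomorphic_on U" by (rule holomorphic_deriv[OF hol\<gamma> U(1)])
  \<comment> \<open>\<open>E\<close> is \<open>(z - a)^2 / k^2\<close> times the difference of both sides, extended across \<open>a\<close>.\<close>
  define E where "E = (\<lambda>z. 4 * (- of_nat m + (z - a) ^ 2 * deriv \<gamma> z - (of_nat m + (z - a) * \<gamma> z) ^ 2)
      - c * (z - a) ^ 2 * k z ^ 4)"
  have holE: "E holomorphic_on U" unfolding E_def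
    by (intro holomorphic_intros hol\<gamma> hol\<gamma>' holomorphic_on_subset[OF hol]) auto
  have E0: "E z = 0" if z: "z \<in> U" "z \<noteq> a" for z
  proof -
    have V: "open (U - {a})" "z \<in> U - {a}" using U z by auto
    have knz: "k w \<noteq> 0" if "w \<in> U - {a}" for w using g(3)[of w] that by (auto simp: U_def)
    have Geq: "deriv k w / k w = of_nat m / (w - a) + \<gamma> w" if w: "w \<in> U - {a}" for w
    proof -
      have "deriv k w = (\<Prod>b\<in>{a}. (w - b) ^ m) * ((\<Sum>b\<in>{a}. of_nat m / (w - b)) * g w + deriv g w)"
        by (rule deriv_factored[where m = "\<lambda>_. m", OF _ g(1)]) (use g(3) w in auto)
      hence dk: "deriv k w = (w - a) ^ m * (of_nat m / (w - a) * g w + deriv g w)" by simp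
      have "g w \<noteq> 0" "(w - a) ^ m \<noteq> 0" using w by (auto simp: U_def)
      moreover have "w \<noteq> a" using w by simp
      ultimately show ?thesis unfolding dk g(3)[of w] \<gamma>_def by (simp add: add_divide_distrib)
    qed
    have d\<gamma>: "(\<gamma> has_field_derivative deriv \<gamma> z) (at z)" by (rule holomorphic_derivI[OF hol\<gamma> U(1) z(1)])
    have "((\<lambda>w. of_nat m / (w - a) + \<gamma> w) has_field_derivative - of_nat m / (z - a) ^ 2 + deriv \<gamma> z) (at z)"
      by (rule derivative_eq_intros d\<gamma> refl)+ (use z d\<gamma> in \<open>auto simp: power2_eq_square\<close>)
    hence "((\<lambda>w. deriv k w / k w) has_field_derivative - of_nat m / (z - a) ^ 2 + deriv \<gamma> z) (at z)"
      by (rule has_field_derivative_transform_within_open[OF _ V]) (simp add: Geq)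
    from schwarzian_part_logderiv[OF hol knz[OF V(2)] this]
    have "k z ^ 2 * (4 * (- of_nat m / (z - a) ^ 2 + deriv \<gamma> z - (of_nat m / (z - a) + \<gamma> z) ^ 2)) = k z ^ 2 * (c * k z ^ 4)"
      unfolding Geq[OF V(2)] eq by (simp only: power_mult_distrib mult.left_commute[of _ c] flip: power_add) simp
    hence "4 * (- of_nat m / (z - a) ^ 2 + deriv \<gamma> z - (of_nat m / (z - a) + \<gamma> z) ^ 2) = c * k z ^ 4"
      using knz[OF V(2)] by simp
    moreover have ident: "u ^ 2 * (4 * (- n / u ^ 2 + p - (n / u + q) ^ 2)) = 4 * (- n + u ^ 2 * p - (n + u * q) ^ 2)"
      if "u \<noteq> 0" for u n p q :: complex using that by (simp add: field_simps power2_eq_square)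
    have "(z - a) ^ 2 * (4 * (- of_nat m / (z - a) ^ 2 + deriv \<gamma> z - (of_nat m / (z - a) + \<gamma> z) ^ 2)) =
        4 * (- of_nat m + (z - a) ^ 2 * deriv \<gamma> z - (of_nat m + (z - a) * \<gamma> z) ^ 2)"
      by (rule ident) (use z(2) in simp)
    ultimately have "4 * (- of_nat m + (z - a) ^ 2 * deriv \<gamma> z - (of_nat m + (z - a) * \<gamma> z) ^ 2) = (z - a) ^ 2 * (c * k z ^ 4)"
      by (simp only:)
    thus ?thesis unfolding E_def by (simp only: mult.assoc mult.left_commute[of c] diff_self)
  qed
  have "isCont E a" using holE U by (meson continuous_on_eq_continuous_at holomorphic_on_imp_continuous_on)
  hence "E \<midarrow>a\<rightarrow> E a" by (simp add: isCont_def)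
  moreover have "E \<midarrow>a\<rightarrow> 0"
  proof (rule Lim_transform_eventually[OF tendsto_const])
    show "eventually (\<lambda>z. 0 = E z) (at a)"
      unfolding eventually_at_topological using U E0 by force
  qed
  ultimately have "E a = 0" using LIM_unique by blast
  hence "4 * (- of_nat m - of_nat m ^ 2 :: complex) = 0" using m by (simp add: E_def a)
  hence "(of_nat m + of_nat m ^ 2 :: complex) = 0" by algebra
  hence "of_nat (m + m ^ 2) = (0 :: complex)" by (simp only: of_nat_add of_nat_power)
  thus False using m by (simp only: of_nat_eq_0_iff)
qed

lemma schwarzian_part_exp_linear:
  assumes "\<And>z. k z = exp (\<alpha> * z + \<beta>)"
  shows "schwarzian_part k z = - 4 * \<alpha>\<^sup>2 * k z ^ 2"
proof -
  have k: "k = (\<lambda>z. exp (\<alpha> * z + \<beta>))" using assms by auto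
  have 1: "((\<lambda>z. c * exp (\<alpha> * z + \<beta>)) has_field_derivative \<alpha> * (c * exp (\<alpha> * z + \<beta>))) (at z)" for c z
    by (auto intro!: derivative_eq_intros)
  have d1: "deriv k = (\<lambda>z. \<alpha> * exp (\<alpha> * z + \<beta>))" unfolding k
    using DERIV_imp_deriv[OF 1[of 1]] by (simp add: fun_eq_iff)
  have d2: "deriv (deriv k) = (\<lambda>z. \<alpha> * (\<alpha> * exp (\<alpha> * z + \<beta>)))" unfolding d1
    using DERIV_imp_deriv[OF 1[of \<alpha>]] by (simp add: fun_eq_iff)
  show ?thesis unfolding schwarzian_part_def unfolding d2 unfolding d1 unfolding k by (simp add: power2_eq_square algebra_simps)
qed

text \<open>
  Here \<open>scaled_potential k = k^2 (k^4 - 4 \<alpha>^2)\<close>, and the points listed are the solutions of \<open>k^4 = 4 \<alpha>^2\<close>.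
\<close>
lemma zero_free_potential_zeros:
  assumes "exp_type k" "\<And>z. k z \<noteq> 0" "\<not> k constant_on UNIV"
  obtains \<alpha> \<beta> where "\<alpha> \<noteq> 0" "\<And>z. k z = exp (\<alpha> * z + \<beta>)"
    "\<And>n :: int. scaled_potential k ((Ln (4 * \<alpha>\<^sup>2) + 2 * of_int n * pi * \<i> - 4 * \<beta>) / (4 * \<alpha>)) = 0"
proof -
  obtain \<alpha> \<beta> where k: "\<And>z. k z = exp (\<alpha> * z + \<beta>)" using zero_free_exp_type[OF assms(1,2)] by metis
  have \<alpha>: "\<alpha> \<noteq> 0" using assms(3) k by (auto simp: constant_on_def)
  show thesis
  proof (rule that[OF \<alpha> k])
    fix n :: int
    define z where "z = (Ln (4 * \<alpha>\<^sup>2) + 2 * of_int n * pi * \<i> - 4 * \<beta>) / (4 * \<alpha>)"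
    have "4 * (\<alpha> * z + \<beta>) = Ln (4 * \<alpha>\<^sup>2) + 2 * of_int n * pi * \<i>" using \<alpha> by (simp add: z_def field_simps)
    moreover have "k z ^ 4 = exp (4 * (\<alpha> * z + \<beta>))" by (simp add: k flip: exp_of_nat_mult)
    ultimately have "k z ^ 4 = exp (Ln (4 * \<alpha>\<^sup>2)) * exp (2 * of_int n * pi * \<i>)" by (simp add: exp_add)
    moreover have "exp (2 * of_int n * pi * \<i>) = 1" using exp_integer_2pi[of "of_int n"] by (simp add: mult_ac)
    ultimately have "k z ^ 4 = 4 * \<alpha>\<^sup>2" using \<alpha> by simp
    moreover have "scaled_potential k z = k z ^ 2 * (k z ^ 4 - 4 * \<alpha>\<^sup>2)"
      unfolding scaled_potential_def schwarzian_part_exp_linear[of k, OF k] by (simp add: algebra_simps eval_nat_numeral)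
    ultimately show "scaled_potential k z = 0" by simp
  qed
qed

text \<open>
  If the Wronskian vanished, \<open>schwarzian_part k\<close> would be a constant multiple of \<open>k^6\<close>. This is impossible
  at a zero of \<open>k\<close>, and also for \<open>exp (\<alpha> z + \<beta>)\<close>.
\<close>
lemma potential_wronskian_nonzero:
  assumes "exp_type k" "\<not> k constant_on UNIV"
  obtains z where "potential_wronskian k z \<noteq> 0"
proof (rule ccontr)
  assume "\<not> thesis"
  hence wr: "potential_wronskian k z = 0" for z using that by blast
  have hol: "k holomorphic_on UNIV" using assms exp_type_holomorphic by blast
  obtain z0 where z0: "k z0 \<noteq> 0" using assms(2) by (auto simp: constant_on_def)
  have "open {z. k z \<noteq> 0}"
    by (rule open_nonzero[OF hol])
  then obtain e where e: "e > 0" "\<And>z. z \<in> ball z0 e \<Longrightarrow> k z \<noteq> 0"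
    using z0 unfolding open_contains_ball by blast
  have kd: "(k has_field_derivative deriv k z) (at z)" for z
    using holomorphic_derivI[OF hol open_UNIV] by simp
  have rd: "(schwarzian_part k has_field_derivative deriv (schwarzian_part k) z) (at z)" for z
    using holomorphic_derivI[OF potential_holomorphic(1)[OF hol] open_UNIV] by simp
  have "((\<lambda>z. schwarzian_part k z / k z ^ 6) has_field_derivative 0) (at z within ball z0 e)" if z: "z \<in> ball z0 e" for z
  proof -
    have p6: "((\<lambda>z. k z ^ 6) has_field_derivative 6 * k z ^ 5 * deriv k z) (at z)"
      by (auto intro!: derivative_eq_intros kd)
    have "((\<lambda>z. schwarzian_part k z / k z ^ 6) has_field_derivative
      (deriv (schwarzian_part k) z * k z ^ 6 - schwarzian_part k z * (6 * k z ^ 5 * deriv k z)) / (k z ^ 6 * k z ^ 6)) (at z)"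
      by (intro DERIV_divide rd p6) (use e(2)[OF z] in auto)
    moreover have "deriv (schwarzian_part k) z * k z ^ 6 - schwarzian_part k z * (6 * k z ^ 5 * deriv k z) = k z ^ 5 * potential_wronskian k z"
      unfolding potential_wronskian_rest(1)[OF hol] by (simp add: algebra_simps eval_nat_numeral)
    ultimately show ?thesis using wr[of z] by (auto intro: has_field_derivative_at_within)
  qed
  then obtain c where c: "\<And>z. z \<in> ball z0 e \<Longrightarrow> schwarzian_part k z / k z ^ 6 = c"
    using has_field_derivative_zero_constant[OF convex_ball, of z0 e "\<lambda>z. schwarzian_part k z / k z ^ 6"] by blast
  have all: "schwarzian_part k z = c * k z ^ 6" for z
  proof (rule analytic_continuation_open[of "ball z0 e" UNIV "schwarzian_part k" "\<lambda>z. c * k z ^ 6"])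
    show "(\<lambda>z. c * k z ^ 6) holomorphic_on UNIV" by (intro holomorphic_intros hol)
    show "schwarzian_part k z = c * k z ^ 6" if "z \<in> ball z0 e" for z using c[OF that] e(2)[OF that] by (simp add: field_simps)
  qed (use e potential_holomorphic(1)[OF hol] in auto)
  show False
  proof (cases "\<exists>a. k a = 0")
    case True
    thus False using schwarzian_part_not_multiple_of_power[OF hol _ z0] all by blast
  next
    case False
    hence nz: "\<And>z. k z \<noteq> 0" by blast
    obtain \<alpha> \<beta> where k: "\<alpha> \<noteq> 0" "\<And>z. k z = exp (\<alpha> * z + \<beta>)" using zero_free_potential_zeros[OF assms(1) nz assms(2)] by metis
    have k4: "c * k z ^ 4 = - 4 * \<alpha>\<^sup>2" for z
    proof -
      have "k z ^ 2 * (c * k z ^ 4) = k z ^ 2 * (- 4 * \<alpha>\<^sup>2)"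
        using all[of z] unfolding schwarzian_part_exp_linear[of k, OF k(2)] by (simp add: eval_nat_numeral mult_ac)
      thus ?thesis by (subst (asm) mult_left_cancel) (use nz[of z] in auto)
    qed
    have "c \<noteq> 0" using k4[of 0] k(1) by auto
    hence "k (1 / (4 * \<alpha>)) ^ 4 = k 0 ^ 4" using k4[of 0] k4[of "1 / (4 * \<alpha>)"] by (metis mult_cancel_left)
    hence "exp (4 * (\<alpha> * (1 / (4 * \<alpha>)) + \<beta>)) = exp (4 * (\<alpha> * 0 + \<beta>))" by (simp add: k flip: exp_of_nat_mult)
    moreover have "4 * (\<alpha> * (1 / (4 * \<alpha>)) + \<beta>) = 1 + 4 * \<beta>" using k(1) by (simp add: field_simps)
    ultimately have "exp (1 + 4 * \<beta>) = exp (4 * \<beta>)" by simp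
    hence "exp 1 = (1 :: complex)" by (simp add: exp_add)
    hence "norm (exp 1 :: complex) = 1" by simp
    thus False by simp
  qed
qed

lemma potential_shift:
  fixes c :: complex
  assumes hol: "k holomorphic_on UNIV"
  defines "K \<equiv> \<lambda>z. k (z + c)"
  shows "deriv K = (\<lambda>z. deriv k (z + c))" "schwarzian_part K = (\<lambda>z. schwarzian_part k (z + c))"
    "scaled_potential K = (\<lambda>z. scaled_potential k (z + c))" "potential_wronskian K = (\<lambda>z. potential_wronskian k (z + c))"
proof -
  have shift: "deriv (\<lambda>z. f (z + c)) = (\<lambda>z. deriv f (z + c))" if "f holomorphic_on UNIV" for f
  proof
    fix z
    have "(f has_field_derivative deriv f (z + c)) (at (z + c))"
      using holomorphic_derivI[OF that open_UNIV] by simp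
    hence "((\<lambda>z. f (z + c)) has_field_derivative deriv f (z + c)) (at z)" by (simp add: DERIV_shift)
    thus "deriv (\<lambda>z. f (z + c)) z = deriv f (z + c)" by (rule DERIV_imp_deriv)
  qed
  show d1: "deriv K = (\<lambda>z. deriv k (z + c))" unfolding K_def by (rule shift[OF hol])
  show r: "schwarzian_part K = (\<lambda>z. schwarzian_part k (z + c))" 
    by (rule ext, simp only: schwarzian_part_def d1 shift[OF holomorphic_deriv[OF hol open_UNIV]]) (simp only: K_def)
  show p: "scaled_potential K = (\<lambda>z. scaled_potential k (z + c))" unfolding scaled_potential_def r by (simp add: K_def)
  show "potential_wronskian K = (\<lambda>z. potential_wronskian k (z + c))"
    unfolding potential_wronskian_def p shift[OF potential_holomorphic(2)[OF hol]] d1 by (simp add: K_def)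
qed

lemma exp_type_shift:
  assumes "exp_type f"
  shows "exp_type (\<lambda>z. f (z + c))"
proof -
  obtain B where B: "B \<ge> 0" "\<And>z. norm (f z) \<le> exp (B * (1 + norm z))" using exp_typeE[OF assms(1)] by metis
  have "norm (f (z + c)) \<le> exp ((B * (1 + norm c)) * (1 + norm z))" for z
  proof -
    have "norm (f (z + c)) \<le> exp (B * (1 + norm (z + c)))" by (rule B)
    also have "1 + norm (z + c) \<le> (1 + norm c) * (1 + norm z)"
    proof -
      have "(1 + norm c) * (1 + norm z) = 1 + norm c + norm z + norm c * norm z" by (simp add: algebra_simps)
      moreover have "0 \<le> norm c * norm z" by simp
      ultimately show ?thesis using norm_triangle_ineq[of z c] by linarith
    qed
    hence "exp (B * (1 + norm (z + c))) \<le> exp (B * ((1 + norm c) * (1 + norm z)))"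
      using B(1) by (auto intro: mult_left_mono)
    finally show ?thesis by (simp add: mult.assoc)
  qed
  moreover have "(\<lambda>z. f (z + c)) holomorphic_on UNIV"
  proof -
    have "(\<lambda>z. z + c) holomorphic_on UNIV" by (intro holomorphic_intros)
    from holomorphic_on_compose_gen[OF this exp_type_holomorphic[OF assms]]
    show ?thesis by (simp add: o_def)
  qed
  ultimately show ?thesis unfolding exp_type_def using B(1) by (intro conjI exI[of _ "B * (1 + norm c)"]) auto
qed

text \<open>
  If \<open>k\<close> has no zeros, the explicit zeros of the potential differ by real multiples of \<open>i / \<alpha>\<close> and \<open>\<alpha>\<close> is real, so they
  cannot all be real. Otherwise a real translation leads to \<open>normalized_counterexample\<close>.
\<close>
proposition no_exp_type_counterexample:
  assumes k: "exp_type k" "\<not> k constant_on UNIV"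
    and zeros_real: "\<And>a. k a = 0 \<Longrightarrow> a \<in> \<real>"
    and potential_zeros_real: "\<And>a. scaled_potential k a = 0 \<Longrightarrow> a \<in> \<real>"
    and square_real: "\<And>x::real. Im (k (of_real x) ^ 2) = 0"
  shows False
proof (cases "\<exists>a. k a = 0")
  case False
  hence nz: "\<And>z. k z \<noteq> 0" by blast
  obtain \<alpha> \<beta> where ab: "\<alpha> \<noteq> 0" "\<And>z. k z = exp (\<alpha> * z + \<beta>)"
    and zs: "\<And>n :: int. scaled_potential k ((Ln (4 * \<alpha>\<^sup>2) + 2 * of_int n * pi * \<i> - 4 * \<beta>) / (4 * \<alpha>)) = 0"
    using zero_free_potential_zeros[OF k(1) nz k(2)] by metis
  define f where "f = (\<lambda>z. k z ^ 2)"
  have "(f has_field_derivative 2 * \<alpha> * f (of_real 0)) (at (of_real 0))"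
    unfolding f_def ab(2) by (auto intro!: derivative_eq_intros simp: power2_eq_square)
  from deriv_of_real_Re(2)[OF this]
  have "((\<lambda>t. 0) has_real_derivative Im (2 * \<alpha> * f (of_real 0))) (at 0)" unfolding f_def square_real .
  hence "Im (2 * \<alpha> * f 0) = 0" using DERIV_unique DERIV_const by (metis of_real_0)
  moreover have "Im (f 0) = 0" using square_real[of 0] by (simp add: f_def)
  moreover have "f 0 \<noteq> 0" using nz[of 0] by (simp add: f_def)
  hence "Re (f 0) \<noteq> 0" using \<open>Im (f 0) = 0\<close> by (simp add: complex_eq_iff)
  ultimately have \<alpha>: "Im \<alpha> = 0" by simp
  define z where "z = (\<lambda>n::int. (Ln (4 * \<alpha>\<^sup>2) + 2 * of_int n * pi * \<i> - 4 * \<beta>) / (4 * \<alpha>))"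
  have "z 1 \<in> \<real>" "z 0 \<in> \<real>" using potential_zeros_real zs unfolding z_def by blast+
  hence "4 * \<alpha> * (z 1 - z 0) \<in> \<real>" using \<alpha> by (intro Reals_mult Reals_diff) (auto simp: complex_is_Real_iff)
  moreover have "4 * \<alpha> * (z 1 - z 0) = 2 * of_real pi * \<i>" using ab(1) by (simp add: z_def field_simps)
  ultimately show False by (simp add: complex_is_Real_iff)
next
  case True
  then obtain a where a: "k a = 0" by blast
  have hol: "k holomorphic_on UNIV" using k exp_type_holomorphic by blast
  obtain w where w: "potential_wronskian k w \<noteq> 0" using potential_wronskian_nonzero[OF k] by blast
  obtain w1 where w1: "k w1 \<noteq> 0" using k(2) by (auto simp: constant_on_def)
  have "\<exists>w2. deriv k w2 \<noteq> 0"
  proof (rule ccontr)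
    assume "\<not> ?thesis"
    hence "schwarzian_part k z = 0 * k z ^ 6" for z by (simp add: schwarzian_part_def) (metis deriv_const ext)
    thus False using schwarzian_part_not_multiple_of_power[OF hol a w1, of 0] by blast
  qed
  then obtain w2 where w2: "deriv k w2 \<noteq> 0" by blast
  obtain w3 where w3: "schwarzian_part k w3 \<noteq> 0"
    using schwarzian_part_not_multiple_of_power[OF hol a w1, of 0] by auto
  obtain w4 where w4: "scaled_potential k w4 \<noteq> 0"
    using schwarzian_part_not_multiple_of_power[OF hol a w1, of "-1"] by (auto simp: scaled_potential_def add_eq_0_iff)
  define bad where "bad = {z \<in> cball 0 1. k z = 0} \<union> {z \<in> cball 0 1. deriv k z = 0} \<union> {z \<in> cball 0 1. schwarzian_part k z = 0}
     \<union> {z \<in> cball 0 1. scaled_potential k z = 0} \<union> {z \<in> cball 0 1. potential_wronskian k z = 0}"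
  have "finite bad" unfolding bad_def
    by (intro finite_UnI finite_zeros_cball[OF hol w1] finite_zeros_cball[OF holomorphic_deriv[OF hol open_UNIV] w2]
        finite_zeros_cball[OF potential_holomorphic(1)[OF hol] w3] finite_zeros_cball[OF potential_holomorphic(2)[OF hol] w4]
        finite_zeros_cball[OF potential_holomorphic(3)[OF hol] w])
  moreover have "infinite (complex_of_real ` {0..1})"
    by (subst finite_image_iff) (auto simp: inj_on_def)
  ultimately have "\<not> complex_of_real ` {0..1} \<subseteq> bad" using finite_subset by blast
  then obtain c where c: "c \<in> {0..1}" "complex_of_real c \<notin> bad" by blast
  have cb: "complex_of_real c \<in> cball 0 1" using c(1) by simp
  have "normalized_counterexample (\<lambda>z. k (z + of_real c))"
  proof
    show "exp_type (\<lambda>z. k (z + of_real c))" by (rule exp_type_shift[OF k(1)])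
    show "k (0 + of_real c) \<noteq> 0" "deriv (\<lambda>z. k (z + of_real c)) 0 \<noteq> 0" "schwarzian_part (\<lambda>z. k (z + of_real c)) 0 \<noteq> 0"
      "scaled_potential (\<lambda>z. k (z + of_real c)) 0 \<noteq> 0" "potential_wronskian (\<lambda>z. k (z + of_real c)) 0 \<noteq> 0"
      unfolding potential_shift[OF hol] add_0 using c(2) cb unfolding bad_def by blast+
    show "z \<in> \<real>" if "k (z + of_real c) = 0" for z
      using zeros_real[OF that] by (metis Reals_diff Reals_of_real add_diff_cancel_right')
    show "z \<in> \<real>" if "scaled_potential (\<lambda>z. k (z + of_real c)) z = 0" for z
      using potential_zeros_real[of "z + of_real c"] that unfolding potential_shift[OF hol]
      by (metis Reals_diff Reals_of_real add_diff_cancel_right')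
    show "Im (k (of_real x + of_real c) ^ 2) = 0" for x
      using square_real[of "x + c"] by (simp only: of_real_add)
    show "\<exists>b. k (b + of_real c) = 0" 
      by (rule exI[of _ "a - of_real c"]) (simp only: diff_add_cancel a)
  qed
  thus False by (rule normalized_counterexample.no_normalized_counterexample)
qed

section \<open>Rescaling to exponential type\<close>

text \<open>
  A local inverse length. It is comparable to the smaller one of \<open>|f'|^(2/3)\<close> and \<open>|f'|^2 / |f|^4\<close>, and it is
  multiplied by \<open>s^2\<close> under the rescaling \<open>s f(c + s^2 z)\<close>. On the set \<open>|f| \<le> 1\<close> it controls \<open>|f'|\<close>, as the
  spherical derivative does.
\<close>
definition zalcman_scale :: "(complex \<Rightarrow> complex) \<Rightarrow> complex \<Rightarrow> real" where
  "zalcman_scale f z = norm (deriv f z) ^ 2 / (root 3 (norm (deriv f z)) ^ 4 + norm (f z) ^ 4)"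

lemma zalcman_scale_alt:
  fixes f z
  defines "t \<equiv> root 3 (norm (deriv f z))"
  shows "t \<ge> 0" "norm (deriv f z) = t ^ 3" "zalcman_scale f z = t ^ 6 / (t ^ 4 + norm (f z) ^ 4)"
proof -
  show t: "t \<ge> 0" by (simp add: t_def)
  show n: "norm (deriv f z) = t ^ 3" by (simp add: t_def)
  show "zalcman_scale f z = t ^ 6 / (t ^ 4 + norm (f z) ^ 4)"
    unfolding zalcman_scale_def t_def[symmetric] by (simp add: n flip: power_mult)
qed

lemma zalcman_scale_nonneg: "zalcman_scale f z \<ge> 0"
  by (simp add: zalcman_scale_def)

lemma zalcman_scale_pos: "deriv f z \<noteq> 0 \<Longrightarrow> zalcman_scale f z > 0"
  unfolding zalcman_scale_def by (intro divide_pos_pos add_pos_nonneg) auto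

lemma zalcman_scale_le: "zalcman_scale f z \<le> root 3 (norm (deriv f z)) ^ 2"
proof -
  define t where "t = root 3 (norm (deriv f z))"
  note a = zalcman_scale_alt[of f z, folded t_def]
  have "t ^ 6 / (t ^ 4 + norm (f z) ^ 4) \<le> t ^ 2"
  proof (cases "t = 0")
    case False
    hence "t ^ 6 / (t ^ 4 + norm (f z) ^ 4) \<le> t ^ 6 / t ^ 4"
      using a(1) by (intro divide_left_mono mult_pos_pos add_pos_nonneg) auto
    also have "\<dots> = t ^ 2" using False by (simp add: power_diff[symmetric])
    finally show ?thesis .
  qed simp
  thus ?thesis unfolding a(3) by (simp only: t_def)
qed

lemma zalcman_scale_le_4:
  assumes "zalcman_scale f z \<le> 4" "norm (f z) \<le> 1"
  shows "norm (deriv f z) \<le> 12"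
proof (rule ccontr)
  assume n: "\<not> ?thesis"
  define t where "t = root 3 (norm (deriv f z))"
  note a = zalcman_scale_alt[of f z, folded t_def]
  have t5: "t\<^sup>2 \<ge> 5"
  proof (rule ccontr)
    assume "\<not> t\<^sup>2 \<ge> 5"
    hence "(t\<^sup>2) ^ 3 \<le> 5 ^ 3" by (intro power_mono) auto
    hence "(t ^ 3)\<^sup>2 \<le> 125" by (simp flip: power_mult)
    hence "(t ^ 3)\<^sup>2 \<le> 12\<^sup>2" by simp
    hence "t ^ 3 \<le> 12" by (rule power2_le_imp_le) simp
    thus False using n a(2) by simp
  qed
  hence t4: "t ^ 4 \<ge> 25" using power_mono[OF t5, of 2] by (simp flip: power_mult)
  have den: "t ^ 4 + norm (f z) ^ 4 > 0" by (rule add_pos_nonneg) (use t4 in auto)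
  have "t ^ 6 \<le> 4 * (t ^ 4 + norm (f z) ^ 4)"
    using assms(1) unfolding a(3) pos_divide_le_eq[OF den] .
  also have "norm (f z) ^ 4 \<le> 1" using assms(2) by (simp add: power_le_one)
  finally have "t ^ 4 * t\<^sup>2 \<le> 4 * t ^ 4 + 4" by (simp flip: power_add)
  moreover have "t ^ 4 * 5 \<le> t ^ 4 * t\<^sup>2" using t5 t4 by (intro mult_left_mono) auto
  ultimately show False using t4 by linarith
qed

lemma zalcman_scale_eq_1:
  assumes "zalcman_scale f z = 1"
  shows "1 \<le> norm (deriv f z)" "norm (f z) ^ 2 \<le> norm (deriv f z)"
proof -
  define t where "t = root 3 (norm (deriv f z))"
  note a = zalcman_scale_alt[of f z, folded t_def]
  have "t ^ 4 + norm (f z) ^ 4 \<noteq> 0" using assms a(3) by auto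
  hence eq: "t ^ 6 = t ^ 4 + norm (f z) ^ 4" using assms a(3) by (simp add: field_simps)
  have "t \<noteq> 0" using assms a(3) by auto
  hence "t > 0" using a(1) by simp
  have "t ^ 4 * 1 \<le> t ^ 4 * t ^ 2" using eq by (simp flip: power_add)
  hence "1 \<le> t ^ 2" using \<open>t > 0\<close> by (simp only: mult_le_cancel_left_pos zero_less_power)
  hence "1 \<le> t" using \<open>t > 0\<close> by (metis abs_of_pos abs_le_square_iff abs_1 one_power2 power2_abs)
  thus "1 \<le> norm (deriv f z)" unfolding a(2) by (rule one_le_power)
  have "(norm (f z) ^ 2) ^ 2 \<le> (t ^ 3) ^ 2" using eq a(1) by (simp flip: power_mult)
  thus "norm (f z) ^ 2 \<le> norm (deriv f z)" unfolding a(2) by (rule power2_le_imp_le) (use a(1) in simp)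
qed

lemma deriv_rescale:
  assumes "f holomorphic_on UNIV"
  shows "deriv (\<lambda>\<zeta>. \<sigma> * f (c + s * \<zeta>)) \<zeta> = \<sigma> * (s * deriv f (c + s * \<zeta>))"
proof -
  have "(f has_field_derivative deriv f (c + s * \<zeta>)) (at (c + s * \<zeta>))"
    using holomorphic_derivI[OF assms open_UNIV] by simp
  moreover have "((\<lambda>\<zeta>. c + s * \<zeta>) has_field_derivative s) (at \<zeta>)" by (auto intro!: derivative_eq_intros)
  ultimately have "((\<lambda>\<zeta>. f (c + s * \<zeta>)) has_field_derivative deriv f (c + s * \<zeta>) * s) (at \<zeta>)"
    by (rule DERIV_chain2)
  hence "((\<lambda>\<zeta>. \<sigma> * f (c + s * \<zeta>)) has_field_derivative \<sigma> * (deriv f (c + s * \<zeta>) * s)) (at \<zeta>)"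
    by (rule DERIV_cmult)
  thus ?thesis using DERIV_imp_deriv by (metis mult.commute)
qed

lemma holomorphic_rescale:
  assumes "f holomorphic_on UNIV"
  shows "(\<lambda>\<zeta>. \<sigma> * f (c + s * \<zeta>)) holomorphic_on UNIV"
proof -
  have "(\<lambda>\<zeta>. c + s * \<zeta>) holomorphic_on UNIV" by (intro holomorphic_intros)
  from holomorphic_on_compose_gen[OF this assms]
  have "(\<lambda>\<zeta>. f (c + s * \<zeta>)) holomorphic_on UNIV" by (simp add: o_def)
  thus ?thesis by (intro holomorphic_intros)
qed

lemma scaled_potential_rescale:
  assumes "k holomorphic_on UNIV"
  shows "scaled_potential (\<lambda>\<zeta>. s * k (c + s ^ 2 * \<zeta>)) \<zeta> = s ^ 6 * scaled_potential k (c + s ^ 2 * \<zeta>)"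
proof -
  define K where "K = (\<lambda>\<zeta>. s * k (c + s ^ 2 * \<zeta>))"
  have d1: "deriv K = (\<lambda>\<zeta>. s ^ 3 * deriv k (c + s ^ 2 * \<zeta>))"
    unfolding K_def by (rule ext, subst deriv_rescale[OF assms]) (simp add: power2_eq_square power3_eq_cube)
  have d2: "deriv (deriv K) = (\<lambda>\<zeta>. s ^ 5 * deriv (deriv k) (c + s ^ 2 * \<zeta>))"
    unfolding d1 by (rule ext, subst deriv_rescale[OF holomorphic_deriv[OF assms open_UNIV]]) (simp add: eval_nat_numeral)
  have "scaled_potential K \<zeta> = s ^ 6 * scaled_potential k (c + s ^ 2 * \<zeta>)"
    unfolding scaled_potential_def schwarzian_part_def unfolding d2 unfolding d1 unfolding K_def
    by (simp add: algebra_simps eval_nat_numeral)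
  thus ?thesis by (simp add: K_def)
qed

lemma zalcman_scale_rescale:
  assumes "f holomorphic_on UNIV" "s > 0"
  shows "zalcman_scale (\<lambda>\<zeta>. of_real s * f (c + of_real s ^ 2 * \<zeta>)) \<zeta> = s\<^sup>2 * zalcman_scale f (c + of_real s ^ 2 * \<zeta>)"
proof -
  define w where "w = c + of_real s ^ 2 * \<zeta>"
  define t where "t = root 3 (norm (deriv f w))"
  have "norm (deriv (\<lambda>\<zeta>. of_real s * f (c + of_real s ^ 2 * \<zeta>)) \<zeta>) = s ^ 3 * norm (deriv f w)"
    unfolding deriv_rescale[OF assms(1)] w_def[symmetric]
    using assms(2) by (simp add: norm_mult norm_power power2_eq_square power3_eq_cube)
  hence "root 3 (norm (deriv (\<lambda>\<zeta>. of_real s * f (c + of_real s ^ 2 * \<zeta>)) \<zeta>)) = s * t"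
    using assms(2) by (simp add: real_root_mult real_root_power_cancel t_def)
  hence "zalcman_scale (\<lambda>\<zeta>. of_real s * f (c + of_real s ^ 2 * \<zeta>)) \<zeta> = (s * t) ^ 6 / ((s * t) ^ 4 + (s * norm (f w)) ^ 4)"
    unfolding zalcman_scale_alt(3) using assms(2) by (simp add: norm_mult w_def)
  also have "\<dots> = (s ^ 4 * (s ^ 2 * t ^ 6)) / (s ^ 4 * (t ^ 4 + norm (f w) ^ 4))"
    by (simp add: power_mult_distrib distrib_left flip: power_add mult.assoc)
  also have "\<dots> = s ^ 2 * (t ^ 6 / (t ^ 4 + norm (f w) ^ 4))"
    unfolding times_divide_eq_right by (rule nonzero_mult_divide_mult_cancel_left) (use assms(2) in simp)
  also have "\<dots> = s ^ 2 * zalcman_scale f w" unfolding zalcman_scale_alt(3) t_def ..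
  finally show ?thesis by (simp add: w_def)
qed

text \<open>
  Choose \<open>c\<close> where \<open>zalcman_scale f z * (R - norm z)\<close> is at least half its supremum over a large ball, and \<open>s\<close> such
  that the scale becomes \<open>1\<close> at the origin. Near \<open>c\<close> the scale is then at most four times its value at \<open>c\<close>.
\<close>
lemma Zalcman_Brody_rescaling:
  assumes hol: "f holomorphic_on UNIV" and a: "deriv f a \<noteq> 0" and N: "N > 0"
  obtains c s where "s > 0" "zalcman_scale (\<lambda>\<zeta>. of_real s * f (c + of_real s ^ 2 * \<zeta>)) 0 = 1"
    "\<And>\<zeta>. norm \<zeta> < N \<Longrightarrow> zalcman_scale (\<lambda>\<zeta>. of_real s * f (c + of_real s ^ 2 * \<zeta>)) \<zeta> \<le> 4"
proof -
  define L0 where "L0 = zalcman_scale f a"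
  have l0: "L0 > 0" using zalcman_scale_pos[OF a] by (simp add: L0_def)
  define R where "R = norm a + 4 * N / L0"
  have Ra: "R - norm a = 4 * N / L0" by (simp add: R_def)
  hence R: "norm a < R" using N l0 by (smt (verit) divide_pos_pos)
  define h where "h = (\<lambda>z. zalcman_scale f z * (R - norm z))"
  have "compact (deriv f ` cball 0 R)"
    by (intro compact_continuous_image holomorphic_on_imp_continuous_on
        holomorphic_on_subset[OF holomorphic_deriv[OF hol open_UNIV]]) auto
  hence "bounded (deriv f ` cball 0 R)" by (rule compact_imp_bounded)
  then obtain M where M: "\<And>z. z \<in> cball 0 R \<Longrightarrow> norm (deriv f z) \<le> M"
    unfolding bounded_iff by blast
  have bdd: "bdd_above (h ` ball 0 R)"
  proof (rule bdd_aboveI2)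
    fix z :: complex assume z: "z \<in> ball 0 R"
    have "zalcman_scale f z \<le> root 3 (norm (deriv f z)) ^ 2" by (rule zalcman_scale_le)
    also have "\<dots> \<le> root 3 M ^ 2" using M[of z] z by (intro power_mono) auto
    finally show "h z \<le> root 3 M ^ 2 * R"
      unfolding h_def using z zalcman_scale_nonneg[of f z] by (intro mult_mono) auto
  qed
  define B where "B = (SUP z\<in>ball 0 R. h z)"
  have hB: "h z \<le> B" if "z \<in> ball 0 R" for z unfolding B_def by (rule cSUP_upper[OF that bdd])
  have ha: "h a = 4 * N" using l0 by (simp add: h_def Ra L0_def[symmetric])
  have B4: "B \<ge> 4 * N" using hB[of a] R ha by simp
  have "B / 2 < (SUP z\<in>ball 0 R. h z)" using B4 N by (simp add: B_def[symmetric])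
  then obtain c where c: "c \<in> ball 0 R" "B / 2 < h c"
    using less_cSUP_iff[OF _ bdd] R by (metis ball_eq_empty linorder_not_le norm_ge_zero order.strict_trans1)
  have lc: "zalcman_scale f c > 0"
  proof (rule ccontr)
    assume "\<not> ?thesis"
    hence "zalcman_scale f c = 0" using zalcman_scale_nonneg[of f c] by simp
    thus False using c B4 N by (simp add: h_def)
  qed
  define s where "s = sqrt (1 / zalcman_scale f c)"
  have s: "s > 0" "s\<^sup>2 = 1 / zalcman_scale f c" using lc by (auto simp: s_def)
  have "2 * N < h c" using B4 c by linarith
  hence Ns: "s\<^sup>2 * N < (R - norm c) / 2" using lc by (simp add: h_def s field_simps)
  show thesis
  proof (rule that[OF s(1)])
    show "zalcman_scale (\<lambda>\<zeta>. of_real s * f (c + of_real s ^ 2 * \<zeta>)) 0 = 1"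
      unfolding zalcman_scale_rescale[OF hol s(1)] using s lc by simp
    fix \<zeta> :: complex assume \<zeta>: "norm \<zeta> < N"
    define z where "z = c + of_real s ^ 2 * \<zeta>"
    have "norm z \<le> norm c + s\<^sup>2 * norm \<zeta>"
      unfolding z_def by (rule order.trans[OF norm_triangle_ineq]) (simp add: norm_mult norm_power)
    moreover have "s\<^sup>2 * norm \<zeta> \<le> s\<^sup>2 * N" using \<zeta> by (intro mult_left_mono) auto
    ultimately have nz: "(R - norm c) / 2 < R - norm z" using Ns by argo
    have Rc: "R - norm c > 0" using c by simp
    have "zalcman_scale f z * ((R - norm c) / 2) \<le> zalcman_scale f z * (R - norm z)"
      using nz zalcman_scale_nonneg by (intro mult_left_mono) auto
    also have "\<dots> \<le> B" using hB[of z] nz Rc by (simp add: h_def)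
    also have "\<dots> \<le> 2 * (zalcman_scale f c * (R - norm c))" using c by (simp add: h_def)
    finally have "zalcman_scale f z * (R - norm c) \<le> (4 * zalcman_scale f c) * (R - norm c)" by argo
    hence "zalcman_scale f z \<le> 4 * zalcman_scale f c" using Rc by simp
    thus "zalcman_scale (\<lambda>\<zeta>. of_real s * f (c + of_real s ^ 2 * \<zeta>)) \<zeta> \<le> 4"
      unfolding zalcman_scale_rescale[OF hol s(1)] z_def[symmetric] s(2) using lc by (simp add: field_simps)
  qed
qed

text \<open>
  Let \<open>\<zeta>\<close> be the point of \<open>|f| \<le> 1\<close> closest to \<open>z\<close>, at distance \<open>d\<close>. In the ball around \<open>z\<close> of radius
  \<open>d\<close> the function \<open>ln |f|\<close> is positive and harmonic, so by the Harnack inequality it grows from \<open>\<zeta>\<close> towards \<open>z\<close> at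
  least at the rate \<open>ln |f z| / (2 d)\<close>; this rate is at most \<open>|f' \<zeta>| \<le> 12\<close>. The condition at the
  origin forces a point with \<open>|f| \<le> 1\<close> within distance \<open>2\<close> of the origin, which bounds \<open>d\<close>.
\<close>
lemma Clunie_Hayman_bound:
  assumes hol: "f holomorphic_on UNIV" and N: "2 * norm z + 2 < N"
    and l0: "zalcman_scale f 0 = 1" and l4: "\<And>z. norm z < N \<Longrightarrow> zalcman_scale f z \<le> 4"
  shows "norm (f z) \<le> exp (24 * (norm z + 2))"
proof (cases "norm (f z) \<le> 1")
  case True
  also have "1 \<le> exp (24 * (norm z + 2))" by simp
  finally show ?thesis .
next
  case False
  have "\<exists>z1\<in>ball 0 2. norm (f z1) \<le> 1"
  proof (rule ccontr)
    assume "\<not> ?thesis"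
    hence big: "\<And>z. z \<in> ball 0 2 \<Longrightarrow> norm (f z) > 1" by force
    hence nz: "\<And>z. z \<in> ball 0 2 \<Longrightarrow> f z \<noteq> 0" by force
    obtain h where h: "h holomorphic_on ball 0 2" "\<And>z. z \<in> ball 0 2 \<Longrightarrow> f z = exp (h z)"
      using exp_form_on_ball[OF holomorphic_on_subset[OF hol subset_UNIV] nz] by blast
    have pos: "Re (h z) > 0" if "z \<in> ball 0 2" for z using big[OF that] h(2)[OF that] by simp
    have H: "norm (deriv h 0) \<le> 2 * Re (h 0) / 2"
      by (rule Harnack_inequality(2)[OF h(1) _ pos, of 0]) auto
    have "(h has_field_derivative deriv h 0) (at 0)" by (rule holomorphic_derivI[OF h(1)]) auto
    hence "((\<lambda>z. exp (h z)) has_field_derivative exp (h 0) * deriv h 0) (at 0)" by (rule DERIV_fun_exp)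
    hence "(f has_field_derivative exp (h 0) * deriv h 0) (at 0)"
      by (rule has_field_derivative_transform_within_open[of _ _ _ "ball 0 2"]) (use h(2) in auto)
    hence "deriv f 0 = f 0 * deriv h 0" using DERIV_imp_deriv h(2)[of 0] by auto
    hence "norm (f 0) ^ 2 \<le> norm (f 0) * norm (deriv h 0)" using zalcman_scale_eq_1(2)[OF l0] by (simp add: norm_mult)
    hence "norm (f 0) \<le> norm (deriv h 0)" using nz[of 0] by (simp add: power2_eq_square)
    moreover have "norm (f 0) = exp (Re (h 0))" using h(2)[of 0] by simp
    ultimately have "exp (Re (h 0)) \<le> Re (h 0)" using H by simp
    thus False using exp_ge_add_one_self[of "Re (h 0)"] by linarith
  qed
  then obtain z1 where z1: "z1 \<in> ball 0 2" "norm (f z1) \<le> 1" by blast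
  define K where "K = {w. norm (f w) \<le> 1}"
  have "closed K" unfolding K_def
    by (intro closed_Collect_le continuous_intros holomorphic_on_imp_continuous_on hol)
  moreover have "z1 \<in> K" using z1 by (simp add: K_def)
  ultimately obtain \<zeta> where \<zeta>: "\<zeta> \<in> K" "\<And>y. y \<in> K \<Longrightarrow> dist z \<zeta> \<le> dist z y"
    using distance_attains_inf[of K z] by blast
  define d where "d = dist z \<zeta>"
  have "z \<noteq> \<zeta>" using \<zeta>(1) False by (auto simp: K_def)
  hence d: "d > 0" by (simp add: d_def)
  have "d \<le> dist z z1" using \<zeta>(2)[OF \<open>z1 \<in> K\<close>] by (simp add: d_def)
  also have "\<dots> \<le> norm z + norm z1" by (simp add: dist_norm norm_triangle_ineq4)
  finally have d2: "d \<le> norm z + 2" using z1 by simp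
  have "norm \<zeta> \<le> norm z + d" unfolding d_def dist_norm using norm_triangle_ineq2[of \<zeta> z] by (simp add: norm_minus_commute)
  hence "norm \<zeta> < N" using N d2 by linarith
  hence der: "norm (deriv f \<zeta>) \<le> 12" using zalcman_scale_le_4 l4 \<zeta>(1) by (auto simp: K_def)
  have big: "norm (f w) > 1" if "w \<in> ball z d" for w
  proof (rule ccontr)
    assume "\<not> ?thesis"
    hence "d \<le> dist z w" using \<zeta>(2)[of w] by (simp add: K_def d_def)
    thus False using that by simp
  qed
  hence nz: "\<And>w. w \<in> ball z d \<Longrightarrow> f w \<noteq> 0" by force
  obtain h where h: "h holomorphic_on ball z d" "\<And>w. w \<in> ball z d \<Longrightarrow> f w = exp (h w)"
    using exp_form_on_ball[OF holomorphic_on_subset[OF hol subset_UNIV] nz] by blast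
  have pos: "Re (h w) > 0" if "w \<in> ball z d" for w using big[OF that] h(2)[OF that] by simp
  \<comment> \<open>Difference quotients of \<open>f\<close> along the segment from \<open>\<zeta>\<close> to \<open>z\<close>.\<close>
  define \<sigma> where "\<sigma> = (\<lambda>n::nat. 1 / (real n + 2))"
  define p where "p = (\<lambda>t::complex. f (\<zeta> + t * (z - \<zeta>)))"
  have quot: "Re (h z) / 2 \<le> norm ((p (of_real (\<sigma> n)) - p 0) / of_real (\<sigma> n))" for n
  proof -
    define s where "s = \<sigma> n"
    have s: "0 < s" "s < 1" by (auto simp: s_def \<sigma>_def)
    define w where "w = \<zeta> + of_real s * (z - \<zeta>)"
    have "w - z = of_real (s - 1) * (z - \<zeta>)" by (simp add: w_def algebra_simps)
    hence nw: "norm (w - z) = (1 - s) * d" using s by (simp add: norm_mult d_def dist_norm del: of_real_diff)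
    have wb: "w \<in> ball z d" using nw s d by (simp add: dist_norm norm_minus_commute)
    have zb: "z \<in> ball z d" using d by simp
    have "Re (h z) * (s / 2) \<le> Re (h z) * (s / (2 - s))"
      using s pos[OF zb] by (intro mult_left_mono divide_left_mono) auto
    also have "\<dots> = Re (h z) * (d - norm (w - z)) / (d + norm (w - z))"
    proof -
      have "d - norm (w - z) = d * s" "d + norm (w - z) = d * (2 - s)" unfolding nw by (auto simp: algebra_simps)
      thus ?thesis using d by simp
    qed
    also have "\<dots> \<le> Re (h w)" by (rule Harnack_inequality(1)[OF h(1) d pos wb])
    finally have "Re (h z) * (s / 2) \<le> Re (h w)" .
    moreover have "1 + Re (h w) \<le> norm (f w)" using h(2)[OF wb] by simp
    ultimately have 1: "1 + Re (h z) * (s / 2) \<le> norm (f w)" by linarith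
    have "norm (f w) \<le> norm (f \<zeta>) + norm (f w - f \<zeta>)" by (metis norm_triangle_sub)
    hence "Re (h z) * (s / 2) \<le> norm (f w - f \<zeta>)" using 1 \<zeta>(1) by (simp add: K_def)
    hence "Re (h z) / 2 \<le> norm (f w - f \<zeta>) / s" using s by (simp add: field_simps)
    thus ?thesis using s by (simp add: p_def w_def s_def norm_divide)
  qed
  have "(f has_field_derivative deriv f \<zeta>) (at (\<zeta> + 0 * (z - \<zeta>)))"
    using holomorphic_derivI[OF hol open_UNIV, of \<zeta> UNIV] by simp
  moreover have "((\<lambda>t. \<zeta> + t * (z - \<zeta>)) has_field_derivative (z - \<zeta>)) (at 0)" by (auto intro!: derivative_eq_intros)
  ultimately have "(p has_field_derivative deriv f \<zeta> * (z - \<zeta>)) (at 0)" unfolding p_def by (rule DERIV_chain2)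
  hence lim0: "((\<lambda>t. (p t - p 0) / t) \<longlongrightarrow> deriv f \<zeta> * (z - \<zeta>)) (at 0)"
    by (simp add: DERIV_def)
  have \<sigma>0: "\<sigma> \<longlonglongrightarrow> 0" unfolding \<sigma>_def by real_asymp
  have "filterlim (\<lambda>n. complex_of_real (\<sigma> n)) (at 0) sequentially"
  proof (rule filterlim_atI)
    show "(\<lambda>n. complex_of_real (\<sigma> n)) \<longlonglongrightarrow> 0" using tendsto_of_real[OF \<sigma>0, where 'a = complex] by simp
    have "\<sigma> n > 0" for n by (simp add: \<sigma>_def)
    hence "complex_of_real (\<sigma> n) \<noteq> 0" for n by (metis less_irrefl of_real_eq_0_iff)
    thus "\<forall>\<^sub>F n in sequentially. complex_of_real (\<sigma> n) \<noteq> 0" by simp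
  qed
  from filterlim_compose[OF lim0 this]
  have "(\<lambda>n. norm ((p (of_real (\<sigma> n)) - p 0) / of_real (\<sigma> n))) \<longlonglongrightarrow> norm (deriv f \<zeta> * (z - \<zeta>))"
    by (rule tendsto_norm)
  hence "Re (h z) / 2 \<le> norm (deriv f \<zeta> * (z - \<zeta>))"
    by (rule LIMSEQ_le_const) (use quot in auto)
  also have "\<dots> = norm (deriv f \<zeta>) * d" by (simp add: norm_mult d_def dist_norm)
  also have "\<dots> \<le> 12 * (norm z + 2)" using der d d2 by (intro mult_mono) auto
  finally have "Re (h z) \<le> 24 * (norm z + 2)" by simp
  thus ?thesis using h(2)[of z] d by simp
qed

lemma uniform_limit_subseq:
  assumes "uniform_limit K f F sequentially" "strict_mono (r :: nat \<Rightarrow> nat)"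
  shows "uniform_limit K (\<lambda>n. f (r n)) F sequentially"
  using filterlim_compose[OF assms(1) filterlim_subseq[OF assms(2)]] .

lemma Montel_exp_type:
  fixes f :: "nat \<Rightarrow> complex \<Rightarrow> complex"
  assumes hol: "\<And>n. f n holomorphic_on UNIV" and C: "C \<ge> 0"
    and b: "\<And>n z. norm z \<le> real n \<Longrightarrow> norm (f n z) \<le> exp (C * (1 + norm z))"
  obtains F r where "exp_type F" "strict_mono (r :: nat \<Rightarrow> nat)"
    "\<And>K. compact K \<Longrightarrow> uniform_limit K (\<lambda>n. f (r n)) F sequentially"
proof -
  have bdd: "\<exists>B. \<forall>h\<in>range f. \<forall>z\<in>K. norm (h z) \<le> B" if K: "compact K" "K \<subseteq> UNIV" for K
  proof -
    obtain M where M: "\<And>z. z \<in> K \<Longrightarrow> norm z \<le> M"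
      using compact_imp_bounded[OF K(1)] unfolding bounded_iff by blast
    have "\<exists>B. \<forall>z\<in>K. norm (f n z) \<le> B" for n
    proof -
      have "bounded (f n ` K)"
        by (intro compact_imp_bounded compact_continuous_image K(1) holomorphic_on_imp_continuous_on
            holomorphic_on_subset[OF hol] subset_UNIV)
      thus ?thesis unfolding bounded_iff by blast
    qed
    then obtain B where B: "\<And>n z. z \<in> K \<Longrightarrow> norm (f n z) \<le> B n" by metis
    define m where "m = nat \<lceil>M\<rceil>"
    define BB where "BB = Max (insert (exp (C * (1 + M))) (B ` {..m}))"
    have "norm (f n z) \<le> BB" if z: "z \<in> K" for n z
    proof (cases "n \<le> m")
      case True
      have "norm (f n z) \<le> B n" using B z by blast
      also have "\<dots> \<le> BB" unfolding BB_def using True by (intro Max_ge) auto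
      finally show ?thesis .
    next
      case False
      have "norm z \<le> real n" using M[OF z] False unfolding m_def by linarith
      hence "norm (f n z) \<le> exp (C * (1 + norm z))" by (rule b)
      also have "\<dots> \<le> exp (C * (1 + M))" using M[OF z] C by (auto intro: mult_left_mono)
      also have "\<dots> \<le> BB" unfolding BB_def by (intro Max_ge) auto
      finally show ?thesis .
    qed
    thus ?thesis by blast
  qed
  have holR: "h holomorphic_on UNIV" if "h \<in> range f" for h using that hol by blast
  obtain F r where F: "F holomorphic_on UNIV" "strict_mono (r :: nat \<Rightarrow> nat)"
    "\<And>x. x \<in> UNIV \<Longrightarrow> ((\<lambda>n. f (r n) x) \<longlongrightarrow> F x) sequentially"
    "\<And>K. \<lbrakk>compact K; K \<subseteq> UNIV\<rbrakk> \<Longrightarrow> uniform_limit K (f \<circ> r) F sequentially"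
    using Montel[OF open_UNIV holR bdd order_refl] by blast
  have "norm (F z) \<le> exp (C * (1 + norm z))" for z
  proof (rule LIMSEQ_le_const2[OF tendsto_norm[OF F(3)[OF UNIV_I]]], intro exI allI impI)
    fix n assume n: "n \<ge> nat \<lceil>norm z\<rceil>"
    have "n \<le> r n" using F(2) by (rule seq_suble)
    hence "norm z \<le> real (r n)" using n by linarith
    thus "norm (f (r n) z) \<le> exp (C * (1 + norm z))" by (rule b)
  qed
  hence "exp_type F" unfolding exp_type_def using F(1) C by blast
  moreover have "uniform_limit K (\<lambda>n. f (r n)) F sequentially" if "compact K" for K
    using F(4)[OF that] by (simp add: o_def)
  ultimately show ?thesis using that F(2) by blast
qed

lemma deriv_bound_of_exp_bound:
  assumes hol: "f holomorphic_on UNIV" and C: "C \<ge> 0"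
    and b: "\<And>z. norm z \<le> R + 1 \<Longrightarrow> norm (f z) \<le> exp (C * (1 + norm z))" and z: "norm z \<le> R"
  shows "norm (deriv f z) \<le> exp (2 * C * (1 + norm z))"
proof -
  have "norm ((deriv ^^ 1) f z) \<le> fact 1 * exp (C * (2 + norm z)) / 1 ^ 1"
  proof (rule Cauchy_inequality[OF holomorphic_on_subset[OF hol]])
    fix x assume x: "norm (z - x) = 1"
    have nx: "norm x \<le> norm z + 1" using x norm_triangle_ineq2[of x z] by (simp add: norm_minus_commute)
    hence "norm (f x) \<le> exp (C * (1 + norm x))" using z by (intro b) simp
    also have "\<dots> \<le> exp (C * (2 + norm z))" using nx C by (auto intro!: mult_left_mono)
    finally show "norm (f x) \<le> exp (C * (2 + norm z))" .
  qed (auto intro: holomorphic_on_imp_continuous_on holomorphic_on_subset[OF hol])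
  also have "C * (2 + norm z) \<le> C * (2 * (1 + norm z))" using C by (intro mult_left_mono) auto
  finally show ?thesis by (simp add: mult_ac)
qed

lemma scaled_potential_exp_bound:
  assumes hol: "f holomorphic_on UNIV" and C: "C \<ge> 0"
    and b: "\<And>z. norm z \<le> R + 2 \<Longrightarrow> norm (f z) \<le> exp (C * (1 + norm z))" and z: "norm z \<le> R"
  shows "norm (scaled_potential f z) \<le> exp ((6 * C + 13) * (1 + norm z))"
proof -
  define x where "x = 1 + norm z"
  have x1: "x \<ge> 1" by (simp add: x_def)
  have d1: "norm (deriv f w) \<le> exp (2 * C * (1 + norm w))" if "norm w \<le> R + 1" for w
    by (rule deriv_bound_of_exp_bound[OF hol C _ that]) (use b in auto)
  have d2: "norm (deriv (deriv f) z) \<le> exp (2 * (2 * C) * (1 + norm z))"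
    by (rule deriv_bound_of_exp_bound[OF holomorphic_deriv[OF hol open_UNIV] _ d1 z]) (use C in auto)
  define E where "E = exp (C * x)"
  have E: "E \<ge> 1" "E > 0" using C x1 by (auto simp: E_def)
  have f0: "norm (f z) \<le> E" using b[of z] z by (simp add: E_def x_def)
  have f1: "norm (deriv f z) \<le> E ^ 2"
    using d1[of z] z unfolding E_def x_def by (simp add: mult_ac flip: exp_of_nat_mult)
  have f2: "norm (deriv (deriv f) z) \<le> E ^ 4"
    using d2 unfolding E_def x_def by (simp add: mult_ac flip: exp_of_nat_mult)
  have "norm (scaled_potential f z) \<le> norm (f z) ^ 6 + (4 * norm (f z) * norm (deriv (deriv f) z) + 8 * norm (deriv f z) ^ 2)"
    unfolding scaled_potential_def schwarzian_part_def
    by (rule order.trans[OF norm_triangle_ineq], rule add_mono, simp add: norm_power,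
        rule order.trans[OF norm_triangle_ineq4]) (simp add: norm_mult norm_power)
  also have "\<dots> \<le> E ^ 6 + (4 * E * E ^ 4 + 8 * (E ^ 2) ^ 2)"
    using E by (intro add_mono mult_mono power_mono f0 f1 f2) auto
  also have "\<dots> \<le> E ^ 6 + (4 * E ^ 6 + 8 * E ^ 6)"
  proof (intro add_mono order_refl)
    have "E ^ 5 \<le> E ^ 6" "E ^ 4 \<le> E ^ 6" using E by (auto intro!: power_increasing)
    thus "4 * E * E ^ 4 \<le> 4 * E ^ 6" "8 * (E ^ 2) ^ 2 \<le> 8 * E ^ 6"
      by (simp_all add: eval_nat_numeral)
  qed
  also have "\<dots> = 13 * E ^ 6" by simp
  also have "\<dots> \<le> exp (13 * x) * E ^ 6"
  proof (rule mult_right_mono)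
    have "13 \<le> 13 * x" using x1 by simp
    also have "\<dots> \<le> exp (13 * x)" using exp_ge_add_one_self[of "13 * x"] by linarith
    finally show "13 \<le> exp (13 * x)" .
  qed (use E in auto)
  also have "\<dots> = exp ((6 * C + 13) * x)"
    unfolding E_def by (simp add: algebra_simps flip: exp_of_nat_mult exp_add)
  finally show ?thesis by (simp add: x_def)
qed

text \<open>
  The theorem of Montel is applied in turn to the functions, their derivatives and their potentials; pointwise
  convergence of the derivatives identifies the limits.
\<close>
lemma scaled_potential_limits:
  fixes f :: "nat \<Rightarrow> complex \<Rightarrow> complex"
  assumes hol: "\<And>n. f n holomorphic_on UNIV" and C: "C \<ge> 0"
    and b: "\<And>n z. norm z \<le> real n \<Longrightarrow> norm (f n z) \<le> exp (C * (1 + norm z))"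
  obtains F r where "exp_type F" "strict_mono (r :: nat \<Rightarrow> nat)"
    "\<And>K. compact K \<Longrightarrow> uniform_limit K (\<lambda>n. f (r n)) F sequentially"
    "\<And>K. compact K \<Longrightarrow> uniform_limit K (\<lambda>n. deriv (f (r n))) (deriv F) sequentially"
    "\<And>K. compact K \<Longrightarrow> uniform_limit K (\<lambda>n. scaled_potential (f (r n))) (scaled_potential F) sequentially"
proof -
  obtain F r1 where F: "exp_type F" "strict_mono (r1 :: nat \<Rightarrow> nat)"
    "\<And>K. compact K \<Longrightarrow> uniform_limit K (\<lambda>n. f (r1 n)) F sequentially"
    using Montel_exp_type[of f C, OF hol C b] by blast
  have hd: "(deriv ^^ m) (f (r1 n)) holomorphic_on UNIV" for n m
    by (intro holomorphic_higher_deriv hol open_UNIV)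
  have ptw: "(\<lambda>n. (deriv ^^ m) (f (r1 n)) z) \<longlonglongrightarrow> (deriv ^^ m) F z" for m z
  proof (rule higher_deriv_complex_uniform_limit)
    show "uniform_limit (ball z 1) (\<lambda>n. f (r1 n)) F sequentially"
      by (rule uniform_limit_on_subset[OF F(3)[OF compact_cball[of z 1]]]) auto
    show "\<forall>\<^sub>F n in sequentially. f (r1 n) holomorphic_on ball z 1"
      by (intro always_eventually allI holomorphic_on_subset[OF hol] subset_UNIV)
  qed auto
  have r1n: "r1 n \<ge> n" for n using F(2) by (rule seq_suble)
  define f1 where "f1 = (\<lambda>n. f (r1 (n + 2)))"
  have f1b: "norm (f1 n w) \<le> exp (C * (1 + norm w))" if "norm w \<le> real n + 2" for n w
    unfolding f1_def using that r1n[of "n + 2"] by (intro b) linarith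
  have db: "norm (deriv (f1 n) z) \<le> exp (2 * C * (1 + norm z))" if "norm z \<le> real n" for n z
    by (rule deriv_bound_of_exp_bound[OF _ C f1b that]) (auto simp: f1_def hol)
  obtain F1 r2 where F1: "exp_type F1" "strict_mono (r2 :: nat \<Rightarrow> nat)"
    "\<And>K. compact K \<Longrightarrow> uniform_limit K (\<lambda>n. deriv (f1 (r2 n))) F1 sequentially"
  proof (rule Montel_exp_type[of "\<lambda>n. deriv (f1 n)" "2 * C"])
    show "deriv (f1 n) holomorphic_on UNIV" for n unfolding f1_def by (intro holomorphic_deriv hol open_UNIV)
  qed (use C db in auto)
  have r2n: "r2 n \<ge> n" for n using F1(2) by (rule seq_suble)
  have gb: "norm (scaled_potential (f1 (r2 n)) z) \<le> exp ((6 * C + 13) * (1 + norm z))" if "norm z \<le> real n" for n z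
  proof (rule scaled_potential_exp_bound[OF _ C f1b])
    show "norm z \<le> real (r2 n)" using that r2n[of n] by linarith
  qed (auto simp: f1_def hol)
  obtain F2 r3 where F2: "exp_type F2" "strict_mono (r3 :: nat \<Rightarrow> nat)"
    "\<And>K. compact K \<Longrightarrow> uniform_limit K (\<lambda>n. scaled_potential (f1 (r2 (r3 n)))) F2 sequentially"
  proof (rule Montel_exp_type[of "\<lambda>n. scaled_potential (f1 (r2 n))" "6 * C + 13"])
    show "scaled_potential (f1 (r2 n)) holomorphic_on UNIV" for n unfolding f1_def by (intro potential_holomorphic hol)
  qed (use C gb in auto)
  define q where "q = (\<lambda>n. r2 (r3 n) + 2)"
  have q: "strict_mono q"
    using F1(2) F2(2) by (auto simp: strict_mono_def q_def)
  define r where "r = (\<lambda>n. r1 (q n))"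
  have r: "strict_mono r" using F(2) q by (auto simp: strict_mono_def r_def)
  have fr: "f (r n) = f1 (r2 (r3 n))" for n by (simp add: r_def q_def f1_def)
  have p: "(\<lambda>n. (deriv ^^ m) (f (r n)) z) \<longlonglongrightarrow> (deriv ^^ m) F z" for m z
    using filterlim_compose[OF ptw[of m z] filterlim_subseq[OF q]] by (simp add: r_def)
  have u1: "uniform_limit K (\<lambda>n. deriv (f (r n))) F1 sequentially" if "compact K" for K
    using uniform_limit_subseq[OF F1(3)[OF that] F2(2)] by (simp add: fr)
  have u2: "uniform_limit K (\<lambda>n. scaled_potential (f (r n))) F2 sequentially" if "compact K" for K
    using F2(3)[OF that] by (simp add: fr)
  have "F1 = deriv F"
  proof
    fix z
    have "(\<lambda>n. deriv (f (r n)) z) \<longlonglongrightarrow> F1 z" by (rule tendsto_uniform_limitI[OF u1[of "{z}"]]) auto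
    thus "F1 z = deriv F z" using p[of 1 z] LIMSEQ_unique by auto
  qed
  moreover have "F2 = scaled_potential F"
  proof
    fix z
    have "(\<lambda>n. scaled_potential (f (r n)) z) \<longlonglongrightarrow> F2 z" by (rule tendsto_uniform_limitI[OF u2[of "{z}"]]) auto
    moreover have "(\<lambda>n. scaled_potential (f (r n)) z) \<longlonglongrightarrow> scaled_potential F z"
      unfolding scaled_potential_def schwarzian_part_def using p[of 0 z] p[of 1 z] p[of 2 z]
      by (intro tendsto_intros) (simp_all add: numeral_2_eq_2)
    ultimately show "F2 z = scaled_potential F z" using LIMSEQ_unique by blast
  qed
  moreover have "uniform_limit K (\<lambda>n. f (r n)) F sequentially" if "compact K" for K
    unfolding r_def by (rule uniform_limit_subseq[OF F(3)[OF that] q])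
  ultimately show ?thesis using that[OF F(1) r] u1 u2 by metis
qed

lemma constant_on_UNIV_of_open:
  fixes f :: "complex \<Rightarrow> complex"
  assumes "f holomorphic_on UNIV" "f constant_on S" "open S" "z0 \<in> S"
  shows "f z = f z0"
proof (rule analytic_continuation_open[of S UNIV f "\<lambda>_. f z0"])
  show "f z = f z0" if "z \<in> S" for z using assms(2,4) that unfolding constant_on_def by metis
qed (use assms in auto)

text \<open>
  The theorem of Hurwitz. If the limiting potential is constant, this constant is not \<open>0\<close>, because the
  potential of a non-constant function of exponential type does not vanish identically.
\<close>
lemma Hurwitz_potential:
  assumes F: "exp_type F" "\<not> F constant_on UNIV"
    and hol: "\<And>n. f n holomorphic_on UNIV"
    and u: "\<And>K. compact K \<Longrightarrow> uniform_limit K f F sequentially"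
      "\<And>K. compact K \<Longrightarrow> uniform_limit K (\<lambda>n. scaled_potential (f n)) (scaled_potential F) sequentially"
    and S: "open S" "connected S" "z \<in> S"
    and nz: "\<And>n w. n \<ge> n0 \<Longrightarrow> w \<in> S \<Longrightarrow> f n w \<noteq> 0 \<and> scaled_potential (f n) w \<noteq> 0"
  shows "F z \<noteq> 0" "scaled_potential F z \<noteq> 0"
proof -
  have Fh: "F holomorphic_on UNIV" using F(1) exp_type_holomorphic by blast
  have sm: "strict_mono (\<lambda>n::nat. n + n0)" by (simp add: strict_mono_def)
  have ncF: "\<not> F constant_on S"
  proof
    assume "F constant_on S"
    hence "F w = F z" for w using constant_on_UNIV_of_open[OF Fh _ S(1,3)] by blast
    thus False using F(2) by (auto simp: constant_on_def)
  qed
  show "F z \<noteq> 0"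
  proof (rule Hurwitz_no_zeros[OF S(1,2) _ _ _ ncF _ S(3), of "\<lambda>n. f (n + n0)"])
    show "uniform_limit K (\<lambda>n. f (n + n0)) F sequentially" if "compact K" for K
      by (rule uniform_limit_subseq[OF u(1)[OF that] sm])
  qed (use nz in \<open>auto intro: holomorphic_on_subset[OF hol] holomorphic_on_subset[OF Fh]\<close>)
  show "scaled_potential F z \<noteq> 0"
  proof (cases "scaled_potential F constant_on S")
    case False
    show ?thesis
    proof (rule Hurwitz_no_zeros[OF S(1,2) _ _ _ False _ S(3), of "\<lambda>n. scaled_potential (f (n + n0))"])
      show "uniform_limit K (\<lambda>n. scaled_potential (f (n + n0))) (scaled_potential F) sequentially" if "compact K" for K
        by (rule uniform_limit_subseq[OF u(2)[OF that] sm])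
    qed (use nz in \<open>auto intro: holomorphic_on_subset[OF potential_holomorphic(2)[OF hol]] holomorphic_on_subset[OF potential_holomorphic(2)[OF Fh]]\<close>)
  next
    case True
    have c: "scaled_potential F w = scaled_potential F z" for w
      using constant_on_UNIV_of_open[OF potential_holomorphic(2)[OF Fh] True S(1,3)] .
    show ?thesis
    proof
      assume "scaled_potential F z = 0"
      hence 0: "scaled_potential F = (\<lambda>_. 0)" using c by auto
      have "potential_wronskian F w = 0" for w unfolding potential_wronskian_def 0 by simp
      thus False using potential_wronskian_nonzero[OF F] by blast
    qed
  qed
qed

lemma not_constant_of_deriv:
  fixes F :: "complex \<Rightarrow> complex"
  assumes "deriv F z \<noteq> 0"
  shows "\<not> F constant_on UNIV"
proof
  assume "F constant_on UNIV"
  then obtain c where "F = (\<lambda>_. c)" by (auto simp: constant_on_def)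
  thus False using assms by simp
qed

text \<open>
  Rescale at centres \<open>c n\<close> with lengths \<open>s n ^ 2\<close>, and let \<open>\<beta> n\<close> be the distance from \<open>c n\<close> to the real axis
  measured in units of \<open>s n ^ 2\<close>, with sign. If \<open>\<beta>\<close> stays bounded along a subsequence, moving the centres to the real axis
  keeps the functions normal, and the limit contradicts \<open>no_exp_type_counterexample\<close>. If \<open>\<bar>\<beta> n\<bar>\<close> tends to
  infinity, the limit and its potential have no zeros, contrary to \<open>zero_free_potential_zeros\<close>.
\<close>
proposition constant_of_real_potential_zeros:
  assumes hol: "k holomorphic_on UNIV"
    and zeros_real: "\<And>a. k a = 0 \<Longrightarrow> a \<in> \<real>"
    and potential_zeros_real: "\<And>a. scaled_potential k a = 0 \<Longrightarrow> a \<in> \<real>"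
    and square_real: "\<And>x::real. Im (k (of_real x) ^ 2) = 0"
  shows "k constant_on UNIV"
proof (rule ccontr)
  assume nc: "\<not> k constant_on UNIV"
  have "\<exists>a. deriv k a \<noteq> 0"
  proof (rule ccontr)
    assume "\<not> ?thesis"
    hence "(k has_field_derivative 0) (at z within UNIV)" for z
      using holomorphic_derivI[OF hol open_UNIV UNIV_I, of z UNIV] by simp
    then obtain c where "\<And>z. k z = c" using has_field_derivative_zero_constant[OF convex_UNIV, of k] by auto
    thus False using nc by (auto simp: constant_on_def)
  qed
  then obtain a where a: "deriv k a \<noteq> 0" by blast
  have "\<exists>c s. s > 0 \<and> zalcman_scale (\<lambda>\<zeta>. of_real s * k (c + of_real s ^ 2 * \<zeta>)) 0 = 1 \<and>
     (\<forall>\<zeta>. norm \<zeta> < real n + 1 \<longrightarrow> zalcman_scale (\<lambda>\<zeta>. of_real s * k (c + of_real s ^ 2 * \<zeta>)) \<zeta> \<le> 4)" for n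
    using Zalcman_Brody_rescaling[OF hol a, of "real n + 1"] by (metis add_pos_nonneg add.commute of_nat_0_le_iff zero_less_one)
  then obtain c s where cs: "\<And>n. s n > 0" "\<And>n. zalcman_scale (\<lambda>\<zeta>. of_real (s n) * k (c n + of_real (s n) ^ 2 * \<zeta>)) 0 = 1"
     "\<And>n \<zeta>. norm \<zeta> < real n + 1 \<Longrightarrow> zalcman_scale (\<lambda>\<zeta>. of_real (s n) * k (c n + of_real (s n) ^ 2 * \<zeta>)) \<zeta> \<le> 4"
    by metis
  define g where "g = (\<lambda>n \<zeta>. of_real (s n) * k (c n + of_real (s n) ^ 2 * \<zeta>))"
  have gh: "g n holomorphic_on UNIV" for n unfolding g_def by (rule holomorphic_rescale[OF hol])
  have g0: "1 \<le> norm (deriv (g n) 0)" for n using zalcman_scale_eq_1(1)[OF cs(2)] unfolding g_def .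
  have gb: "norm (g n \<zeta>) \<le> exp (24 * (norm \<zeta> + 2))" if "2 * norm \<zeta> + 2 < real n + 1" for n \<zeta>
    using Clunie_Hayman_bound[OF gh that] cs(2,3) unfolding g_def by blast
  have g_nz: "g n \<zeta> \<noteq> 0 \<and> scaled_potential (g n) \<zeta> \<noteq> 0" if "Im (c n) + s n ^ 2 * Im \<zeta> \<noteq> 0" for n \<zeta>
  proof -
    have "Im (c n + of_real (s n) ^ 2 * \<zeta>) \<noteq> 0" using that by (simp flip: of_real_power)
    hence "c n + of_real (s n) ^ 2 * \<zeta> \<notin> \<real>" by (simp add: complex_is_Real_iff)
    thus ?thesis using zeros_real potential_zeros_real cs(1)[of n] unfolding g_def scaled_potential_rescale[OF hol]
      by (metis less_irrefl mult_eq_0_iff of_real_eq_0_iff power_not_zero)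
  qed
  define \<beta> where "\<beta> = (\<lambda>n. Im (c n) / s n ^ 2)"
  have \<beta>: "Im (c n) = s n ^ 2 * \<beta> n" for n using cs(1)[of n] by (simp add: \<beta>_def)
  show False
  proof (cases "\<exists>M\<ge>0. \<forall>n0. \<exists>n\<ge>n0. \<bar>\<beta> n\<bar> \<le> M")
    case True
    then obtain M where M: "M \<ge> 0" "\<And>n0. \<exists>n\<ge>n0. \<bar>\<beta> n\<bar> \<le> M" by blast
    have "\<exists>n. real n \<ge> 2 * real j + 2 * M + 2 \<and> \<bar>\<beta> n\<bar> \<le> M" for j
    proof -
      obtain n where "n \<ge> nat \<lceil>2 * real j + 2 * M + 2\<rceil>" "\<bar>\<beta> n\<bar> \<le> M" using M(2) by blast
      thus ?thesis by (intro exI[of _ n]) linarith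
    qed
    then obtain N where N: "\<And>j. real (N j) \<ge> 2 * real j + 2 * M + 2" "\<And>j. \<bar>\<beta> (N j)\<bar> \<le> M" by metis
    \<comment> \<open>The centre is moved vertically to the real axis.\<close>
    define f where "f = (\<lambda>j \<zeta>. g (N j) (- \<i> * of_real (\<beta> (N j)) + 1 * \<zeta>))"
    have feq: "f j \<zeta> = of_real (s (N j)) * k (of_real (Re (c (N j))) + of_real (s (N j)) ^ 2 * \<zeta>)" for j \<zeta>
    proof -
      have "c (N j) = of_real (Re (c (N j))) + \<i> * of_real (s (N j) ^ 2 * \<beta> (N j))"
        unfolding \<beta>[symmetric] by (rule complex_eq)
      hence "c (N j) + of_real (s (N j)) ^ 2 * (- \<i> * of_real (\<beta> (N j)) + 1 * \<zeta>)
          = of_real (Re (c (N j))) + of_real (s (N j)) ^ 2 * \<zeta>" by (simp add: algebra_simps)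
      thus ?thesis unfolding f_def g_def by simp
    qed
    have fh: "f j holomorphic_on UNIV" for j
      unfolding feq by (rule holomorphic_rescale[OF hol])
    have fb: "norm (f j z) \<le> exp (24 * (M + 2) * (1 + norm z))" if z: "norm z \<le> real j" for j z
    proof -
      define w where "w = - \<i> * of_real (\<beta> (N j)) + 1 * z"
      have w: "norm w \<le> M + norm z"
        unfolding w_def by (rule order.trans[OF norm_triangle_ineq]) (use N(2)[of j] in \<open>simp add: norm_mult\<close>)
      have "norm (f j z) \<le> exp (24 * (norm w + 2))"
        unfolding f_def w_def[symmetric] by (rule gb) (use w z N(1)[of j] in linarith)
      also have "24 * (norm w + 2) \<le> 24 * (M + 2) * (1 + norm z)"
      proof -
        have "24 * (M + 2) * (1 + norm z) = 24 * M + 48 + 24 * (M * norm z) + 48 * norm z" by (simp add: algebra_simps)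
        moreover have "0 \<le> M * norm z" using M(1) by simp
        ultimately show ?thesis using w norm_ge_zero[of z] by argo
      qed
      finally show ?thesis by simp
    qed
    have fd: "1 \<le> norm (deriv (f j) (\<i> * of_real (\<beta> (N j))))" for j
      using g0[of "N j"] deriv_rescale[OF gh, of 1 "N j" "- \<i> * of_real (\<beta> (N j))" 1 "\<i> * of_real (\<beta> (N j))"]
      unfolding f_def by simp
    obtain F r where F: "exp_type F" "strict_mono (r :: nat \<Rightarrow> nat)"
      "\<And>K. compact K \<Longrightarrow> uniform_limit K (\<lambda>n. f (r n)) F sequentially"
      "\<And>K. compact K \<Longrightarrow> uniform_limit K (\<lambda>n. deriv (f (r n))) (deriv F) sequentially"
      "\<And>K. compact K \<Longrightarrow> uniform_limit K (\<lambda>n. scaled_potential (f (r n))) (scaled_potential F) sequentially"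
      using scaled_potential_limits[of f "24 * (M + 2)", OF fh _ fb] M(1) by (metis add_nonneg_nonneg mult_nonneg_nonneg zero_le_numeral)
    have "eventually (\<lambda>n. \<forall>z\<in>cball 0 M. dist (deriv (f (r n)) z) (deriv F z) < 1) sequentially"
      using F(4)[OF compact_cball[of 0 M]] by (rule uniform_limitD) simp
    then obtain n where n: "\<And>z. z \<in> cball 0 M \<Longrightarrow> dist (deriv (f (r n)) z) (deriv F z) < 1"
      unfolding eventually_sequentially by blast
    have "\<i> * of_real (\<beta> (N (r n))) \<in> cball 0 M" using N(2) by (simp add: norm_mult)
    from n[OF this] have "deriv F (\<i> * of_real (\<beta> (N (r n)))) \<noteq> 0"
      using fd[of "r n"] by (auto simp: dist_norm)
    hence Fnc: "\<not> F constant_on UNIV" by (rule not_constant_of_deriv)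
    have f_nz: "f j z \<noteq> 0 \<and> scaled_potential (f j) z \<noteq> 0" if "Im z \<noteq> 0" for j z
    proof -
      have "Im (of_real (Re (c (N j))) + of_real (s (N j)) ^ 2 * z) \<noteq> 0"
        using that cs(1)[of "N j"] by (simp flip: of_real_power)
      hence "of_real (Re (c (N j))) + of_real (s (N j)) ^ 2 * z \<notin> \<real>" by (simp add: complex_is_Real_iff)
      thus ?thesis using zeros_real potential_zeros_real cs(1)[of "N j"] unfolding feq scaled_potential_rescale[OF hol]
        by (metis less_irrefl mult_eq_0_iff of_real_eq_0_iff power_not_zero)
    qed
    have F_nz: "F z \<noteq> 0 \<and> scaled_potential F z \<noteq> 0" if z: "Im z \<noteq> 0" for z
    proof -
      define S where "S = (if Im z > 0 then {w. Im w > 0} else {w. Im w < 0})"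
      have S: "open S" "connected S" "z \<in> S" "\<And>w. w \<in> S \<Longrightarrow> Im w \<noteq> 0"
        using z by (auto simp: S_def open_halfspace_Im_gt open_halfspace_Im_lt split: if_splits
            intro!: convex_connected convex_halfspace_Im_gt convex_halfspace_Im_lt)
      show ?thesis
        using Hurwitz_potential[OF F(1) Fnc, of "\<lambda>n. f (r n)" S z 0, OF fh F(3,5) S(1-3)] f_nz S(4) by blast
    qed
    show False
    proof (rule no_exp_type_counterexample[OF F(1) Fnc])
      show "a \<in> \<real>" if "F a = 0" for a using F_nz[of a] that by (auto simp: complex_is_Real_iff)
      show "a \<in> \<real>" if "scaled_potential F a = 0" for a using F_nz[of a] that by (auto simp: complex_is_Real_iff)
      fix x :: real
      have "(\<lambda>n. f (r n) (of_real x)) \<longlonglongrightarrow> F (of_real x)"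
        by (rule tendsto_uniform_limitI[OF F(3)[of "{of_real x}"]]) auto
      hence lim: "(\<lambda>n. Im (f (r n) (of_real x) ^ 2)) \<longlonglongrightarrow> Im (F (of_real x) ^ 2)" by (intro tendsto_intros)
      have "Im (f (r n) (of_real x) ^ 2) = 0" for n
      proof -
        define y where "y = Re (c (N (r n))) + s (N (r n)) ^ 2 * x"
        have "f (r n) (of_real x) ^ 2 = of_real (s (N (r n)) ^ 2) * k (of_real y) ^ 2"
          unfolding feq y_def by (simp add: power_mult_distrib)
        thus ?thesis using square_real[of y] by (simp add: Im_complex_of_real)
      qed
      thus "Im (F (of_real x) ^ 2) = 0" using lim by (simp only: LIMSEQ_const_iff)
    qed
  next
    case False
    hence far: "\<exists>n0. \<forall>n\<ge>n0. \<bar>\<beta> n\<bar> > M" if "M \<ge> 0" for M using that by (meson linorder_not_le)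
    have "\<exists>n. real n \<ge> 2 * real j + 2 \<and> \<bar>\<beta> n\<bar> > real j" for j
    proof -
      obtain n0 where n0: "\<And>n. n \<ge> n0 \<Longrightarrow> \<bar>\<beta> n\<bar> > real j" using far[of "real j"] by auto
      show ?thesis by (rule exI[of _ "max n0 (2 * j + 2)"]) (use n0 in auto)
    qed
    then obtain N where N: "\<And>j. real (N j) \<ge> 2 * real j + 2" "\<And>j. \<bar>\<beta> (N j)\<bar> > real j" by metis
    define f where "f = (\<lambda>j. g (N j))"
    have fh: "f j holomorphic_on UNIV" for j unfolding f_def by (rule gh)
    have fb: "norm (f j z) \<le> exp (48 * (1 + norm z))" if z: "norm z \<le> real j" for j z
    proof -
      have "norm (f j z) \<le> exp (24 * (norm z + 2))"
        unfolding f_def by (rule gb) (use z N(1)[of j] in linarith)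
      also have "24 * (norm z + 2) \<le> 48 * (1 + norm z)" by simp
      finally show ?thesis by simp
    qed
    obtain F r where F: "exp_type F" "strict_mono (r :: nat \<Rightarrow> nat)"
      "\<And>K. compact K \<Longrightarrow> uniform_limit K (\<lambda>n. f (r n)) F sequentially"
      "\<And>K. compact K \<Longrightarrow> uniform_limit K (\<lambda>n. deriv (f (r n))) (deriv F) sequentially"
      "\<And>K. compact K \<Longrightarrow> uniform_limit K (\<lambda>n. scaled_potential (f (r n))) (scaled_potential F) sequentially"
      using scaled_potential_limits[of f 48, OF fh _ fb] by (metis zero_le_numeral)
    have "(\<lambda>n. norm (deriv (f (r n)) 0)) \<longlonglongrightarrow> norm (deriv F 0)"
      by (intro tendsto_norm tendsto_uniform_limitI[OF F(4)[of "{0}"]]) auto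
    hence "1 \<le> norm (deriv F 0)" by (rule LIMSEQ_le_const) (use g0 in \<open>auto simp: f_def\<close>)
    hence Fnc: "\<not> F constant_on UNIV" by (intro not_constant_of_deriv[of F 0]) auto
    have f_nz: "f j z \<noteq> 0 \<and> scaled_potential (f j) z \<noteq> 0" if "norm z < real j" for j z
      unfolding f_def
    proof (rule g_nz)
      have "\<bar>Im z\<bar> < \<bar>\<beta> (N j)\<bar>" using abs_Im_le_cmod[of z] that N(2)[of j] by linarith
      hence "\<beta> (N j) + Im z \<noteq> 0" by linarith
      hence "s (N j) ^ 2 * (\<beta> (N j) + Im z) \<noteq> 0" using cs(1)[of "N j"] by simp
      thus "Im (c (N j)) + s (N j) ^ 2 * Im z \<noteq> 0" unfolding \<beta> by (simp add: algebra_simps)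
    qed
    have F_nz: "F z \<noteq> 0 \<and> scaled_potential F z \<noteq> 0" for z
    proof -
      define m where "m = nat \<lceil>norm z\<rceil> + 1"
      have zm: "z \<in> ball 0 (real m)" unfolding m_def by simp linarith
      have nz: "f (r n) w \<noteq> 0 \<and> scaled_potential (f (r n)) w \<noteq> 0" if "n \<ge> m" "w \<in> ball 0 (real m)" for n w
      proof (rule f_nz)
        have "n \<le> r n" using F(2) by (rule seq_suble)
        thus "norm w < real (r n)" using that by simp
      qed
      show ?thesis
        using Hurwitz_potential[OF F(1) Fnc, of "\<lambda>n. f (r n)" "ball 0 (real m)" z m, OF fh F(3,5) open_ball connected_ball zm] nz by blast
    qed
    obtain \<alpha> b where "\<And>n :: int. scaled_potential F ((Ln (4 * \<alpha>\<^sup>2) + 2 * of_int n * pi * \<i> - 4 * b) / (4 * \<alpha>)) = 0"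
      using zero_free_potential_zeros[OF F(1) _ Fnc] F_nz by metis
    thus False using F_nz by blast
  qed
qed

section \<open>Reduction of the differential equation\<close>

lemma deriv_shift_left: "deriv (\<lambda>x. f (a + x)) = (\<lambda>x. deriv f (a + x))"
  by (rule ext) (simp add: deriv_def DERIV_shift add.commute)

lemma eventually_not_pole:
  assumes "f nicely_meromorphic_on UNIV"
  shows "eventually (\<lambda>z. \<not> is_pole f z) (at z)"
proof -
  have "f meromorphic_on UNIV" using assms by (simp add: nicely_meromorphic_on_def)
  hence "eventually (\<lambda>z. \<not> is_pole f z) (cosparse UNIV)" by (rule meromorphic_on_imp_not_pole_cosparse)
  thus ?thesis by (simp add: eventually_cosparse_open_eq)
qed

text \<open>
  At a pole of \<open>w\<close> of order \<open>p\<close> the second derivative has order \<open>p + 2\<close>, so \<open>H\<close> has a pole of order \<open>2\<close>.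
\<close>
lemma pole_of_solution:
  assumes H: "H nicely_meromorphic_on UNIV" and w: "w nicely_meromorphic_on UNIV"
    and ode: "solves_ode H w" and a: "is_pole w a"
  shows "is_pole H a"
proof (rule ccontr)
  assume nH: "\<not> is_pole H a"
  obtain F where F: "(\<lambda>x. w (a + x)) has_laurent_expansion F"
    using w unfolding nicely_meromorphic_on_def meromorphic_on_def by blast
  obtain K where K: "(\<lambda>x. H (a + x)) has_laurent_expansion K"
    using H unfolding nicely_meromorphic_on_def meromorphic_on_def by blast
  have sF: "fls_subdegree F < 0" using is_pole_imp_neg_fls_subdegree[OF F a] .
  have sK: "fls_subdegree K \<ge> 0" using is_pole_fls_subdegree_iff[OF K] nH by simp
  have s1: "fls_subdegree (fls_deriv F) = fls_subdegree F - 1" using sF by (intro fls_subdegree_deriv) simp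
  have s2: "fls_subdegree (fls_deriv (fls_deriv F)) = fls_subdegree F - 2"
    using s1 sF by (subst fls_subdegree_deriv) simp_all
  have L: "(\<lambda>x. (deriv ^^ 2) w (a + x)) has_laurent_expansion fls_deriv (fls_deriv F)"
    using has_laurent_expansion_deriv[OF has_laurent_expansion_deriv[OF F]]
    by (simp add: deriv_shift_left numeral_2_eq_2)
  have "eventually (\<lambda>z. (deriv ^^ 2) w z = - (H z * w z)) (at a)"
    using eventually_not_pole[OF w, of a] eventually_not_pole[OF H, of a]
  proof eventually_elim
    case (elim z)
    hence "(deriv ^^ 2) w z + H z * w z = 0" using ode unfolding solves_ode_def by blast
    thus ?case by (simp add: add_eq_0_iff)
  qed
  hence "eventually (\<lambda>x. (deriv ^^ 2) w (a + x) = - (H (a + x) * w (a + x))) (at 0)"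
    by (subst (asm) at_to_0) (simp add: eventually_filtermap add.commute)
  moreover have "(\<lambda>x. - (H (a + x) * w (a + x))) has_laurent_expansion - (K * F)"
    by (intro laurent_expansion_intros F K)
  ultimately have "(\<lambda>x. (deriv ^^ 2) w (a + x)) has_laurent_expansion - (K * F)"
    by (subst has_laurent_expansion_cong[OF _ refl])
  hence eq: "fls_deriv (fls_deriv F) = - (K * F)" using L has_laurent_expansion_unique by blast
  have "fls_deriv (fls_deriv F) \<noteq> 0" using s2 sF by auto
  hence "K \<noteq> 0" "F \<noteq> 0" using eq by auto
  hence "fls_subdegree (- (K * F)) = fls_subdegree K + fls_subdegree F" by simp
  thus False using eq s2 sK by simp
qed

lemma schwarz_refl_deriv:
  assumes "(f has_field_derivative D) (at (cnj z))"
  shows "(schwarz_refl f has_field_derivative cnj D) (at z)"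
  using has_field_derivative_cnj_cnj[OF assms] by (simp add: schwarz_refl_def o_def)

text \<open>
  Carries identities on the real axis across the poles of \<open>w\<close> and \<open>H\<close>, which are isolated.
\<close>
lemma real_limit_property:
  fixes F :: "complex \<Rightarrow> real"
  assumes cont: "continuous_on UNIV F" and ev: "\<And>z :: complex. eventually (\<lambda>z. z \<in> U) (at z)"
    and 0: "\<And>x. of_real x \<in> U \<Longrightarrow> F (of_real x) = c"
  shows "F (of_real x) = c"
proof -
  define s where "s = (\<lambda>n::nat. of_real (x + 1 / (real n + 1)) :: complex)"
  have "(\<lambda>n::nat. x + 1 / (real n + 1)) \<longlonglongrightarrow> x" by real_asymp
  hence s: "s \<longlonglongrightarrow> of_real x" unfolding s_def by (rule tendsto_of_real)
  have ne: "s n \<noteq> of_real x" for n unfolding s_def of_real_eq_iff by simp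
  have "filterlim s (at (of_real x)) sequentially" using s ne by (intro filterlim_atI) auto
  hence "eventually (\<lambda>n. s n \<in> U) sequentially" using ev filterlim_iff by blast
  hence evc: "eventually (\<lambda>n. F (s n) = c) sequentially"
    by eventually_elim (unfold s_def, rule 0)
  have "(\<lambda>n. F (s n)) \<longlonglongrightarrow> F (of_real x)"
    by (rule continuous_on_tendsto_compose[OF cont s]) auto
  from Lim_transform_eventually[OF this evc] have "(\<lambda>n. c) \<longlonglongrightarrow> F (of_real x)" .
  thus ?thesis by (simp add: LIMSEQ_const_iff)
qed

theorem corollary1p1:
  fixes H w :: "complex \<Rightarrow> complex"
  assumes H_mero: "H nicely_meromorphic_on UNIV"
    and H_nonconst: "\<not> H constant_on UNIV"
    and H_real: "real_function H"
    and H_zeros: "\<And>z. isolated_zero H z \<Longrightarrow> z \<in> \<real>"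
    and H_poles: "\<And>z. is_pole H z \<Longrightarrow> z \<in> \<real>"
    and w_mero: "w nicely_meromorphic_on UNIV"
    and w_snr: "strictly_non_real w"
    and w_ode: "solves_ode H w"
  shows "\<exists>z. z \<notin> \<real> \<and> isolated_zero w z"
proof (rule ccontr)
  assume "\<not> ?thesis"
  hence w_zeros: "z \<in> \<real>" if "isolated_zero w z" for z using that by blast
  have w_poles: "is_pole H z" if "is_pole w z" for z
    using pole_of_solution[OF H_mero w_mero w_ode that] .
  define S where "S = {z. is_pole w z \<or> is_pole H z}"
  define U where "U = - S"
  have S_real: "z \<in> \<real>" if "z \<in> S" for z using that w_poles H_poles by (auto simp: S_def)
  have evU: "eventually (\<lambda>z. z \<in> U) (at z)" for z
    using eventually_not_pole[OF w_mero, of z] eventually_not_pole[OF H_mero, of z]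
    by eventually_elim (auto simp: U_def S_def)
  have sparse: "S sparse_in UNIV"
  proof -
    have "eventually (\<lambda>z. z \<in> U) (cosparse UNIV)" using evU by (simp add: eventually_cosparse_open_eq)
    thus ?thesis by (simp add: eventually_cosparse U_def)
  qed
  have U: "open U" "connected U"
  proof -
    have "connected (UNIV - S)" by (rule sparse_imp_connected[OF _ connected_UNIV open_UNIV sparse]) simp
    thus "connected U" by (simp add: U_def Compl_eq_Diff_UNIV)
    show "open U"
    proof (subst open_subopen, intro ballI)
      fix z assume z: "z \<in> U"
      hence "eventually (\<lambda>z. z \<in> U) (nhds z)" using evU[of z] by (simp add: eventually_nhds_conv_at)
      thus "\<exists>T. open T \<and> z \<in> T \<and> T \<subseteq> U" unfolding eventually_nhds by blast
    qed
  qed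
  have U_cnj: "cnj z \<in> U" if "z \<in> U" for z
  proof (rule ccontr)
    assume "cnj z \<notin> U"
    hence s: "cnj z \<in> S" by (simp add: U_def)
    hence "cnj z = z" using S_real[OF s] by (simp add: complex_is_Real_iff complex_eq_iff)
    thus False using s that by (simp add: U_def)
  qed
  obtain z0 where z0: "z0 \<in> U"
    using evU[of 0] by (metis (mono_tags, lifting) eventually_happens' trivial_limit_at)
  have w_an: "w analytic_on {z}" if "\<not> is_pole w z" for z
    using nicely_meromorphic_on_imp_analytic_at[OF w_mero _ that] by simp
  have H_an: "H analytic_on {z}" if "\<not> is_pole H z" for z
    using nicely_meromorphic_on_imp_analytic_at[OF H_mero _ that] by simp
  have holU: "w holomorphic_on U"
  proof -
    have "w analytic_on U" by (subst analytic_on_analytic_at) (use w_an in \<open>auto simp: U_def S_def\<close>)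
    thus ?thesis by (rule analytic_imp_holomorphic)
  qed
  have w1: "(w has_field_derivative deriv w z) (at z)" if "z \<in> U" for z
    by (rule holomorphic_derivI[OF holU U(1) that])
  have w2: "(deriv w has_field_derivative - (H z * w z)) (at z)" if "z \<in> U" for z
  proof -
    have "(deriv ^^ 2) w z + H z * w z = 0" using w_ode that unfolding solves_ode_def U_def S_def by blast
    hence "deriv (deriv w) z = - (H z * w z)" by (simp add: numeral_2_eq_2 add_eq_0_iff)
    thus ?thesis using holomorphic_derivI[OF holomorphic_deriv[OF holU U(1)] U(1) that, of UNIV] by simp
  qed
  define v where "v = schwarz_refl w"
  define v' where "v' = schwarz_refl (deriv w)"
  have v1: "(v has_field_derivative v' z) (at z)" if "z \<in> U" for z
    unfolding v_def v'_def using schwarz_refl_deriv[OF w1[OF U_cnj[OF that]]]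
    by (simp add: schwarz_refl_def)
  have Hr: "cnj (H (cnj z)) = H z" for z
    using H_real unfolding real_function_def schwarz_refl_def by metis
  have v2: "(v' has_field_derivative - (H z * v z)) (at z)" if "z \<in> U" for z
    unfolding v_def v'_def using schwarz_refl_deriv[OF w2[OF U_cnj[OF that]]]
    by (simp add: schwarz_refl_def Hr)
  define W where "W = (\<lambda>z. w z * v' z - deriv w z * v z)"
  have Wd: "(W has_field_derivative 0) (at z)" if "z \<in> U" for z
    unfolding W_def by (rule derivative_eq_intros w1[OF that] w2[OF that] v1[OF that] v2[OF that] refl)+ (simp add: algebra_simps)
  obtain c where c: "\<And>z. z \<in> U \<Longrightarrow> W z = c"
  proof (rule DERIV_zero_connected_constant[OF U(2,1) finite.emptyI])
    show "continuous_on U W" using Wd by (meson DERIV_isCont continuous_at_imp_continuous_on)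
  qed (use Wd in auto)
  have w_not_zero: "\<not> (\<forall>z\<in>U. w z = 0)"
  proof
    assume 0: "\<forall>z\<in>U. w z = 0"
    have fr: "frequently (\<lambda>z. w z = 0) (at z0)"
      by (rule eventually_frequently) (use evU[of z0] 0 in \<open>auto elim: eventually_mono\<close>)
    have "w z = 0" for z using frequently_eq_meromorphic_imp_constant[OF fr w_mero open_UNIV connected_UNIV] by simp
    thus False using w_snr unfolding strictly_non_real_def constant_on_def by blast
  qed
  have w_freq: "eventually (\<lambda>x. w x \<noteq> 0) (at z)" for z
  proof (rule ccontr)
    assume "\<not> ?thesis"
    hence fr: "frequently (\<lambda>x. w x = 0) (at z)" by (simp add: frequently_def)
    have "w y = 0" for y using frequently_eq_meromorphic_imp_constant[OF fr w_mero open_UNIV connected_UNIV] by simp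
    thus False using w_not_zero by blast
  qed
  have c0: "c \<noteq> 0"
  proof
    assume "c = 0"
    obtain z1 where z1: "z1 \<in> U" "w z1 \<noteq> 0" using w_not_zero by blast
    have "open (U \<inter> w -` (- {0}))"
      by (rule continuous_open_preimage[OF holomorphic_on_imp_continuous_on[OF holU] U(1)]) auto
    moreover have "U \<inter> w -` (- {0}) = {z \<in> U. w z \<noteq> 0}" by auto
    ultimately have "open {z \<in> U. w z \<noteq> 0}" by simp
    then obtain e where e: "e > 0" "ball z1 e \<subseteq> {z \<in> U. w z \<noteq> 0}"
      using z1 unfolding open_contains_ball by blast
    have "((\<lambda>z. v z / w z) has_field_derivative 0) (at z within ball z1 e)" if z: "z \<in> ball z1 e" for z
    proof -
      have zU: "z \<in> U" "w z \<noteq> 0" using e z by auto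
      have "((\<lambda>z. v z / w z) has_field_derivative (v' z * w z - v z * deriv w z) / (w z * w z)) (at z)"
        by (intro DERIV_divide v1 w1 zU)
      moreover have "v' z * w z - v z * deriv w z = 0" using c[OF zU(1)] \<open>c = 0\<close> by (simp add: W_def mult.commute)
      ultimately show ?thesis by (simp add: has_field_derivative_at_within)
    qed
    then obtain d where d: "\<And>z. z \<in> ball z1 e \<Longrightarrow> v z / w z = d"
      using has_field_derivative_zero_constant[OF convex_ball, of z1 e "\<lambda>z. v z / w z"] by blast
    have v_hol: "v holomorphic_on U"
      unfolding holomorphic_on_open[OF U(1)] using v1 by blast
    have vw: "v z = d * w z" if "z \<in> U" for z
    proof (rule analytic_continuation_open[of "ball z1 e" U v "\<lambda>z. d * w z"])
      show "ball z1 e \<subseteq> U" using e by blast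
      show "(\<lambda>z. d * w z) holomorphic_on U" by (intro holomorphic_intros holU)
      show "v z = d * w z" if z: "z \<in> ball z1 e" for z
      proof -
        have "w z \<noteq> 0" using e z by blast
        thus ?thesis using d[OF z] by (simp add: field_simps)
      qed
    qed (use e U v_hol that in auto)
    have "remove_sings (\<lambda>z. schwarz_refl w z / w z) z = d" for z
    proof (rule remove_sings_eqI)
      have "eventually (\<lambda>x. d = schwarz_refl w x / w x) (at z)"
        using evU[of z] w_freq[of z]
        by eventually_elim (simp add: vw[unfolded v_def])
      thus "(\<lambda>z. schwarz_refl w z / w z) \<midarrow>z\<rightarrow> d" by (rule Lim_transform_eventually[OF tendsto_const])
    qed
    thus False using w_snr unfolding strictly_non_real_def constant_on_def by blast
  qed
  have w_nz: "w z \<noteq> 0" if np: "\<not> is_pole w z" for z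
  proof
    assume wz: "w z = 0"
    have "w \<midarrow>z\<rightarrow> 0" using analytic_at_imp_isCont[OF w_an[OF np]] wz by (simp add: isCont_def)
    with w_freq[of z] have "isolated_zero w z" by (simp add: isolated_zero_def)
    hence zr: "cnj z = z" using w_zeros by (simp add: complex_is_Real_iff complex_eq_iff)
    obtain A where A: "open A" "z \<in> A" "w holomorphic_on A" using w_an[OF np] by (auto simp: analytic_at)
    have wi: "isCont w z" "isCont (deriv w) z"
      using A by (meson continuous_on_eq_continuous_at holomorphic_on_imp_continuous_on holomorphic_deriv)+
    have vi: "isCont v z" "isCont v' z" unfolding v_def v'_def schwarz_refl_def
      by (intro isCont_cnj isCont_o2[of z cnj] ; simp add: zr wi)+
    have "isCont W z" unfolding W_def by (intro continuous_intros wi vi)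
    hence "W \<midarrow>z\<rightarrow> W z" by (simp add: isCont_def)
    moreover have "W z = 0" by (simp add: W_def v_def schwarz_refl_def zr wz)
    moreover have "W \<midarrow>z\<rightarrow> c"
    proof (rule Lim_transform_eventually[OF tendsto_const])
      show "eventually (\<lambda>x. c = W x) (at z)" using evU[of z] by eventually_elim (simp add: c)
    qed
    ultimately show False using c0 LIM_unique by fastforce
  qed
  define e where "e = (\<lambda>z. inverse (w z))"
  have w_pole0: "w z = 0" if "is_pole w z" for z
    using w_mero that unfolding nicely_meromorphic_on_def
    by (metis UNIV_I at_neq_bot is_pole_def not_tendsto_and_filterlim_at_infinity)
  have e_lim: "e \<midarrow>z\<rightarrow> e z" for z
  proof (cases "is_pole w z")
    case True
    have "e \<midarrow>z\<rightarrow> 0" unfolding e_def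
      using filterlim_compose[OF tendsto_inverse_0 True[unfolded is_pole_def]] .
    thus ?thesis using w_pole0[OF True] by (simp add: e_def)
  next
    case False
    thus ?thesis unfolding e_def using analytic_at_imp_isCont[OF w_an[OF False]] w_nz[OF False]
      by (intro tendsto_inverse) (auto simp: isCont_def)
  qed
  have "e analytic_on UNIV"
  proof (rule nicely_meromorphic_without_singularities)
    have "e meromorphic_on UNIV" unfolding e_def
      using w_mero by (intro meromorphic_intros) (auto simp: nicely_meromorphic_on_def)
    thus "e nicely_meromorphic_on UNIV" using e_lim by (simp add: nicely_meromorphic_on_def)
    show "\<forall>z\<in>UNIV. \<not> is_pole e z" using e_lim
      by (metis at_neq_bot is_pole_def not_tendsto_and_filterlim_at_infinity)
  qed
  hence e_hol: "e holomorphic_on UNIV" by (rule analytic_imp_holomorphic)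
  have U_nz: "w z \<noteq> 0" "v z \<noteq> 0" "e z \<noteq> 0" if "z \<in> U" for z
  proof -
    show "w z \<noteq> 0" using w_nz that by (auto simp: U_def S_def)
    thus "e z \<noteq> 0" by (simp add: e_def)
    have "w (cnj z) \<noteq> 0" using w_nz U_cnj[OF that] by (auto simp: U_def S_def)
    thus "v z \<noteq> 0" by (simp add: v_def schwarz_refl_def)
  qed
  \<comment> \<open>The derivative of \<open>v / w\<close> is \<open>c / w^2 = c * e^2\<close>, which is entire; its primitive extends \<open>v / w\<close> across the poles
  of \<open>w\<close> and \<open>H\<close>.\<close>
  obtain E where E: "\<And>z. (E has_field_derivative c * e z ^ 2) (at z)"
  proof -
    have "(\<lambda>z. c * e z ^ 2) holomorphic_on UNIV" by (intro holomorphic_intros e_hol)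
    from holomorphic_convex_primitive'[OF convex_UNIV open_UNIV this]
    obtain E where "\<And>z. z \<in> UNIV \<Longrightarrow> (E has_field_derivative c * e z ^ 2) (at z within UNIV)" by metis
    thus thesis by (intro that[of E]) simp
  qed
  have ud: "((\<lambda>z. v z / w z) has_field_derivative c * e z ^ 2) (at z)" if z: "z \<in> U" for z
  proof -
    have "((\<lambda>z. v z / w z) has_field_derivative (v' z * w z - v z * deriv w z) / (w z * w z)) (at z)"
      by (intro DERIV_divide v1 w1 z U_nz)
    moreover have "v' z * w z - v z * deriv w z = c" using c[OF z] by (simp add: W_def mult.commute)
    ultimately show ?thesis by (simp add: e_def power2_eq_square divide_inverse)
  qed
  obtain b where b: "\<And>z. z \<in> U \<Longrightarrow> v z / w z - E z = b"
  proof (rule DERIV_zero_connected_constant[OF U(2,1) finite.emptyI])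
    have d: "((\<lambda>z. v z / w z - E z) has_field_derivative 0) (at z)" if "z \<in> U" for z
      using DERIV_diff[OF ud[OF that] E] by simp
    thus "continuous_on U (\<lambda>z. v z / w z - E z)" by (meson DERIV_isCont continuous_at_imp_continuous_on)
    show "\<forall>x\<in>U - {}. ((\<lambda>z. v z / w z - E z) has_field_derivative 0) (at x)" using d by auto
  qed auto
  define u where "u = (\<lambda>z. E z + b)"
  have uU: "u z = v z / w z" if "z \<in> U" for z using b[OF that] by (simp add: u_def algebra_simps)
  have u1: "(u has_field_derivative c * e z ^ 2) (at z)" for z
    unfolding u_def by (rule DERIV_cong[OF DERIV_add[OF E DERIV_const]]) simp
  have u_hol: "u holomorphic_on UNIV" using u1 by (auto simp: holomorphic_on_open)
  have u_norm: "norm (u (of_real x)) = 1" for x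
  proof (rule real_limit_property[where F = "\<lambda>z. norm (u z)", OF _ evU])
    show "continuous_on UNIV (\<lambda>z. norm (u z))"
      by (intro continuous_on_norm holomorphic_on_imp_continuous_on u_hol)
    fix x assume x: "of_real x \<in> U"
    show "norm (u (of_real x)) = 1" using U_nz(1)[OF x] unfolding uU[OF x]
      by (simp add: v_def schwarz_refl_def norm_divide)
  qed
  have u_nz: "u z \<noteq> 0" for z
  proof (cases "z \<in> U")
    case True
    thus ?thesis using U_nz uU by simp
  next
    case False
    hence "z \<in> \<real>" using S_real by (simp add: U_def)
    then obtain x where "z = of_real x" by (rule Reals_cases)
    thus ?thesis using u_norm[of x] by auto
  qed
  obtain g where g: "g holomorphic_on UNIV" "\<And>z. u z = exp (g z)"
    using exp_form_on_plane[OF u_hol u_nz] by metis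
  \<comment> \<open>With this normalization \<open>g' = - \<i> k^2\<close>, so that \<open>w\<close> is a multiple of \<open>exp (- g / 2) / k\<close> and \<open>4 H k^2\<close> is
  exactly \<open>scaled_potential k\<close>.\<close>
  define \<kappa> where "\<kappa> = csqrt (\<i> * c)"
  have \<kappa>: "\<kappa> ^ 2 = \<i> * c" "\<kappa> \<noteq> 0" using c0 by (auto simp: \<kappa>_def)
  define k where "k = (\<lambda>z. \<kappa> * e z * exp (- g z / 2))"
  have k_hol: "k holomorphic_on UNIV" unfolding k_def by (intro holomorphic_intros e_hol g) auto
  have ksq: "k z ^ 2 = \<i> * c * e z ^ 2 / u z" for z
  proof -
    have "exp (- g z / 2) ^ 2 = inverse (exp (g z))"
      by (simp add: power2_eq_square flip: exp_minus exp_add)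
    thus ?thesis unfolding k_def power_mult_distrib \<kappa>(1) g(2) by (simp only: divide_inverse)
  qed
  have k_real: "a \<in> \<real>" if "k a = 0" for a
  proof -
    have "w a = 0" using that \<kappa>(2) by (simp add: k_def e_def)
    hence "is_pole w a" using w_nz by blast
    thus ?thesis using S_real by (simp add: S_def)
  qed
  have sq_real: "Im (k (of_real x) ^ 2) = 0" for x
  proof (rule real_limit_property[where F = "\<lambda>z. Im (k z ^ 2)", OF _ evU])
    show "continuous_on UNIV (\<lambda>z. Im (k z ^ 2))"
      by (intro continuous_intros holomorphic_on_imp_continuous_on k_hol)
    fix x assume x: "of_real x \<in> U"
    \<comment> \<open>Hence \<open>\<i> * c\<close> is real, and so is \<open>k^2 = \<i> * c / (w * v)\<close> on the real axis.\<close>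
    have "c = w (of_real x) * cnj (deriv w (of_real x)) - deriv w (of_real x) * cnj (w (of_real x))"
      using c[OF x] by (simp add: W_def v_def v'_def schwarz_refl_def)
    hence "Re c = 0" by simp
    have "k (of_real x) ^ 2 = \<i> * c / (w (of_real x) * v (of_real x))"
      unfolding ksq uU[OF x] e_def using U_nz[OF x] by (simp add: power2_eq_square field_simps)
    also have "w (of_real x) * v (of_real x) = of_real (norm (w (of_real x)) ^ 2)"
      by (simp add: v_def schwarz_refl_def complex_norm_square[symmetric] del: of_real_power)
    also have "\<i> * c / of_real (norm (w (of_real x)) ^ 2) = of_real (- Im c / norm (w (of_real x)) ^ 2)"
      using \<open>Re c = 0\<close> by (simp add: complex_eq_iff)
    finally show "Im (k (of_real x) ^ 2) = 0" by (simp only: Im_complex_of_real)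
  qed
  have gap: "scaled_potential k z = 4 * H z * k z ^ 2 \<and> k z \<noteq> 0" if z: "z \<in> U" for z
  proof
    have kd: "(k has_field_derivative deriv k y) (at y)" for y
      using holomorphic_derivI[OF k_hol open_UNIV] by simp
    have knz: "k y \<noteq> 0" if "y \<in> U" for y using U_nz[OF that] \<kappa> by (simp add: k_def)
    show "k z \<noteq> 0" by (rule knz[OF z])
    have gd: "(g has_field_derivative - \<i> * k y ^ 2) (at y)" for y
    proof -
      have gd: "(g has_field_derivative deriv g y) (at y)" using holomorphic_derivI[OF g(1) open_UNIV] by simp
      hence "((\<lambda>y. exp (g y)) has_field_derivative exp (g y) * deriv g y) (at y)" by (rule DERIV_fun_exp)
      hence "(u has_field_derivative u y * deriv g y) (at y)" by (simp add: g(2)[symmetric])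
      hence "u y * deriv g y = c * e y ^ 2" using u1 DERIV_unique by blast
      hence "deriv g y = - \<i> * k y ^ 2" unfolding ksq using u_nz[of y] by (simp add: field_simps)
      thus ?thesis using gd by simp
    qed
    have G: "deriv k y / k y = - deriv w y / w y + \<i> / 2 * k y ^ 2" if y: "y \<in> U" for y
    proof -
      have "((\<lambda>y. inverse (w y)) has_field_derivative - (deriv w y / w y ^ 2)) (at y)"
        using DERIV_inverse_fun[OF w1[OF y] U_nz(1)[OF y]] by (simp add: field_simps power2_eq_square)
      hence ed: "(e has_field_derivative - (deriv w y / w y ^ 2)) (at y)" unfolding e_def .
      have "((\<lambda>y. exp (- g y / 2)) has_field_derivative exp (- g y / 2) * (- (- \<i> * k y ^ 2) / 2)) (at y)"
        by (intro DERIV_fun_exp DERIV_cdivide DERIV_minus gd)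
      from DERIV_mult[OF DERIV_cmult[OF ed, of \<kappa>] this]
      have "((\<lambda>y. \<kappa> * e y * exp (- g y / 2)) has_field_derivative
         k y * (- deriv w y / w y + \<i> / 2 * k y ^ 2)) (at y)"
      proof (rule DERIV_cong)
        have alg: "\<kappa> * - (deriv w y / w y ^ 2) * X + X * (- (- \<i> * q) / 2) * (\<kappa> * e y) =
            \<kappa> * e y * X * (- deriv w y / w y + \<i> / 2 * q)" for X q
          using U_nz(1)[OF y] by (simp add: e_def field_simps power2_eq_square)
        have ky: "k y = \<kappa> * e y * exp (- g y / 2)" by (simp add: k_def)
        show "\<kappa> * - (deriv w y / w y ^ 2) * exp (- g y / 2) + exp (- g y / 2) * (- (- \<i> * k y ^ 2) / 2) * (\<kappa> * e y) =
            k y * (- deriv w y / w y + \<i> / 2 * k y ^ 2)"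
          unfolding alg ky[symmetric] ..
      qed
      hence "(k has_field_derivative k y * (- deriv w y / w y + \<i> / 2 * k y ^ 2)) (at y)"
        by (simp only: k_def)
      hence "deriv k y = k y * (- deriv w y / w y + \<i> / 2 * k y ^ 2)" by (rule DERIV_imp_deriv)
      thus ?thesis using knz[OF y] by simp
    qed
    define G where "G = deriv k z / k z"
    have dk: "deriv k z = k z * G" using knz[OF z] by (simp add: G_def)
    have w'w: "deriv w z / w z = \<i> / 2 * k z ^ 2 - G" using G[OF z] by (simp add: G_def)
    have "((\<lambda>y. - (deriv w y / w y) + \<i> / 2 * k y ^ 2) has_field_derivative
        - ((- (H z * w z) * w z - deriv w z * deriv w z) / (w z * w z)) + \<i> / 2 * (2 * k z * deriv k z)) (at z)"
      by (intro DERIV_add DERIV_minus DERIV_divide DERIV_cmult w1 w2 z U_nz) (auto intro!: derivative_eq_intros kd)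
    hence "((\<lambda>y. deriv k y / k y) has_field_derivative
        - ((- (H z * w z) * w z - deriv w z * deriv w z) / (w z * w z)) + \<i> / 2 * (2 * k z * deriv k z)) (at z)"
      by (rule has_field_derivative_transform_within_open[OF _ U(1) z]) (simp add: G)
    moreover have "- ((- (H z * w z) * w z - deriv w z * deriv w z) / (w z * w z)) = H z + (deriv w z / w z) ^ 2"
      using U_nz(1)[OF z] by (simp add: field_simps power2_eq_square)
    ultimately have "((\<lambda>y. deriv k y / k y) has_field_derivative H z + (\<i> / 2 * k z ^ 2 - G) ^ 2 + \<i> / 2 * (2 * k z * (k z * G))) (at z)"
      by (simp only: w'w dk)
    from schwarzian_part_logderiv[OF k_hol knz[OF z] this, folded G_def]
    have "schwarzian_part k z = k z ^ 2 * (4 * (H z + (\<i> / 2 * k z ^ 2 - G) ^ 2 + \<i> / 2 * (2 * k z * (k z * G)) - G ^ 2))" .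
    also have "\<dots> = k z ^ 2 * (4 * H z - k z ^ 4)"
      by (simp add: power2_eq_square eval_nat_numeral algebra_simps)
    finally show "scaled_potential k z = 4 * H z * k z ^ 2" unfolding scaled_potential_def
      by (simp add: algebra_simps eval_nat_numeral)
  qed
  have gap_real: "a \<in> \<real>" if "scaled_potential k a = 0" for a
  proof (rule ccontr)
    assume a: "a \<notin> \<real>"
    hence aU: "a \<in> U" using S_real by (auto simp: U_def)
    have "H a = 0" using gap[OF aU] that by auto
    have np: "\<not> is_pole H a" using aU by (simp add: U_def S_def)
    have "\<not> frequently (\<lambda>x. H x = 0) (at a)"
    proof
      assume fr: "frequently (\<lambda>x. H x = 0) (at a)"
      have "H y = 0" for y using frequently_eq_meromorphic_imp_constant[OF fr H_mero open_UNIV connected_UNIV] by simp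
      thus False using H_nonconst by (auto simp: constant_on_def)
    qed
    moreover have "H \<midarrow>a\<rightarrow> 0" using analytic_at_imp_isCont[OF H_an[OF np]] \<open>H a = 0\<close> by (simp add: isCont_def)
    ultimately have "isolated_zero H a" by (simp add: isolated_zero_def frequently_def)
    thus False using H_zeros a by blast
  qed
  have "k constant_on UNIV" by (rule constant_of_real_potential_zeros[OF k_hol k_real gap_real sq_real])
  then obtain K where K: "k = (\<lambda>_. K)" by (auto simp: constant_on_def)
  have "H z = K ^ 4 / 4" if "z \<in> U" for z
  proof -
    have "4 * H z * K ^ 2 = K ^ 6" "K \<noteq> 0" using gap[OF that] by (simp_all add: scaled_potential_def schwarzian_part_def K)
    hence "K ^ 2 * (4 * H z) = K ^ 2 * K ^ 4" by (simp flip: power_add add: mult.commute)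
    hence 4: "4 * H z = K ^ 4" by (subst (asm) mult_left_cancel) (use \<open>K \<noteq> 0\<close> in simp)
    show ?thesis unfolding 4[symmetric] by simp
  qed
  hence "H constant_on U" unfolding constant_on_def by blast
  hence "H constant_on UNIV"
    by (rule constant_on_extend_nicely_meromorphic_on[OF H_mero]) (use U z0 in auto)
  thus False using H_nonconst by blast
qed

end
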